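(* The macro--micro parallel BUG scheme (defined in the context) for the thermal radiative transfer equations is asymptotic-preserving: in the limit $\varepsilon\to0$ (all discretization parameters fixed) the scheme preserves the discrete Rosseland diffusion equation $$\frac{c_\nu}{\Delta t}\left(T^{n+1}-T^n\right)+\frac{2\pi}{c\Delta t}\left(B^{n+1}-B^n\right)=\frac{2\pi}3\left[\mathbf{D}^0_x\left((\Sigma^t)^{-1}\mathbf{d}^0_xB^n\right)+\mathbf{D}^0_y\left((\Sigma^t)^{-1}\mathbf{d}^0_yB^n\right)\right].$$ This is a 5-point centered difference discretization on a staggered grid, with explicit time discretization, of the Rosseland diffusion equation (given in the context).
   Context: Constants: $\varepsilon,c,a,c_\nu,\Delta t,\Delta x,\Delta y>0$. Cross sections $\sigma^a(x)\ge\sigma^a_0>0$, $\sigma^t=\sigma^a+\sigma^s\ge\sigma^t_0>0$. The Rosseland equation, in the two-dimensional projected geometry, is $c_\nu\partial_tT+\frac{2\pi}{c}\partial_tB(T)=\frac{2\pi}{3}\nabla\cdot(\frac{1}{\sigma^t}\nabla B(T))$, $B(T)=\frac{ac}{2\pi}T^4$. Staggered grid: points $x_i,x_{i+1/2}$ (spacing $\Delta x$), $y_j,y_{j+1/2}$ (spacing $\Delta y$). $\mathcal{K}^C$: indices $(i,j)$ (cell centers) and $(i+\frac12,j+\frac12)$ (corners), $N^C$ of them; $\mathcal{K}^I$: indices $(i+\frac12,j)$ and $(i,j+\frac12)$ (interfaces), $N^I$ of them. $T,h\in\mathbb{R}^{N^C}$ are grid functions on $\mathcal{K}^C$; $\mathbf{g}\in\mathbb{R}^{N^I\times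 N_q}$ has rows $g_\kappa^\top$, $\kappa\in\mathcal{K}^I$. $B^n=B(T^n)=\frac{ac}{2\pi}(T^n)^4$ pointwise. $\Sigma^t$ is the diagonal matrix with entries $\sigma^t_\kappa$, $\kappa\in\mathcal{K}^I$. Angular discretization: product quadrature on the projected unit sphere with nodes $(\Omega_x^\ell,\Omega_y^\ell)$ and positive weights $w^\ell$, $\ell=1,\dots,N_q$; $w=(w^\ell)_\ell$, $\mathbb{1}=(1,\dots,1)^\top$, $Q_v=\mathrm{diag}(\Omega_v^\ell)$, $Q_v^\pm=(Q_v\pm|Q_v|)/2$, $v\in\{x,y\}$. The quadrature satisfies $w^\top\mathbb{1}=2\pi$, $w^\top Q_v\mathbb{1}=0$, $w^\top Q_xQ_x\mathbb{1}=w^\top Q_yQ_y\mathbb{1}=2\pi/3$, $w^\top Q_xQ_y\mathbb{1}=0$. Difference matrices: $\mathbf{D}^\pm_v\in\mathbb{R}^{N^I\times N^I}$, $\mathbf{d}^0_v\in\mathbb{R}^{N^I\times N^C}$, $\mathbf{D}^0_v\in\mathbb{R}^{N^C\times N^I}$ are the matrix forms of the operators, for $v=x$ (analogously for $y$): $\mathcal{D}^+_xg_{\alpha\beta}=\frac{g_{\alpha+1,\beta}-g_{\alpha\beta}}{\Delta x}$, $\mathcal{D}^-_xg_{\alpha\beta}=\frac{g_{\alpha\beta}-g_{\alpha-1,\beta}}{\Delta x}$, $\delta^0_xh_{\alpha\beta}=\frac{h_{\alpha+1/2,\beta}-h_{\alpha-1/2,\beta}}{\Delta x}$ for $(\alpha,\beta)\in\mathcal{K}^I$,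 and $\mathcal{D}^0_xg_{\alpha\beta}=\frac{g_{\alpha+1/2,\beta}-g_{\alpha-1/2,\beta}}{\Delta x}$ for $(\alpha,\beta)\in\mathcal{K}^C$. For a matrix $Y\in\mathbb{R}^{N^I\times N_q}$ set $\mathbf{L}Y=\sum_v(\mathbf{D}^+_vYQ_v^-+\mathbf{D}^-_vYQ_v^+)$, and write $R^n=\sum_v\mathbf{d}^0_v(B(T^n)+\varepsilon^2h^n)\mathbb{1}^\top Q_v$, $P=I-\frac1{2\pi}\mathbb{1}w^\top$. Macro--micro parallel BUG scheme, one step $t_n\to t_{n+1}=t_n+\Delta t$, starting from $T^n,h^n$ and the rank-$r_n$ factorization $\mathbf{g}^n=X^nS^nV^{n,\top}$ ($X^n,V^n$ with orthonormal columns): 1. Pre-augmentation: replace $X^n$ by an orthonormal basis of the columns of $[(\Sigma^t)^{-1}\mathbf{d}^0_xB(T^n),(\Sigma^t)^{-1}\mathbf{d}^0_yB(T^n),X^n]$ and $V^n$ by an orthonormal basis of the columns of $[Q_x\mathbb{1},Q_y\mathbb{1},V^n]$ with $V^{n,\top}w=0$; replace $S^n$ by the projection of the coefficients onto the new bases (so $X^nS^nV^{n,\top}$ is unchanged). The new factors are again denoted $X^n,S^n,V^n$; their rank is $\tilde r_n=r_n+2$. 2. Parallel update. K-step: with $K^n=X^nS^n$, $\frac{\varepsilon^2}{c\Delta t}(K^{n+1}-K^n)=-\varepsilon\,\mathbf{L}(K^nV^{n,\top})P^\top V^n-R^nV^n-\Sigma^tK^{n+1}$; let $\widehat X=(X^n,\widetilde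 X^{n+1})$ be an orthonormal basis of the columns of $(X^n,K^{n+1})$ and $\widetilde S^K=\widetilde X^{n+1,\top}K^{n+1}$. L-step: with $L^n=V^nS^{n,\top}$, $\frac{\varepsilon^2}{c\Delta t}(L^{n+1}-L^n)=-\varepsilon P(\mathbf{L}(X^nL^{n,\top}))^\top X^n-(R^n)^\top X^n-L^{n+1}X^{n,\top}\Sigma^tX^n$; let $\widehat V=(V^n,\widetilde V^{n+1})$ be an orthonormal basis of the columns of $(V^n,L^{n+1})$ with $\widetilde V^{n+1,\top}w=0$ and $\widetilde S^L=L^{n+1,\top}\widetilde V^{n+1}$. S-step: $\frac{\varepsilon^2}{c\Delta t}(\overline S^{n+1}-S^n)=-\varepsilon X^{n,\top}\mathbf{L}(X^nS^nV^{n,\top})P^\top V^n-X^{n,\top}R^nV^n-X^{n,\top}\Sigma^tX^n\overline S^{n+1}$. 3. Augmentation: $\widehat S=\begin{bmatrix}\overline S^{n+1}&\widetilde S^L\\\widetilde S^K&0\end{bmatrix}$. 4. Conservative truncation: $\widehat X\widehat S\widehat V^\top$ is truncated (up to a given tolerance, by an SVD-based truncation) to $\mathbf{g}^{n+1}=X^{n+1}S^{n+1}V^{n+1,\top}$ of rank $1\le r_{n+1}<2\tilde r_n$, in such a way that the pre-augmented basis vectors of step 1 are preserved: $(\Sigma^t)^{-1}\mathbf{d}^0_vB(T^n)$ and $Q_v\mathbb{1}$ remain in the ranges of $X^{n+1}$ and $V^{n+1}$, and the part of $\widehat X\widehat S\widehat V^\top$ supported on these directions is not truncated. 5. Update of $h,T$: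 for all $\kappa\in\mathcal{K}^C$, with $g^{n+1}_\kappa$ the rows of $\mathbf{g}^{n+1}$ on $\mathcal{K}^I$, $\frac{\varepsilon^2}{c\Delta t}(h^{n+1}_\kappa-h^n_\kappa)+\frac1{c\Delta t}(B^{n+1}_\kappa-B^n_\kappa)+\frac1{2\pi}\sum_vw^\top Q_v\mathcal{D}^0_vg^{n+1}_\kappa=-\sigma^a_\kappa h^{n+1}_\kappa$ and $\frac{c_\nu}{\Delta t}(T^{n+1}_\kappa-T^n_\kappa)=2\pi\sigma^a_\kappa h^{n+1}_\kappa$. The limit $\varepsilon\to0$ is the formal one: the terms carrying a positive power of $\varepsilon$ vanish in these equations (the discrete unknowns remaining bounded). *)

theory Defs
  imports "HOL-Analysis.Derivative" "Jordan_Normal_Form.VS_Connect"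
begin

section \<open>Data of the discretization\<close>

datatype axis = AX | AY

text \<open>
  Grid indices are doubled, so that \<open>(p, q)\<close> stands for the index \<open>(p/2, q/2)\<close>. Cell centres and
  corners are then the pairs with \<open>p + q\<close> even, interfaces those with \<open>p + q\<close> odd, and a shift by
  one half in an index is a shift by 1 in its double. The two grids are given as enumerations
  \<open>KC\<close>, \<open>KI\<close>, which fix the row and column numbering of all vectors and matrices.

  The difference operators near the boundary use values outside the grid. These are ghost values,
  supplied by a linear closure: the value at lattice index \<open>k\<close> of the extension of a
  grid function \<open>u\<close> on \<open>KC\<close> is \<open>\<Sum>j. gC k j * u\<^sub>j\<close>, and similarly for \<open>gI\<close> on \<open>KI\<close>. No particular
  boundary condition (periodic, homogeneous Dirichlet, ...) is imposed.
\<close>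

record rte =
  light :: real
  arad :: real
  cnu :: real
  dt :: real
  dx :: real
  dy :: real
  origin :: "real \<times> real"
  siga :: "real \<times> real \<Rightarrow> real"
  sigs :: "real \<times> real \<Rightarrow> real"
  KC :: "(int \<times> int) list"
  KI :: "(int \<times> int) list"
  gC :: "int \<times> int \<Rightarrow> nat \<Rightarrow> real"
  gI :: "int \<times> int \<Rightarrow> nat \<Rightarrow> real"
  Nq :: nat
  Om :: "axis \<Rightarrow> nat \<Rightarrow> real"
  wt :: "real vec"

definition NC :: "rte \<Rightarrow> nat" where "NC D = length (KC D)"

definition NI :: "rte \<Rightarrow> nat" where "NI D = length (KI D)"

definition sigt :: "rte \<Rightarrow> real \<times> real \<Rightarrow> real" where
  "sigt D p = siga D p + sigs D p"

definition pos :: "rte \<Rightarrow> int \<times> int \<Rightarrow> real \<times> real" where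
  "pos D k = (fst (origin D) + of_int (fst k) * dx D / 2, snd (origin D) + of_int (snd k) * dy D / 2)"

definition Q :: "rte \<Rightarrow> axis \<Rightarrow> real mat" where
  "Q D v = mat_diag (Nq D) (Om D v)"

definition Qplus :: "rte \<Rightarrow> axis \<Rightarrow> real mat" where
  "Qplus D v = mat_diag (Nq D) (\<lambda>l. (Om D v l + \<bar>Om D v l\<bar>) / 2)"

definition Qminus :: "rte \<Rightarrow> axis \<Rightarrow> real mat" where
  "Qminus D v = mat_diag (Nq D) (\<lambda>l. (Om D v l - \<bar>Om D v l\<bar>) / 2)"

definition ones :: "rte \<Rightarrow> real vec" where
  "ones D = vec (Nq D) (\<lambda>_. 1)"

definition quadrature :: "rte \<Rightarrow> bool" where
  "quadrature D \<longleftrightarrow>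
     wt D \<in> carrier_vec (Nq D) \<and> (\<forall>l<Nq D. 0 < vec_index (wt D) l) \<and>
     (\<forall>l<Nq D. (Om D AX l)\<^sup>2 + (Om D AY l)\<^sup>2 \<le> 1) \<and>
     scalar_prod (wt D) (ones D) = 2 * pi \<and>
     (\<forall>v. scalar_prod (wt D) (Q D v *\<^sub>v ones D) = 0) \<and>
     (\<forall>v. scalar_prod (wt D) (Q D v *\<^sub>v (Q D v *\<^sub>v ones D)) = 2 * pi / 3) \<and>
     scalar_prod (wt D) (Q D AX *\<^sub>v (Q D AY *\<^sub>v ones D)) = 0"

definition rte_discretization :: "rte \<Rightarrow> bool" where
  "rte_discretization D \<longleftrightarrow>
     0 < light D \<and> 0 < arad D \<and> 0 < cnu D \<and> 0 < dt D \<and> 0 < dx D \<and> 0 < dy D \<and>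
     (\<exists>s0>0. \<forall>p. s0 \<le> siga D p) \<and> (\<exists>s0>0. \<forall>p. s0 \<le> sigt D p) \<and>
     distinct (KC D) \<and> (\<forall>k\<in>set (KC D). even (fst k + snd k)) \<and>
     distinct (KI D) \<and> (\<forall>k\<in>set (KI D). odd (fst k + snd k)) \<and>
     (\<forall>i<NC D. \<forall>j<NC D. gC D (KC D ! i) j = (if i = j then 1 else 0)) \<and>
     (\<forall>i<NI D. \<forall>j<NI D. gI D (KI D ! i) j = (if i = j then 1 else 0)) \<and>
     quadrature D"

section \<open>Difference matrices\<close>

fun half :: "axis \<Rightarrow> int \<times> int" where
  "half AX = (1, 0)"
| "half AY = (0, 1)"

fun step :: "rte \<Rightarrow> axis \<Rightarrow> real" where
  "step D AX = dx D"
| "step D AY = dy D"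

definition Dplus :: "rte \<Rightarrow> axis \<Rightarrow> real mat" where
  "Dplus D v = mat (NI D) (NI D)
     (\<lambda>(i, j). (gI D (KI D ! i + half v + half v) j - gI D (KI D ! i) j) / step D v)"

definition Dminus :: "rte \<Rightarrow> axis \<Rightarrow> real mat" where
  "Dminus D v = mat (NI D) (NI D)
     (\<lambda>(i, j). (gI D (KI D ! i) j - gI D (KI D ! i - half v - half v) j) / step D v)"

definition d0 :: "rte \<Rightarrow> axis \<Rightarrow> real mat" where
  "d0 D v = mat (NI D) (NC D)
     (\<lambda>(i, j). (gC D (KI D ! i + half v) j - gC D (KI D ! i - half v) j) / step D v)"

definition D0 :: "rte \<Rightarrow> axis \<Rightarrow> real mat" where
  "D0 D v = mat (NC D) (NI D)
     (\<lambda>(i, j). (gI D (KC D ! i + half v) j - gI D (KC D ! i - half v) j) / step D v)"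

definition Sig :: "rte \<Rightarrow> real mat" where
  "Sig D = mat_diag (NI D) (\<lambda>i. sigt D (pos D (KI D ! i)))"

definition Sig_inv :: "rte \<Rightarrow> real mat" where
  "Sig_inv D = mat_diag (NI D) (\<lambda>i. 1 / sigt D (pos D (KI D ! i)))"

section \<open>Operators of the scheme\<close>

definition planck :: "rte \<Rightarrow> real \<Rightarrow> real" where
  "planck D T = arad D * light D / (2 * pi) * T ^ 4"

abbreviation planck_vec :: "rte \<Rightarrow> real vec \<Rightarrow> real vec" where
  "planck_vec D T \<equiv> map_vec (planck D) T"

definition outer :: "real vec \<Rightarrow> real vec \<Rightarrow> real mat" where
  "outer u v = mat (dim_vec u) (dim_vec v) (\<lambda>(i, j). vec_index u i * vec_index v j)"

definition Lop :: "rte \<Rightarrow> real mat \<Rightarrow> real mat" where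
  "Lop D Y = (Dplus D AX * Y * Qminus D AX + Dminus D AX * Y * Qplus D AX)
           + (Dplus D AY * Y * Qminus D AY + Dminus D AY * Y * Qplus D AY)"

definition Rop :: "rte \<Rightarrow> real \<Rightarrow> real vec \<Rightarrow> real vec \<Rightarrow> real mat" where
  "Rop D \<epsilon> T h = outer (d0 D AX *\<^sub>v (planck_vec D T + \<epsilon>\<^sup>2 \<cdot>\<^sub>v h)) (ones D) * Q D AX
               + outer (d0 D AY *\<^sub>v (planck_vec D T + \<epsilon>\<^sup>2 \<cdot>\<^sub>v h)) (ones D) * Q D AY"

definition Proj :: "rte \<Rightarrow> real mat" where
  "Proj D = 1\<^sub>m (Nq D) - (1 / (2 * pi)) \<cdot>\<^sub>m outer (ones D) (wt D)"

section \<open>The macro--micro parallel BUG step\<close>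

abbreviation col_range :: "real mat \<Rightarrow> real vec set" where
  "col_range A \<equiv> vec_space.col_space (dim_row A) A"

definition hcat :: "real mat \<Rightarrow> real mat \<Rightarrow> real mat" where
  "hcat A B = mat_of_cols (dim_row A) (cols A @ cols B)"

definition orthonormal_cols :: "real mat \<Rightarrow> bool" where
  "orthonormal_cols X \<longleftrightarrow> X\<^sup>T * X = 1\<^sub>m (dim_col X)"

text \<open>
  If the columns of \<open>A\<close> are linearly independent, the bound on the number of columns of \<open>X\<close> forces
  \<open>X\<close> to have as many columns as \<open>A\<close> and the same column space. Dependent columns do occur: in all
  time steps but the first, \<open>Q\<^sub>v \<one>\<close> already lies in the range of the previous \<open>V\<close>. Then both conventions
  are admitted: dropping the redundant columns (a basis of the column space), or completing to an
  orthonormal system with as many columns as \<open>A\<close> (as a QR factorization does).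
\<close>

definition onb_of_cols :: "real mat \<Rightarrow> real mat \<Rightarrow> bool" where
  "onb_of_cols A X \<longleftrightarrow>
     dim_row X = dim_row A \<and> dim_col X \<le> dim_col A \<and> orthonormal_cols X \<and> col_range A \<subseteq> col_range X"

definition dirs_X :: "rte \<Rightarrow> real vec \<Rightarrow> real mat" where
  "dirs_X D T = mat_of_cols (NI D)
     [Sig_inv D *\<^sub>v (d0 D AX *\<^sub>v planck_vec D T), Sig_inv D *\<^sub>v (d0 D AY *\<^sub>v planck_vec D T)]"

definition dirs_V :: "rte \<Rightarrow> real mat" where
  "dirs_V D = mat_of_cols (Nq D) [Q D AX *\<^sub>v ones D, Q D AY *\<^sub>v ones D]"

definition preaugmentation ::
  "rte \<Rightarrow> real vec \<Rightarrow> real mat \<Rightarrow> real mat \<Rightarrow> real mat \<Rightarrow> real mat \<Rightarrow> real mat \<Rightarrow> real mat \<Rightarrow> bool" where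
  "preaugmentation D T X S V X' S' V' \<longleftrightarrow>
     onb_of_cols (hcat (dirs_X D T) X) X' \<and>
     onb_of_cols (hcat (dirs_V D) V) V' \<and> V'\<^sup>T *\<^sub>v wt D = 0\<^sub>v (dim_col V') \<and>
     S' = X'\<^sup>T * X * S * V\<^sup>T * V'"

definition K_step ::
  "rte \<Rightarrow> real \<Rightarrow> real vec \<Rightarrow> real vec \<Rightarrow> real mat \<Rightarrow> real mat \<Rightarrow> real mat \<Rightarrow> real mat \<Rightarrow> bool" where
  "K_step D \<epsilon> T h X S V K1 \<longleftrightarrow> K1 \<in> carrier_mat (NI D) (dim_col V) \<and>
     (\<epsilon>\<^sup>2 / (light D * dt D)) \<cdot>\<^sub>m (K1 - X * S)
       = - (\<epsilon> \<cdot>\<^sub>m (Lop D (X * S * V\<^sup>T) * (Proj D)\<^sup>T * V)) - Rop D \<epsilon> T h * V - Sig D * K1"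

definition L_step ::
  "rte \<Rightarrow> real \<Rightarrow> real vec \<Rightarrow> real vec \<Rightarrow> real mat \<Rightarrow> real mat \<Rightarrow> real mat \<Rightarrow> real mat \<Rightarrow> bool" where
  "L_step D \<epsilon> T h X S V L1 \<longleftrightarrow> L1 \<in> carrier_mat (Nq D) (dim_col X) \<and>
     (\<epsilon>\<^sup>2 / (light D * dt D)) \<cdot>\<^sub>m (L1 - V * S\<^sup>T)
       = - (\<epsilon> \<cdot>\<^sub>m (Proj D * (Lop D (X * (V * S\<^sup>T)\<^sup>T))\<^sup>T * X)) - (Rop D \<epsilon> T h)\<^sup>T * X
         - L1 * (X\<^sup>T * Sig D * X)"

definition S_step ::
  "rte \<Rightarrow> real \<Rightarrow> real vec \<Rightarrow> real vec \<Rightarrow> real mat \<Rightarrow> real mat \<Rightarrow> real mat \<Rightarrow> real mat \<Rightarrow> bool" where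
  "S_step D \<epsilon> T h X S V S1 \<longleftrightarrow> S1 \<in> carrier_mat (dim_col X) (dim_col V) \<and>
     (\<epsilon>\<^sup>2 / (light D * dt D)) \<cdot>\<^sub>m (S1 - S)
       = - (\<epsilon> \<cdot>\<^sub>m (X\<^sup>T * Lop D (X * S * V\<^sup>T) * (Proj D)\<^sup>T * V)) - X\<^sup>T * Rop D \<epsilon> T h * V
         - X\<^sup>T * Sig D * X * S1"

definition svd_truncation :: "real \<Rightarrow> real mat \<Rightarrow> real mat \<Rightarrow> bool" where
  "svd_truncation \<theta> A A' \<longleftrightarrow> (\<exists>U s W m k.
     U \<in> carrier_mat (dim_row A) m \<and> W \<in> carrier_mat (dim_col A) m \<and>
     orthonormal_cols U \<and> orthonormal_cols W \<and>
     (\<forall>i<m. 0 \<le> s i) \<and> (\<forall>i j. i \<le> j \<and> j < m \<longrightarrow> s j \<le> s i) \<and>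
     A = U * mat_diag m s * W\<^sup>T \<and>
     k \<le> m \<and> sqrt (\<Sum>i\<in>{k..<m}. (s i)\<^sup>2) \<le> \<theta> \<and>
     A' = U * mat_diag m (\<lambda>i. if i < k then s i else 0) * W\<^sup>T)"

text \<open>
  \<open>G\<close> is split orthogonally (in the Frobenius inner product) into a part \<open>Gc\<close>, which is kept unchanged
  and carries everything supported on the directions \<open>A\<close> (space) and \<open>B\<close> (angle), and a remainder
  \<open>Gr\<close>, which has no component on these directions and is truncated to \<open>Gt\<close>. Which further
  components are kept in \<open>Gc\<close> (only the component in the span of \<open>A\<close> and \<open>B\<close>, or for example also
  everything supported on \<open>B\<close> in angle) is left open. \<open>rmax\<close> is the strict bound on the new rank.
\<close>

definition conservative_truncation ::
  "real \<Rightarrow> nat \<Rightarrow> real mat \<Rightarrow> real mat \<Rightarrow> real mat \<Rightarrow> real mat \<Rightarrow> real mat \<Rightarrow> real mat \<Rightarrow> bool" where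
  "conservative_truncation \<theta> rmax A B G X1 S1 V1 \<longleftrightarrow>
     (\<exists>r1. 1 \<le> r1 \<and> r1 < rmax \<and> X1 \<in> carrier_mat (dim_row G) r1 \<and>
        S1 \<in> carrier_mat r1 r1 \<and> V1 \<in> carrier_mat (dim_col G) r1) \<and>
     orthonormal_cols X1 \<and> orthonormal_cols V1 \<and>
     col_range A \<subseteq> col_range X1 \<and> col_range B \<subseteq> col_range V1 \<and>
     (\<exists>Gc Gr Gt.
        Gc \<in> carrier_mat (dim_row G) (dim_col G) \<and> Gr \<in> carrier_mat (dim_row G) (dim_col G) \<and>
        G = Gc + Gr \<and>
        (\<Sum>i<dim_row G. \<Sum>j<dim_col G. Gc $$ (i, j) * Gr $$ (i, j)) = 0 \<and>
        A\<^sup>T * Gr * B = 0\<^sub>m (dim_col A) (dim_col B) \<and>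
        svd_truncation \<theta> Gr Gt \<and>
        A\<^sup>T * Gt * B = 0\<^sub>m (dim_col A) (dim_col B) \<and>
        X1 * S1 * V1\<^sup>T = Gc + Gt)"

definition macro_update ::
  "rte \<Rightarrow> real \<Rightarrow> real vec \<Rightarrow> real vec \<Rightarrow> real mat \<Rightarrow> real vec \<Rightarrow> real vec \<Rightarrow> bool" where
  "macro_update D \<epsilon> T h g1 T1 h1 \<longleftrightarrow>
     T1 \<in> carrier_vec (NC D) \<and> h1 \<in> carrier_vec (NC D) \<and>
     (\<forall>i<NC D. let sa = siga D (pos D (KC D ! i)) in
        \<epsilon>\<^sup>2 / (light D * dt D) * (vec_index h1 i - vec_index h i)
          + 1 / (light D * dt D) * (planck D (vec_index T1 i) - planck D (vec_index T i))
          + 1 / (2 * pi) * (\<Sum>v\<in>{AX, AY}. scalar_prod (wt D) (Q D v *\<^sub>v row (D0 D v * g1) i))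
          = - sa * vec_index h1 i \<and>
        cnu D / dt D * (vec_index T1 i - vec_index T i) = 2 * pi * sa * vec_index h1 i)"

text \<open>
  One step from \<open>(T, h, X S V\<^sup>T)\<close> to \<open>(T1, h1, X1 S1 V1\<^sup>T)\<close>; \<open>\<theta>\<close> is the truncation tolerance. With
  \<open>\<epsilon> = 0\<close> this is the formal limit scheme, because every occurrence of \<open>\<epsilon>\<close> is in a factor
  \<open>\<epsilon>\<close> or \<open>\<epsilon>\<^sup>2\<close>. The rank after pre-augmentation is at most \<open>r + 2\<close> (equal to it for independent
  columns), hence the bound \<open>2 * (r + 2)\<close> in the truncation.
\<close>

definition bug_step ::
  "rte \<Rightarrow> real \<Rightarrow> real \<Rightarrow> real vec \<Rightarrow> real vec \<Rightarrow> real mat \<Rightarrow> real mat \<Rightarrow> real mat \<Rightarrow>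
   real vec \<Rightarrow> real vec \<Rightarrow> real mat \<Rightarrow> real mat \<Rightarrow> real mat \<Rightarrow> bool" where
  "bug_step D \<theta> \<epsilon> T h X S V T1 h1 X1 S1 V1 \<longleftrightarrow>
     T \<in> carrier_vec (NC D) \<and> h \<in> carrier_vec (NC D) \<and>
     (\<exists>r Xn Sn Vn K1 L1 Sbar Xt Vt.
        X \<in> carrier_mat (NI D) r \<and> S \<in> carrier_mat r r \<and> V \<in> carrier_mat (Nq D) r \<and>
        orthonormal_cols X \<and> orthonormal_cols V \<and>
        preaugmentation D T X S V Xn Sn Vn \<and>
        K_step D \<epsilon> T h Xn Sn Vn K1 \<and> L_step D \<epsilon> T h Xn Sn Vn L1 \<and> S_step D \<epsilon> T h Xn Sn Vn Sbar \<and>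
        dim_row Xt = NI D \<and> onb_of_cols (hcat Xn K1) (hcat Xn Xt) \<and>
        dim_row Vt = Nq D \<and> onb_of_cols (hcat Vn L1) (hcat Vn Vt) \<and>
        Vt\<^sup>T *\<^sub>v wt D = 0\<^sub>v (dim_col Vt) \<and>
        conservative_truncation \<theta> (2 * (r + 2)) (dirs_X D T) (dirs_V D)
          (hcat Xn Xt
            * four_block_mat Sbar (L1\<^sup>T * Vt) (Xt\<^sup>T * K1) (0\<^sub>m (dim_col Xt) (dim_col Vt))
            * (hcat Vn Vt)\<^sup>T)
          X1 S1 V1 \<and>
        macro_update D \<epsilon> T h (X1 * S1 * V1\<^sup>T) T1 h1)"

section \<open>The Rosseland equation and its discretization\<close>

text \<open>
  \<open>T\<close> solves the Rosseland equation at \<open>(t, p)\<close> iff \<open>rosseland_residual D T t p = 0\<close>. \<open>explicit_residual\<close>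
  is what is left of the difference equation after inserting the values of \<open>T\<close> at time levels
  \<open>t\<close> and \<open>t + \<tau>\<close> on a grid with spacings \<open>\<xi>\<close>, \<open>\<eta>\<close> that has \<open>p\<close> as a node.
\<close>

definition disc_diffusion :: "rte \<Rightarrow> real vec \<Rightarrow> real vec" where
  "disc_diffusion D u =
     D0 D AX *\<^sub>v (Sig_inv D *\<^sub>v (d0 D AX *\<^sub>v u)) + D0 D AY *\<^sub>v (Sig_inv D *\<^sub>v (d0 D AY *\<^sub>v u))"

definition rosseland_lhs :: "rte \<Rightarrow> real vec \<Rightarrow> real vec \<Rightarrow> real vec" where
  "rosseland_lhs D T T1 =
     (cnu D / dt D) \<cdot>\<^sub>v (T1 - T) + (2 * pi / (light D * dt D)) \<cdot>\<^sub>v (planck_vec D T1 - planck_vec D T)"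

definition rosseland_rhs :: "rte \<Rightarrow> real vec \<Rightarrow> real vec" where
  "rosseland_rhs D T = (2 * pi / 3) \<cdot>\<^sub>v disc_diffusion D (planck_vec D T)"

definition ghost_ext :: "rte \<Rightarrow> real vec \<Rightarrow> int \<times> int \<Rightarrow> real" where
  "ghost_ext D u k = (\<Sum>j<NC D. gC D k j * vec_index u j)"

definition five_point ::
  "real \<Rightarrow> real \<Rightarrow> (real \<times> real \<Rightarrow> real) \<Rightarrow> (real \<times> real \<Rightarrow> real) \<Rightarrow> real \<times> real \<Rightarrow> real" where
  "five_point \<xi> \<eta> s u = (\<lambda>(x, y).
     ((u (x + \<xi>, y) - u (x, y)) / (\<xi> * s (x + \<xi> / 2, y)) - (u (x, y) - u (x - \<xi>, y)) / (\<xi> * s (x - \<xi> / 2, y))) / \<xi>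
   + ((u (x, y + \<eta>) - u (x, y)) / (\<eta> * s (x, y + \<eta> / 2)) - (u (x, y) - u (x, y - \<eta>)) / (\<eta> * s (x, y - \<eta> / 2))) / \<eta>)"

definition rosseland_residual :: "rte \<Rightarrow> (real \<Rightarrow> real \<times> real \<Rightarrow> real) \<Rightarrow> real \<Rightarrow> real \<times> real \<Rightarrow> real" where
  "rosseland_residual D T t = (\<lambda>(x, y).
     cnu D * deriv (\<lambda>t'. T t' (x, y)) t
   + 2 * pi / light D * deriv (\<lambda>t'. planck D (T t' (x, y))) t
   - 2 * pi / 3 *
       (deriv (\<lambda>x'. 1 / sigt D (x', y) * deriv (\<lambda>z. planck D (T t (z, y))) x') x
      + deriv (\<lambda>y'. 1 / sigt D (x, y') * deriv (\<lambda>z. planck D (T t (x, z))) y') y))"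

definition explicit_residual ::
  "rte \<Rightarrow> (real \<Rightarrow> real \<times> real \<Rightarrow> real) \<Rightarrow> real \<Rightarrow> real \<times> real \<Rightarrow> real \<Rightarrow> real \<Rightarrow> real \<Rightarrow> real" where
  "explicit_residual D T t p \<tau> \<xi> \<eta> =
     cnu D / \<tau> * (T (t + \<tau>) p - T t p)
   + 2 * pi / (light D * \<tau>) * (planck D (T (t + \<tau>) p) - planck D (T t p))
   - 2 * pi / 3 * five_point \<xi> \<eta> (sigt D) (\<lambda>p'. planck D (T t p')) p"

text \<open>Pointwise regularity that makes every derivative in \<open>rosseland_residual\<close> exist.\<close>

definition regular_at :: "rte \<Rightarrow> (real \<Rightarrow> real \<times> real \<Rightarrow> real) \<Rightarrow> real \<Rightarrow> real \<times> real \<Rightarrow> bool" where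
  "regular_at D T t = (\<lambda>(x, y).
     (\<lambda>t'. T t' (x, y)) differentiable at t \<and>
     (\<forall>\<^sub>F x' in nhds x. (\<lambda>z. T t (z, y)) differentiable at x') \<and>
     deriv (\<lambda>z. T t (z, y)) differentiable at x \<and>
     (\<forall>\<^sub>F y' in nhds y. (\<lambda>z. T t (x, z)) differentiable at y') \<and>
     deriv (\<lambda>z. T t (x, z)) differentiable at y \<and>
     (\<lambda>x'. sigt D (x', y)) differentiable at x \<and>
     (\<lambda>y'. sigt D (x, y')) differentiable at y)"

end

theory Submission
  imports Defs
begin

text \<open>
  Write \<open>A = (\<Sigma>\<^sup>t)\<inverse> (d\<^sup>0\<^sub>x B, d\<^sup>0\<^sub>y B)\<close> for the two spatial directions and \<open>C = (Q\<^sub>x \<one>, Q\<^sub>y \<one>)\<close> for the two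
  angular directions that the pre-augmentation adds. Up to terms of order \<open>\<epsilon>\<close> the micro equation
  reads \<open>\<Sigma>\<^sup>t g = - \<Sigma>\<^sub>v (d\<^sup>0\<^sub>v B) (Q\<^sub>v \<one>)\<^sup>T\<close>, so the matrix that the micro step should produce is \<open>Y = - A C\<^sup>T\<close>
  (\<open>micro_limit\<close>). The low-rank step finds it because \<open>Y\<close> already lies in the augmented spaces: the
  K-, L- and S-steps are Galerkin projections, onto the spaces spanned by \<open>X\<close> and \<open>V\<close>, of one linear
  equation with the coercive operator \<open>\<Sigma>\<^sup>t\<close>, and since \<open>Y = X X\<^sup>T Y = Y V V\<^sup>T\<close> the corresponding
  projections of \<open>Y\<close> solve all three up to a common remainder \<open>W\<close> (\<open>bug_substeps_bound\<close>). The new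
  basis vectors carry only components of the error, hence the augmented matrix is \<open>O(\<parallel>W\<parallel>)\<close> close
  to \<open>Y\<close> (\<open>augmented_product_bound\<close>). The truncation does not destroy this: the part it may alter is
  orthogonal to the kept part and to \<open>Y\<close>, so it is itself no larger than the error
  (\<open>conservative_truncation_bound\<close>).

  In the macro equation only the angular moments of \<open>g\<close> enter. By the moment conditions of the
  quadrature the moments of \<open>Y\<close> are \<open>- 2\<pi>/3\<close> times the discrete diffusion operator applied to \<open>B\<close>
  (\<open>angular_flux_micro_limit\<close>); eliminating \<open>\<sigma>\<^sup>a h\<close> with the temperature equation leaves the discrete
  Rosseland equation with a defect bounded by a multiple of \<open>\<parallel>W\<parallel>\<close> plus one of \<open>\<epsilon>\<^sup>2\<close> (\<open>rosseland_gap_bound\<close>).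

  Every estimate is quantitative and holds for \<open>0 \<le> \<epsilon> \<le> 1\<close> with a constant that depends only on the
  discretization and on bounds of the unknowns: \<open>\<parallel>W\<parallel> \<le> C \<epsilon>\<close>. The formal limit scheme is the case
  \<open>\<epsilon> = 0\<close>, where the defect vanishes, and bounded families are the case \<open>\<epsilon> \<rightarrow> 0\<close>.

  The last two claims are independent of the scheme. The stencil is obtained by multiplying out the
  difference matrices; consistency rests on the fact that a difference quotient of a function with a
  derivative that is differentiable at one point is itself differentiable in the step size
  (\<open>flux_difference_tendsto\<close>).
\<close>

section \<open>Frobenius inner product and norm\<close>

definition frob_inner :: "real mat \<Rightarrow> real mat \<Rightarrow> real" where
  "frob_inner A B = (\<Sum>i<dim_row A. \<Sum>j<dim_col A. A $$ (i, j) * B $$ (i, j))"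

definition frob :: "real mat \<Rightarrow> real" where
  "frob A = L2_set (\<lambda>p. A $$ p) ({..<dim_row A} \<times> {..<dim_col A})"

lemma frob_inner_cartesian:
  "frob_inner A B = (\<Sum>p\<in>{..<dim_row A} \<times> {..<dim_col A}. A $$ p * B $$ p)"
  by (simp add: frob_inner_def sum.cartesian_product case_prod_unfold)

lemma frob_nonneg: "0 \<le> frob A"
  by (simp add: frob_def L2_set_nonneg)

lemma frob_inner_self: "frob_inner A A = (frob A)\<^sup>2"
  by (simp add: frob_inner_cartesian frob_def L2_set_def sum_nonneg power2_eq_square)

lemma frob_inner_le:
  assumes "A \<in> carrier_mat n m" "B \<in> carrier_mat n m"
  shows "frob_inner A B \<le> frob A * frob B"
proof -
  have "frob_inner A B \<le> (\<Sum>p\<in>{..<n} \<times> {..<m}. \<bar>A $$ p\<bar> * \<bar>B $$ p\<bar>)"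
    unfolding frob_inner_cartesian using assms
    by (auto intro!: sum_mono simp flip: abs_mult)
  also have "\<dots> \<le> frob A * frob B"
    using L2_set_mult_ineq[of "\<lambda>p. A $$ p" "\<lambda>p. B $$ p" "{..<n} \<times> {..<m}"] assms
    by (simp add: frob_def)
  finally show ?thesis .
qed

lemma frob_inner_add_left:
  assumes "A \<in> carrier_mat n m" "B \<in> carrier_mat n m" "C \<in> carrier_mat n m"
  shows "frob_inner (A + B) C = frob_inner A C + frob_inner B C"
  using assms by (simp add: frob_inner_def distrib_right sum.distrib)

lemma frob_inner_minus_left:
  assumes "A \<in> carrier_mat n m" "B \<in> carrier_mat n m" "C \<in> carrier_mat n m"
  shows "frob_inner (A - B) C = frob_inner A C - frob_inner B C"
  using assms by (simp add: frob_inner_def left_diff_distrib sum_subtractf)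

lemma frob_inner_add_right:
  assumes "A \<in> carrier_mat n m" "B \<in> carrier_mat n m" "C \<in> carrier_mat n m"
  shows "frob_inner C (A + B) = frob_inner C A + frob_inner C B"
  using assms by (simp add: frob_inner_def distrib_left sum.distrib)

lemma frob_inner_smult_right:
  assumes "A \<in> carrier_mat n m" "C \<in> carrier_mat n m"
  shows "frob_inner C (a \<cdot>\<^sub>m A) = a * frob_inner C A"
  using assms by (simp add: frob_inner_def sum_distrib_left mult.left_commute)

lemma frob_inner_transpose:
  assumes "A \<in> carrier_mat n m" "B \<in> carrier_mat n m"
  shows "frob_inner (A\<^sup>T) (B\<^sup>T) = frob_inner A B"
  using assms by (simp add: frob_inner_def) (rule sum.swap)

lemma frob_inner_mult_left:
  assumes "P \<in> carrier_mat n k" "A \<in> carrier_mat k m" "B \<in> carrier_mat n m"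
  shows "frob_inner (P * A) B = frob_inner A (P\<^sup>T * B)"
proof -
  have "frob_inner (P * A) B = (\<Sum>i<n. \<Sum>j<m. \<Sum>l<k. P $$ (i, l) * A $$ (l, j) * B $$ (i, j))"
    using assms
    by (simp add: frob_inner_def times_mat_def scalar_prod_def sum_distrib_right atLeast0LessThan)
  also have "\<dots> = (\<Sum>i<n. \<Sum>l<k. \<Sum>j<m. P $$ (i, l) * A $$ (l, j) * B $$ (i, j))"
    by (rule sum.cong[OF refl], rule sum.swap)
  also have "\<dots> = (\<Sum>l<k. \<Sum>i<n. \<Sum>j<m. P $$ (i, l) * A $$ (l, j) * B $$ (i, j))"
    by (rule sum.swap)
  also have "\<dots> = (\<Sum>l<k. \<Sum>j<m. \<Sum>i<n. P $$ (i, l) * A $$ (l, j) * B $$ (i, j))"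
    by (rule sum.cong[OF refl], rule sum.swap)
  also have "\<dots> = frob_inner A (P\<^sup>T * B)"
    using assms
    by (simp add: frob_inner_def times_mat_def scalar_prod_def sum_distrib_left atLeast0LessThan
        mult.assoc mult.left_commute)
  finally show ?thesis .
qed

lemma frob_inner_mult_right:
  assumes "A \<in> carrier_mat n k" "P \<in> carrier_mat k m" "B \<in> carrier_mat n m"
  shows "frob_inner (A * P) B = frob_inner A (B * P\<^sup>T)"
proof -
  have "frob_inner (A * P) B = frob_inner (P\<^sup>T * A\<^sup>T) (B\<^sup>T)"
    using assms frob_inner_transpose[of "A * P" n m B] by (simp add: transpose_mult[of A n k P m])
  also have "\<dots> = frob_inner (A\<^sup>T) (P * B\<^sup>T)"
    using assms by (subst frob_inner_mult_left[of _ m k _ n]) auto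
  also have "P * B\<^sup>T = (B * P\<^sup>T)\<^sup>T"
    using assms by (simp add: transpose_mult[of B n m "P\<^sup>T" k])
  also have "frob_inner (A\<^sup>T) ((B * P\<^sup>T)\<^sup>T) = frob_inner A (B * P\<^sup>T)"
    using assms by (intro frob_inner_transpose[of _ n k]) auto
  finally show ?thesis .
qed

lemma frob_transpose: "frob (A\<^sup>T) = frob A"
proof -
  have "(frob (A\<^sup>T))\<^sup>2 = (frob A)\<^sup>2"
    by (metis carrier_matI frob_inner_self frob_inner_transpose)
  then show ?thesis by (simp add: frob_nonneg)
qed

lemma frob_add_le:
  assumes "A \<in> carrier_mat n m" "B \<in> carrier_mat n m"
  shows "frob (A + B) \<le> frob A + frob B"
proof -
  have "frob (A + B) = L2_set (\<lambda>p. A $$ p + B $$ p) ({..<n} \<times> {..<m})"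
    unfolding frob_def using assms by (intro L2_set_cong) auto
  also have "\<dots> \<le> frob A + frob B"
    using assms L2_set_triangle_ineq by (fastforce simp: frob_def)
  finally show ?thesis .
qed

lemma frob_smult: "frob (a \<cdot>\<^sub>m A) = \<bar>a\<bar> * frob A"
proof -
  have "frob (a \<cdot>\<^sub>m A) = L2_set (\<lambda>p. \<bar>a\<bar> * A $$ p) ({..<dim_row A} \<times> {..<dim_col A})"
    by (auto simp: frob_def L2_set_def power_mult_distrib intro!: sum.cong)
  then show ?thesis by (simp add: frob_def L2_set_right_distrib)
qed

lemma frob_uminus: "frob (- A) = frob A"
  by (auto simp: frob_def L2_set_def intro!: sum.cong)

lemma frob_minus_le:
  assumes "A \<in> carrier_mat n m" "B \<in> carrier_mat n m"
  shows "frob (A - B) \<le> frob A + frob B"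
  using frob_add_le[OF assms(1), of "- B"] assms
  by (simp add: frob_uminus add_uminus_minus_mat)

lemma frob_mult_le:
  assumes "A \<in> carrier_mat n k" "B \<in> carrier_mat k m"
  shows "frob (A * B) \<le> frob A * frob B"
proof -
  have "(frob (A * B))\<^sup>2 = (\<Sum>i<n. \<Sum>j<m. (\<Sum>l<k. A $$ (i, l) * B $$ (l, j))\<^sup>2)"
    unfolding frob_inner_self[symmetric] using assms
    by (simp add: frob_inner_def times_mat_def scalar_prod_def atLeast0LessThan power2_eq_square)
  also have "\<dots> \<le> (\<Sum>i<n. \<Sum>j<m. (\<Sum>l<k. (A $$ (i, l))\<^sup>2) * (\<Sum>l<k. (B $$ (l, j))\<^sup>2))"
    by (intro sum_mono Cauchy_Schwarz_ineq_sum)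
  also have "\<dots> = (\<Sum>i<n. \<Sum>l<k. (A $$ (i, l))\<^sup>2) * (\<Sum>j<m. \<Sum>l<k. (B $$ (l, j))\<^sup>2)"
    by (simp add: sum_product)
  also have "(\<Sum>j<m. \<Sum>l<k. (B $$ (l, j))\<^sup>2) = (\<Sum>l<k. \<Sum>j<m. (B $$ (l, j))\<^sup>2)"
    by (rule sum.swap)
  also have "(\<Sum>i<n. \<Sum>l<k. (A $$ (i, l))\<^sup>2) * (\<Sum>l<k. \<Sum>j<m. (B $$ (l, j))\<^sup>2)
      = (frob A * frob B)\<^sup>2"
    unfolding power_mult_distrib frob_inner_self[symmetric] using assms
    by (simp add: frob_inner_def power2_eq_square)
  finally show ?thesis
    by (rule power2_le_imp_le) (simp add: frob_nonneg)
qed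

lemma frob_isometry:
  assumes "orthonormal_cols X" "X \<in> carrier_mat n m" "A \<in> carrier_mat m k"
  shows "frob (X * A) = frob A"
proof -
  have "X\<^sup>T * (X * A) = A"
    using assms by (simp add: orthonormal_cols_def flip: assoc_mult_mat[of "X\<^sup>T" m n X m A k])
  then have "(frob (X * A))\<^sup>2 = (frob A)\<^sup>2"
    unfolding frob_inner_self[symmetric] using assms by (simp add: frob_inner_mult_left[of X n m A k])
  then show ?thesis by (simp add: frob_nonneg)
qed

text \<open>
  \<open>X X\<^sup>T\<close> is an orthogonal projection, so \<open>\<parallel>X\<^sup>T A\<parallel>\<^sup>2 = \<langle>A, X X\<^sup>T A\<rangle> \<le> \<parallel>A\<parallel> \<parallel>X X\<^sup>T A\<parallel> = \<parallel>A\<parallel> \<parallel>X\<^sup>T A\<parallel>\<close>.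
\<close>

lemma frob_coisometry:
  assumes "orthonormal_cols X" "X \<in> carrier_mat n m" "A \<in> carrier_mat n k"
  shows "frob (X\<^sup>T * A) \<le> frob A"
proof -
  have "(frob (X\<^sup>T * A))\<^sup>2 = frob_inner A (X * (X\<^sup>T * A))"
    unfolding frob_inner_self[symmetric] using assms by (simp add: frob_inner_mult_left[of "X\<^sup>T" m n A k])
  also have "\<dots> \<le> frob A * frob (X * (X\<^sup>T * A))"
    using assms by (intro frob_inner_le[of _ n k]) auto
  also have "frob (X * (X\<^sup>T * A)) = frob (X\<^sup>T * A)"
    using assms by (intro frob_isometry[of _ n m _ k]) auto
  finally show ?thesis
    using frob_nonneg[of "X\<^sup>T * A"] frob_nonneg[of A]
    by (cases "frob (X\<^sup>T * A) = 0") (auto simp: power2_eq_square)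
qed

lemma frob_isometry_right:
  assumes "orthonormal_cols V" "V \<in> carrier_mat n m" "A \<in> carrier_mat k m"
  shows "frob (A * V\<^sup>T) = frob A"
proof -
  have "(A * V\<^sup>T)\<^sup>T = V * A\<^sup>T" using assms by (simp add: transpose_mult[of A k m _ n])
  then show ?thesis
    using frob_isometry[OF assms(1,2), of "A\<^sup>T" k] assms frob_transpose[of A]
      frob_transpose[of "A * V\<^sup>T"] by simp
qed

lemma frob_coisometry_right:
  assumes "orthonormal_cols V" "V \<in> carrier_mat n m" "A \<in> carrier_mat k n"
  shows "frob (A * V) \<le> frob A"
proof -
  have "(A * V)\<^sup>T = V\<^sup>T * A\<^sup>T" using assms by (simp add: transpose_mult[of A k n _ m])
  then show ?thesis
    using frob_coisometry[OF assms(1,2), of "A\<^sup>T" k] assms frob_transpose[of A]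
      frob_transpose[of "A * V"] by simp
qed

section \<open>Coercive implicit equations\<close>

text \<open>
  The test objects are matrices with any number of columns, because the unknowns of the substeps are
  matrices; for one column this is the usual coercivity of a bilinear form.
\<close>

definition coercive :: "real \<Rightarrow> real mat \<Rightarrow> bool" where
  "coercive s M \<longleftrightarrow> square_mat M \<and>
     (\<forall>Y. dim_row Y = dim_row M \<longrightarrow> s * (frob Y)\<^sup>2 \<le> frob_inner Y (M * Y))"

lemma coercive_mat_diag:
  assumes "\<And>i. i < n \<Longrightarrow> s \<le> f i"
  shows "coercive s (mat_diag n f)"
  unfolding coercive_def
proof (intro conjI allI impI)
  show "square_mat (mat_diag n f)" by (simp add: mat_diag_def)
  fix Y :: "real mat" assume "dim_row Y = dim_row (mat_diag n f)"
  then have "dim_row Y = n" by (simp add: mat_diag_def)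
  then obtain k where Y: "Y \<in> carrier_mat n k" by blast
  have "s * (Y $$ (i, j) * Y $$ (i, j)) \<le> Y $$ (i, j) * (f i * Y $$ (i, j))" if "i < n" for i j
  proof -
    have "s * (Y $$ (i, j) * Y $$ (i, j)) \<le> f i * (Y $$ (i, j) * Y $$ (i, j))"
      using assms[OF that] by (intro mult_right_mono) auto
    then show ?thesis by (simp only: mult.left_commute)
  qed
  then have "s * frob_inner Y Y \<le> frob_inner Y (mat n k (\<lambda>(i, j). f i * Y $$ (i, j)))"
    unfolding frob_inner_def sum_distrib_left using Y by (intro sum_mono) auto
  then show "s * (frob Y)\<^sup>2 \<le> frob_inner Y (mat_diag n f * Y)"
    by (simp only: frob_inner_self mat_diag_mult_left[OF Y])
qed

text \<open>
  Restricting a form to the range of an isometry keeps its coercivity constant. This makes the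
  reduced systems of the L- and S-steps stable uniformly in the bases.
\<close>

lemma coercive_galerkin:
  assumes "coercive s M" "M \<in> carrier_mat n n" "orthonormal_cols X" "X \<in> carrier_mat n m"
  shows "coercive s (X\<^sup>T * M * X)"
  unfolding coercive_def
proof (intro conjI allI impI)
  show "square_mat (X\<^sup>T * M * X)" by simp
  fix Y :: "real mat" assume "dim_row Y = dim_row (X\<^sup>T * M * X)"
  then have "dim_row Y = m" using assms by simp
  then obtain k where Y: "Y \<in> carrier_mat m k" by blast
  have "s * (frob Y)\<^sup>2 = s * (frob (X * Y))\<^sup>2"
    using frob_isometry[OF assms(3,4) Y] by simp
  also have "\<dots> \<le> frob_inner (X * Y) (M * (X * Y))"
    using assms by (auto simp: coercive_def)
  also have "\<dots> = frob_inner Y (X\<^sup>T * (M * (X * Y)))"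
    using assms Y by (intro frob_inner_mult_left[of _ n]) auto
  also have "X\<^sup>T * (M * (X * Y)) = X\<^sup>T * M * X * Y"
    using assms Y by (simp add: assoc_mult_mat[of _ m n _ n _ m] assoc_mult_mat[of _ m n _ m _ k]
        assoc_mult_mat[of _ n n _ m _ k])
  finally show "s * (frob Y)\<^sup>2 \<le> frob_inner Y (X\<^sup>T * M * X * Y)" .
qed

text \<open>
  Stability of one implicit Euler step: if \<open>Y\<close> balances the source term \<open>M Y\<close>, the difference
  \<open>N = K - Y\<close> satisfies \<open>\<delta> N + M N = W + \<delta> (K0 - Y)\<close>. Pairing this with \<open>N\<close> gives the bound, uniformly
  in \<open>\<delta> \<ge> 0\<close>.
\<close>

lemma implicit_step_bound:
  assumes "coercive s M" "0 < s" "0 \<le> \<delta>" and M: "M \<in> carrier_mat n n"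
    and K: "K \<in> carrier_mat n m" and K0: "K0 \<in> carrier_mat n m" and W: "W \<in> carrier_mat n m"
    and Y: "Y \<in> carrier_mat n m"
    and step: "\<delta> \<cdot>\<^sub>m (K - K0) = W + M * Y - M * K"
  shows "frob (K - Y) \<le> frob (W + \<delta> \<cdot>\<^sub>m (K0 - Y)) / s"
proof -
  let ?N = "K - Y" and ?F = "W + \<delta> \<cdot>\<^sub>m (K0 - Y)"
  have N: "?N \<in> carrier_mat n m" and F: "?F \<in> carrier_mat n m" and MN: "M * ?N \<in> carrier_mat n m"
    using K Y K0 W M by auto
  have "\<delta> \<cdot>\<^sub>m ?N + M * ?N = ?F"
  proof (rule eq_matI)
    fix i j assume "i < dim_row ?F" "j < dim_col ?F"
    then have ij: "i < n" "j < m" using F by auto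
    have "(\<delta> \<cdot>\<^sub>m (K - K0)) $$ (i, j) = (W + M * Y - M * K) $$ (i, j)"
      by (simp only: step)
    then have "\<delta> * (K $$ (i, j) - K0 $$ (i, j)) = W $$ (i, j) + (M * Y) $$ (i, j) - (M * K) $$ (i, j)"
      using ij K K0 W Y M by (simp del: index_mult_mat(1))
    then show "(\<delta> \<cdot>\<^sub>m ?N + M * ?N) $$ (i, j) = ?F $$ (i, j)"
      unfolding mult_minus_distrib_mat[OF M K Y]
      using ij K K0 W Y M by (simp add: algebra_simps del: index_mult_mat(1))
  qed (use K K0 W Y M in auto)
  then have "frob_inner ?N ?F = frob_inner ?N (\<delta> \<cdot>\<^sub>m ?N + M * ?N)"
    by (simp only:)
  also have "\<dots> = \<delta> * (frob ?N)\<^sup>2 + frob_inner ?N (M * ?N)"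
    using frob_inner_add_right[OF smult_carrier_mat[OF N] MN N] frob_inner_smult_right[OF N N]
    by (simp only: frob_inner_self)
  finally have "frob_inner ?N ?F = \<delta> * (frob ?N)\<^sup>2 + frob_inner ?N (M * ?N)" .
  moreover have "0 \<le> \<delta> * (frob ?N)\<^sup>2" using assms(3) by simp
  moreover have "s * (frob ?N)\<^sup>2 \<le> frob_inner ?N (M * ?N)"
    using assms(1) M N by (auto simp: coercive_def)
  moreover have "frob_inner ?N ?F \<le> frob ?N * frob ?F"
    using N F by (rule frob_inner_le)
  ultimately have "s * frob ?N * frob ?N \<le> frob ?F * frob ?N"
    unfolding power2_eq_square by argo
  then have "s * frob ?N \<le> frob ?F"
    using frob_nonneg[of ?N] frob_nonneg[of ?F] by (cases "frob ?N = 0") auto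
  then show ?thesis using \<open>0 < s\<close> by (simp add: field_simps)
qed

section \<open>Bases containing prescribed directions\<close>

lemma mult_transpose_mult_of_range:
  assumes "orthonormal_cols X" and X: "X \<in> carrier_mat n m" and A: "A \<in> carrier_mat n k"
    and "set (cols A) \<subseteq> col_range X"
  shows "X * (X\<^sup>T * A) = A"
proof (rule mat_col_eqI)
  fix j assume "j < dim_col A"
  then have j: "j < k" using A by simp
  have "col A j \<in> set (cols A)"
    using j A by (auto simp: cols_def)
  then obtain c where c: "c \<in> carrier_vec m" "X *\<^sub>v c = col A j"
    using assms(4) X vec_space.col_space_eq[OF X] by auto
  have XX: "X\<^sup>T * X = 1\<^sub>m m" using assms(1) X by (simp add: orthonormal_cols_def)
  have "col (X * (X\<^sup>T * A)) j = X *\<^sub>v (X\<^sup>T *\<^sub>v col A j)"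
    using col_mult2[OF X _ j, of "X\<^sup>T * A"] col_mult2[of "X\<^sup>T" m n A k j] X A j by simp
  also have "X\<^sup>T *\<^sub>v col A j = X\<^sup>T * X *\<^sub>v c"
    unfolding c(2)[symmetric] using c X by (intro assoc_mult_mat_vec[symmetric]) auto
  also have "\<dots> = c" using XX c by simp
  finally show "col (X * (X\<^sup>T * A)) j = col A j" using c by simp
qed (use X A in auto)

lemma cols_subset_col_range: "set (cols A) \<subseteq> col_range A"
proof
  fix u assume "u \<in> set (cols A)"
  then obtain j where j: "j < dim_col A" "u = col A j" by (auto simp: cols_def)
  obtain n m where A: "A \<in> carrier_mat n m" by blast
  then have "A *\<^sub>v unit_vec m j = u" "u \<in> carrier_vec n"
    using j by (auto intro!: eq_vecI)
  then show "u \<in> col_range A"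
    using A vec_space.col_space_eq[OF A] by auto
qed

lemma cols_hcat:
  assumes "A \<in> carrier_mat n a" "B \<in> carrier_mat n b"
  shows "cols (hcat A B) = cols A @ cols B"
  using assms cols_dim[of A] cols_dim[of B] unfolding hcat_def
  by (intro cols_mat_of_cols) auto

lemma hcat_carrier:
  assumes "A \<in> carrier_mat n a" "B \<in> carrier_mat n b"
  shows "hcat A B \<in> carrier_mat n (a + b)"
  using assms by (simp add: hcat_def mat_of_cols_def)

text \<open>
  All that is used later of a basis of the columns of two blocks: the orthogonal projection onto its
  range fixes both blocks.
\<close>

lemma onb_of_hcat:
  assumes "onb_of_cols (hcat A B) X" and A: "A \<in> carrier_mat n a" and B: "B \<in> carrier_mat n b"
  obtains m where "X \<in> carrier_mat n m" "orthonormal_cols X"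
    "X * (X\<^sup>T * A) = A" "X * (X\<^sup>T * B) = B"
proof -
  have "dim_row X = n" using assms hcat_carrier[OF A B] by (auto simp: onb_of_cols_def)
  then obtain m where X: "X \<in> carrier_mat n m" by blast
  have o: "orthonormal_cols X" using assms by (simp add: onb_of_cols_def)
  have "set (cols A) \<union> set (cols B) \<subseteq> col_range X"
    using assms(1) cols_subset_col_range[of "hcat A B"] cols_hcat[OF A B]
    by (auto simp: onb_of_cols_def)
  then show thesis
    using that[OF X o] mult_transpose_mult_of_range[OF o X A] mult_transpose_mult_of_range[OF o X B]
    by simp
qed

text \<open>
  With two empty lower blocks, juxtaposition becomes a block matrix, so that the block
  multiplication rules apply.
\<close>

lemma hcat_four_block:
  assumes "A \<in> carrier_mat n a" "B \<in> carrier_mat n b"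
  shows "hcat A B = four_block_mat A B (0\<^sub>m 0 a) (0\<^sub>m 0 b)"
proof (rule eq_matI)
  fix i j assume "i < dim_row (four_block_mat A B (0\<^sub>m 0 a) (0\<^sub>m 0 b))"
    "j < dim_col (four_block_mat A B (0\<^sub>m 0 a) (0\<^sub>m 0 b))"
  then have "i < n" "j < a + b" using assms by auto
  then show "hcat A B $$ (i, j) = four_block_mat A B (0\<^sub>m 0 a) (0\<^sub>m 0 b) $$ (i, j)"
    using assms by (auto simp: hcat_def mat_of_cols_index nth_append)
qed (use assms hcat_carrier[OF assms] in auto)

lemma hcat_mult_hcat_transpose:
  assumes "A \<in> carrier_mat n a" "B \<in> carrier_mat n b" "C \<in> carrier_mat q a" "D \<in> carrier_mat q b"
  shows "hcat A B * (hcat C D)\<^sup>T = A * C\<^sup>T + B * D\<^sup>T"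
proof -
  have T: "(hcat C D)\<^sup>T = four_block_mat (C\<^sup>T) (0\<^sub>m a 0) (D\<^sup>T) (0\<^sub>m b 0)"
    unfolding hcat_four_block[OF assms(3,4)] using assms
    by (subst transpose_four_block_mat[of _ q a _ b _ 0]) auto
  have "hcat A B * (hcat C D)\<^sup>T
      = four_block_mat (A * C\<^sup>T + B * D\<^sup>T) (A * 0\<^sub>m a 0 + B * 0\<^sub>m b 0)
          (0\<^sub>m 0 a * C\<^sup>T + 0\<^sub>m 0 b * D\<^sup>T) (0\<^sub>m 0 a * 0\<^sub>m a 0 + 0\<^sub>m 0 b * 0\<^sub>m b 0)"
    unfolding hcat_four_block[OF assms(1,2)] T
    by (rule mult_four_block_mat[of _ n a _ b _ 0 _ _ q _ 0]) (use assms in auto)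
  also have "\<dots> = A * C\<^sup>T + B * D\<^sup>T"
    using assms by (intro eq_matI) auto
  finally show ?thesis .
qed

lemma hcat_mult_four_block:
  assumes "A \<in> carrier_mat n a" "B \<in> carrier_mat n b"
    and "P \<in> carrier_mat a c" "C \<in> carrier_mat a d" "R \<in> carrier_mat b c"
  shows "hcat A B * four_block_mat P C R (0\<^sub>m b d) = hcat (A * P + B * R) (A * C)"
proof -
  have "hcat A B * four_block_mat P C R (0\<^sub>m b d)
      = four_block_mat (A * P + B * R) (A * C + B * 0\<^sub>m b d)
          (0\<^sub>m 0 a * P + 0\<^sub>m 0 b * R) (0\<^sub>m 0 a * C + 0\<^sub>m 0 b * 0\<^sub>m b d)"
    unfolding hcat_four_block[OF assms(1,2)] using assms
    by (intro mult_four_block_mat[of _ n a _ b _ 0 _ _ c _ d]) auto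
  also have "A * C + B * 0\<^sub>m b d = A * C" using assms by auto
  also have "0\<^sub>m 0 a * P + 0\<^sub>m 0 b * R = 0\<^sub>m 0 c" using assms by auto
  also have "0\<^sub>m 0 a * C + 0\<^sub>m 0 b * 0\<^sub>m b d = 0\<^sub>m 0 d" using assms by auto
  also have "four_block_mat (A * P + B * R) (A * C) (0\<^sub>m 0 c) (0\<^sub>m 0 d) = hcat (A * P + B * R) (A * C)"
    using assms by (intro hcat_four_block[symmetric]) auto
  finally show ?thesis .
qed

lemma orthonormal_hcat:
  assumes "orthonormal_cols (hcat A B)" and A: "A \<in> carrier_mat n a" and B: "B \<in> carrier_mat n b"
  shows "orthonormal_cols B" "A\<^sup>T * B = 0\<^sub>m a b" "B\<^sup>T * A = 0\<^sub>m b a"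
proof -
  let ?H = "hcat A B"
  have H: "?H \<in> carrier_mat n (a + b)" using hcat_carrier[OF A B] .
  have gram: "scalar_prod (col ?H i) (col ?H j) = (if i = j then 1 else 0)" if "i < a + b" "j < a + b" for i j
  proof -
    have "(?H\<^sup>T * ?H) $$ (i, j) = (1\<^sub>m (a + b)) $$ (i, j)"
      using assms(1) H by (simp add: orthonormal_cols_def)
    then show ?thesis using that H by auto
  qed
  have c1: "col ?H i = col A i" if "i < a" for i
    using that A B H cols_hcat[OF A B] cols_nth[of i ?H] cols_nth[of i A]
    by (simp add: nth_append)
  have c2: "col ?H (a + i) = col B i" if "i < b" for i
    using that A B H cols_hcat[OF A B] cols_nth[of "a + i" ?H] cols_nth[of i B]
    by (simp add: nth_append)
  show "orthonormal_cols B"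
    unfolding orthonormal_cols_def
  proof (rule eq_matI)
    fix i j assume "i < dim_row (1\<^sub>m (dim_col B))" "j < dim_col (1\<^sub>m (dim_col B))"
    then show "(B\<^sup>T * B) $$ (i, j) = 1\<^sub>m (dim_col B) $$ (i, j)"
      using B gram[of "a + i" "a + j"] c2 by simp
  qed auto
  show "A\<^sup>T * B = 0\<^sub>m a b"
  proof (rule eq_matI)
    fix i j assume "i < dim_row (0\<^sub>m a b)" "j < dim_col (0\<^sub>m a b)"
    then show "(A\<^sup>T * B) $$ (i, j) = 0\<^sub>m a b $$ (i, j)"
      using A B gram[of i "a + j"] c1 c2 by simp
  qed (use A B in auto)
  show "B\<^sup>T * A = 0\<^sub>m b a"
  proof (rule eq_matI)
    fix i j assume "i < dim_row (0\<^sub>m b a)" "j < dim_col (0\<^sub>m b a)"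
    then show "(B\<^sup>T * A) $$ (i, j) = 0\<^sub>m b a $$ (i, j)"
      using A B gram[of "a + i" j] c1 c2 by simp
  qed (use A B in auto)
qed

section \<open>Truncation\<close>

text \<open>
  The Frobenius norm of a matrix is the \<open>\<ell>\<^sup>2\<close>-norm of its singular values, and truncation sets some
  of them to zero.
\<close>

lemma svd_truncation_frob_le:
  assumes "svd_truncation \<theta> A A'" "A \<in> carrier_mat n q"
  shows "A' \<in> carrier_mat n q" "frob A' \<le> frob A"
proof -
  obtain U s W m k where U: "U \<in> carrier_mat n m" and W: "W \<in> carrier_mat q m"
    and oU: "orthonormal_cols U" and oW: "orthonormal_cols W"
    and A: "A = U * mat_diag m s * W\<^sup>T"
    and A': "A' = U * mat_diag m (\<lambda>i. if i < k then s i else 0) * W\<^sup>T"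
    using assms unfolding svd_truncation_def by auto
  have frob_svd: "frob (U * mat_diag m t * W\<^sup>T) = frob (mat_diag m t)" for t
    using frob_isometry_right[OF oW W, of "U * mat_diag m t" n] U
      frob_isometry[OF oU U mat_diag_dim[of m t]] by simp
  have "frob (mat_diag m (\<lambda>i. if i < k then s i else 0)) \<le> frob (mat_diag m s)"
    unfolding frob_def L2_set_def
    by (intro real_sqrt_le_mono) (auto simp: mat_diag_def split: prod.splits intro!: sum_mono)
  then show "frob A' \<le> frob A" by (simp add: A A' frob_svd)
  show "A' \<in> carrier_mat n q" using U W by (auto simp: A')
qed

text \<open>
  Let \<open>Y = A Z B\<^sup>T\<close>. The truncated part \<open>Gr\<close> is orthogonal to the kept part \<open>Gc\<close> and, because
  \<open>A\<^sup>T Gr B = 0\<close>, also to \<open>Y\<close>. Hence \<open>\<parallel>Gr\<parallel>\<^sup>2 = \<langle>G, Gr\<rangle> = \<langle>G - Y, Gr\<rangle>\<close>, that is \<open>\<parallel>Gr\<parallel> \<le> \<parallel>G - Y\<parallel>\<close>: whatever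
  the tolerance, the truncation cannot change more than the distance to \<open>Y\<close> that is already there.
\<close>

lemma conservative_truncation_bound:
  assumes tr: "conservative_truncation \<theta> r A B G X1 S1 V1"
    and A: "A \<in> carrier_mat n a" and B: "B \<in> carrier_mat q b" and G: "G \<in> carrier_mat n q"
    and Z: "Z \<in> carrier_mat a b"
  shows "frob (X1 * S1 * V1\<^sup>T - A * Z * B\<^sup>T) \<le> 3 * frob (G - A * Z * B\<^sup>T)"
proof -
  define Y where "Y = A * Z * B\<^sup>T"
  let ?E = "G - Y"
  have Y: "Y \<in> carrier_mat n q" using A B Z by (auto simp: Y_def)
  have E: "?E \<in> carrier_mat n q" using Y by (rule minus_carrier_mat)
  obtain Gc Gr Gt where Gc: "Gc \<in> carrier_mat n q" and Gr: "Gr \<in> carrier_mat n q"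
    and split: "G = Gc + Gr" and orth: "frob_inner Gc Gr = 0"
    and null: "A\<^sup>T * Gr * B = 0\<^sub>m a b"
    and svd: "svd_truncation \<theta> Gr Gt" and res: "X1 * S1 * V1\<^sup>T = Gc + Gt"
    using tr G A B unfolding conservative_truncation_def frob_inner_def by auto
  note Gt = svd_truncation_frob_le[OF svd Gr]
  have "frob_inner Y Gr = frob_inner (A * Z) (Gr * B)"
    unfolding Y_def using A B Z Gr by (subst frob_inner_mult_right[of _ n b _ q]) auto
  also have "\<dots> = frob_inner Z (A\<^sup>T * (Gr * B))"
    using A B Z Gr by (intro frob_inner_mult_left[of _ n a _ b]) auto
  also have "A\<^sup>T * (Gr * B) = 0\<^sub>m a b"
    using A B Gr null assoc_mult_mat[of "A\<^sup>T" a n Gr q B b] by simp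
  also have "frob_inner Z (0\<^sub>m a b) = 0" using Z by (simp add: frob_inner_def)
  finally have "frob_inner ?E Gr = frob_inner G Gr"
    using frob_inner_minus_left[OF G Y Gr] by simp
  also have "\<dots> = frob Gr * frob Gr"
    using orth frob_inner_add_left[OF Gc Gr Gr]
    by (simp add: split frob_inner_self power2_eq_square)
  finally have "frob Gr * frob Gr \<le> frob ?E * frob Gr"
    using frob_inner_le[OF E Gr] by simp
  then have le: "frob Gr \<le> frob ?E"
    using frob_nonneg[of Gr] frob_nonneg[of ?E] by (cases "frob Gr = 0") auto
  have "Gc + Gt - Y = ?E + Gt - Gr"
    using Gc Gr Gt(1) Y by (intro eq_matI) (auto simp: split)
  then have "frob (X1 * S1 * V1\<^sup>T - Y) \<le> frob (?E + Gt) + frob Gr"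
    using frob_minus_le[of "?E + Gt" n q Gr] E Gt Gr by (simp add: res)
  also have "\<dots> \<le> frob ?E + frob Gt + frob Gr"
    using frob_add_le[OF E Gt(1)] by simp
  finally show ?thesis using le Gt(2) by (simp add: Y_def)
qed

section \<open>Augmentation\<close>

text \<open>
  Since the range of \<open>Xt\<close> is orthogonal to that of \<open>X\<close>, which contains the columns of \<open>Y\<close>, the block
  \<open>Xt\<^sup>T K\<close> does not change when \<open>Y V\<close> is subtracted from \<open>K\<close>; likewise for \<open>L\<close>. So the product minus \<open>Y\<close>
  is the sum of the errors of the three substeps, each mapped by a contraction.
\<close>

lemma augmented_product_bound:
  assumes X: "X \<in> carrier_mat n a" and Xt: "Xt \<in> carrier_mat n b"
    and V: "V \<in> carrier_mat q c" and Vt: "Vt \<in> carrier_mat q d"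
    and oX: "orthonormal_cols X" and oX': "orthonormal_cols (hcat X Xt)"
    and oV: "orthonormal_cols V" and oV': "orthonormal_cols (hcat V Vt)"
    and Y: "Y \<in> carrier_mat n q"
    and YX: "X * (X\<^sup>T * Y) = Y" and YV: "Y * V * V\<^sup>T = Y"
    and K: "K \<in> carrier_mat n c" "frob (K - Y * V) \<le> e"
    and L: "L \<in> carrier_mat q a" "frob (L\<^sup>T - X\<^sup>T * Y) \<le> e"
    and S: "S \<in> carrier_mat a c" "frob (S - X\<^sup>T * Y * V) \<le> e"
  shows "frob (hcat X Xt * four_block_mat S (L\<^sup>T * Vt) (Xt\<^sup>T * K) (0\<^sub>m b d) * (hcat V Vt)\<^sup>T - Y) \<le> 3 * e"
proof -
  note o = orthonormal_hcat[OF oX' X Xt] orthonormal_hcat[OF oV' V Vt]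
  let ?s = "S - X\<^sup>T * Y * V" and ?l = "L\<^sup>T - X\<^sup>T * Y" and ?k = "K - Y * V"
  let ?G = "hcat X Xt * four_block_mat S (L\<^sup>T * Vt) (Xt\<^sup>T * K) (0\<^sub>m b d) * (hcat V Vt)\<^sup>T"
  have XtY: "X\<^sup>T * Y \<in> carrier_mat a q" and YVc: "Y * V \<in> carrier_mat n c"
    and LVt: "L\<^sup>T * Vt \<in> carrier_mat a d" and XtK: "Xt\<^sup>T * K \<in> carrier_mat b c"
    using X Xt Y V Vt K L by auto
  have sc: "?s \<in> carrier_mat a c" and lc: "?l \<in> carrier_mat a q" and kc: "?k \<in> carrier_mat n c"
    using X Y V K L S by auto
  have "X\<^sup>T * Y * Vt = 0\<^sub>m a d"
  proof -
    have "X\<^sup>T * Y * Vt = X\<^sup>T * (Y * V * V\<^sup>T) * Vt" by (simp add: YV)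
    also have "\<dots> = X\<^sup>T * (Y * V) * (V\<^sup>T * Vt)"
      using X V Vt YVc by (simp add: assoc_mult_mat[of "X\<^sup>T" a n "Y * V * V\<^sup>T" q Vt d]
          assoc_mult_mat[of "Y * V" n c "V\<^sup>T" q Vt d] assoc_mult_mat[of "X\<^sup>T" a n "Y * V" c _ d])
    finally show ?thesis using o(5) right_mult_zero_mat[of "X\<^sup>T * (Y * V)" a c d] X YVc by simp
  qed
  then have l: "?l * Vt = L\<^sup>T * Vt"
    using minus_mult_distrib_mat[of "L\<^sup>T" a q "X\<^sup>T * Y" Vt d] L XtY Vt LVt by auto
  have "Xt\<^sup>T * (Y * V) = 0\<^sub>m b c"
  proof -
    have "Xt\<^sup>T * (Y * V) = Xt\<^sup>T * (X * (X\<^sup>T * Y) * V)" by (simp add: YX)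
    also have "\<dots> = Xt\<^sup>T * X * (X\<^sup>T * Y * V)"
      using X Xt Y V XtY by (simp add: assoc_mult_mat[of _ n a _ q _ c] assoc_mult_mat[of _ b n _ a _ c])
    finally show ?thesis using o X Y V by simp
  qed
  then have k: "Xt\<^sup>T * ?k = Xt\<^sup>T * K"
    using mult_minus_distrib_mat[of "Xt\<^sup>T" b n K c "Y * V"] Xt K YVc XtK by auto
  have "X * (X\<^sup>T * Y * V) * V\<^sup>T = Y"
    by (simp only: assoc_mult_mat[OF X XtY V, symmetric] YX YV)
  then have s: "X * ?s * V\<^sup>T = X * S * V\<^sup>T - Y"
    using X S V Y by (simp add: mult_minus_distrib_mat[of X n a S c] minus_mult_distrib_mat[of _ n c _ "V\<^sup>T" q])
  have "?G = (X * S + Xt * (Xt\<^sup>T * K)) * V\<^sup>T + X * (L\<^sup>T * Vt) * Vt\<^sup>T"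
    unfolding hcat_mult_four_block[OF X Xt S(1) LVt XtK]
    using X Xt S K L V Vt by (intro hcat_mult_hcat_transpose[of _ n c _ d]) auto
  also have "\<dots> = X * S * V\<^sup>T + Xt * (Xt\<^sup>T * K) * V\<^sup>T + X * (L\<^sup>T * Vt) * Vt\<^sup>T"
    using X Xt S K V by (simp add: add_mult_distrib_mat[of _ n c _ _ q])
  finally have "?G - Y = X * ?s * V\<^sup>T + Xt * (Xt\<^sup>T * ?k) * V\<^sup>T + X * (?l * Vt) * Vt\<^sup>T"
    unfolding s l k using X S V Xt K L Vt Y by (intro eq_matI) (auto simp del: index_mult_mat(1))
  also have "frob \<dots> \<le> frob (X * ?s * V\<^sup>T) + frob (Xt * (Xt\<^sup>T * ?k) * V\<^sup>T) + frob (X * (?l * Vt) * Vt\<^sup>T)"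
    using X S V Xt K L Vt Y
    by (intro order_trans[OF frob_add_le[of _ n q]] add_mono order_refl frob_add_le[of _ n q]) auto
  also have "frob (X * ?s * V\<^sup>T) \<le> e"
    using frob_isometry_right[OF oV V, of "X * ?s" n] frob_isometry[OF oX X sc] X sc S(2) by simp
  also have "frob (Xt * (Xt\<^sup>T * ?k) * V\<^sup>T) \<le> e"
    using frob_isometry_right[OF oV V, of "Xt * (Xt\<^sup>T * ?k)" n]
      frob_isometry[OF o(1) Xt, of "Xt\<^sup>T * ?k" c] frob_coisometry[OF o(1) Xt kc] Xt kc K(2) by simp
  also have "frob (X * (?l * Vt) * Vt\<^sup>T) \<le> e"
    using frob_isometry_right[OF o(4) Vt, of "X * (?l * Vt)" n]
      frob_isometry[OF oX X, of "?l * Vt" d] frob_coisometry_right[OF o(4) Vt lc] X Vt lc L(2) by simp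
  finally show ?thesis by simp
qed

section \<open>The three substeps\<close>

text \<open>
  The right-hand sides of the substeps are the full source \<open>- a E - (b H - N)\<close> multiplied by the
  bases. These two rules separate its stiff part \<open>N\<close> from the small part \<open>- a E - b H\<close>.
\<close>

lemma source_mult_right:
  fixes a b :: real
  assumes "E \<in> carrier_mat n q" "H \<in> carrier_mat n q" "N \<in> carrier_mat n q" "V \<in> carrier_mat q c"
  shows "- (a \<cdot>\<^sub>m (E * V)) - (b \<cdot>\<^sub>m H - N) * V = (- (a \<cdot>\<^sub>m E) - b \<cdot>\<^sub>m H) * V + N * V"
proof (rule eq_matI)
  fix i j assume "i < dim_row ((- (a \<cdot>\<^sub>m E) - b \<cdot>\<^sub>m H) * V + N * V)" "j < dim_col ((- (a \<cdot>\<^sub>m E) - b \<cdot>\<^sub>m H) * V + N * V)"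
  then have "i < n" "j < c" using assms by auto
  then show "(- (a \<cdot>\<^sub>m (E * V)) - (b \<cdot>\<^sub>m H - N) * V) $$ (i, j) = ((- (a \<cdot>\<^sub>m E) - b \<cdot>\<^sub>m H) * V + N * V) $$ (i, j)"
    using assms
    by (simp add: scalar_prod_def sum_distrib_left algebra_simps flip: sum.distrib sum_subtractf sum_negf)
qed (use assms in auto)

lemma source_mult_left:
  fixes a b :: real
  assumes "E \<in> carrier_mat n q" "H \<in> carrier_mat n q" "N \<in> carrier_mat n q" "U \<in> carrier_mat c n"
  shows "- (a \<cdot>\<^sub>m (U * E)) - U * (b \<cdot>\<^sub>m H - N) = U * (- (a \<cdot>\<^sub>m E) - b \<cdot>\<^sub>m H) + U * N"
proof (rule eq_matI)
  fix i j assume "i < dim_row (U * (- (a \<cdot>\<^sub>m E) - b \<cdot>\<^sub>m H) + U * N)" "j < dim_col (U * (- (a \<cdot>\<^sub>m E) - b \<cdot>\<^sub>m H) + U * N)"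
  then have "i < c" "j < q" using assms by auto
  then show "(- (a \<cdot>\<^sub>m (U * E)) - U * (b \<cdot>\<^sub>m H - N)) $$ (i, j) = (U * (- (a \<cdot>\<^sub>m E) - b \<cdot>\<^sub>m H) + U * N) $$ (i, j)"
    using assms
    by (simp add: scalar_prod_def sum_distrib_left algebra_simps flip: sum.distrib sum_subtractf sum_negf)
qed (use assms in auto)

lemma smult_minus_mult_right:
  fixes d :: real
  assumes "A \<in> carrier_mat n q" "B \<in> carrier_mat n q" "C \<in> carrier_mat n q" "V \<in> carrier_mat q c"
  shows "(A + d \<cdot>\<^sub>m (B - C)) * V = A * V + d \<cdot>\<^sub>m (B * V - C * V)"
proof (rule eq_matI)
  fix i j assume "i < dim_row (A * V + d \<cdot>\<^sub>m (B * V - C * V))" "j < dim_col (A * V + d \<cdot>\<^sub>m (B * V - C * V))"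
  then have "i < n" "j < c" using assms by auto
  then show "((A + d \<cdot>\<^sub>m (B - C)) * V) $$ (i, j) = (A * V + d \<cdot>\<^sub>m (B * V - C * V)) $$ (i, j)"
    using assms
    by (simp add: scalar_prod_def sum_distrib_left algebra_simps flip: sum.distrib sum_subtractf sum_negf)
qed (use assms in auto)

lemma smult_minus_mult_left:
  fixes d :: real
  assumes "A \<in> carrier_mat n q" "B \<in> carrier_mat n q" "C \<in> carrier_mat n q" "U \<in> carrier_mat c n"
  shows "U * (A + d \<cdot>\<^sub>m (B - C)) = U * A + d \<cdot>\<^sub>m (U * B - U * C)"
proof (rule eq_matI)
  fix i j assume "i < dim_row (U * A + d \<cdot>\<^sub>m (U * B - U * C))" "j < dim_col (U * A + d \<cdot>\<^sub>m (U * B - U * C))"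
  then have "i < c" "j < q" using assms by auto
  then show "(U * (A + d \<cdot>\<^sub>m (B - C))) $$ (i, j) = (U * A + d \<cdot>\<^sub>m (U * B - U * C)) $$ (i, j)"
    using assms
    by (simp add: scalar_prod_def sum_distrib_left algebra_simps flip: sum.distrib sum_subtractf sum_negf)
qed (use assms in auto)

text \<open>
  The three equations are obtained from \<open>\<delta> (G - g) = W + M Y - M G\<close>, where \<open>g = X S V\<^sup>T\<close>, by
  projecting onto \<open>V\<close>, onto \<open>X\<close>, and onto both. All sources are then projections of the single
  matrix \<open>W + \<delta> (g - Y)\<close>, and projecting does not increase the norm.
\<close>

lemma bug_substeps_bound:
  assumes coer: "coercive s M" "0 < s" "0 \<le> \<delta>" and M: "M \<in> carrier_mat n n"
    and X: "X \<in> carrier_mat n a" and V: "V \<in> carrier_mat q c" and S: "S \<in> carrier_mat a c"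
    and oX: "orthonormal_cols X" and oV: "orthonormal_cols V"
    and W: "W \<in> carrier_mat n q" and Y: "Y \<in> carrier_mat n q"
    and K: "K \<in> carrier_mat n c" and L: "L \<in> carrier_mat q a" and S1: "S1 \<in> carrier_mat a c"
    and stepK: "\<delta> \<cdot>\<^sub>m (K - X * S) = W * V + M * (Y * V) - M * K"
    and stepL: "\<delta> \<cdot>\<^sub>m (L\<^sup>T - S * V\<^sup>T)
        = X\<^sup>T * W + X\<^sup>T * M * X * (X\<^sup>T * Y) - X\<^sup>T * M * X * L\<^sup>T"
    and stepS: "\<delta> \<cdot>\<^sub>m (S1 - S)
        = X\<^sup>T * W * V + X\<^sup>T * M * X * (X\<^sup>T * Y * V) - X\<^sup>T * M * X * S1"
  defines "e \<equiv> frob (W + \<delta> \<cdot>\<^sub>m (X * S * V\<^sup>T - Y)) / s"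
  shows "frob (K - Y * V) \<le> e" "frob (L\<^sup>T - X\<^sup>T * Y) \<le> e" "frob (S1 - X\<^sup>T * Y * V) \<le> e"
proof -
  define g where "g = X * S * V\<^sup>T"
  let ?W = "W + \<delta> \<cdot>\<^sub>m (g - Y)"
  have XT: "X\<^sup>T \<in> carrier_mat a n" using X by simp
  have g: "g \<in> carrier_mat n q" using X S V by (auto simp: g_def)
  have Wc: "?W \<in> carrier_mat n q" using W g Y by auto
  have VV: "V\<^sup>T * V = 1\<^sub>m c" using oV V by (simp add: orthonormal_cols_def)
  have XX: "X\<^sup>T * X = 1\<^sub>m a" using oX X by (simp add: orthonormal_cols_def)
  \<comment> \<open>The initial values of the substeps are the projections of \<open>g\<close>.\<close>
  have gV: "g * V = X * S"
    using X S V VV assoc_mult_mat[of "X * S" n c "V\<^sup>T" q V c] right_mult_one_mat[of "X * S" n c]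
    by (simp only: g_def mult_carrier_mat[OF X S] transpose_carrier_mat)
  have Xg: "X\<^sup>T * g = S * V\<^sup>T"
    using X S V XX assoc_mult_mat[of X n a S c "V\<^sup>T" q] assoc_mult_mat[of "X\<^sup>T" a n X a "S * V\<^sup>T" q]
    by (simp add: g_def)
  have XgV: "X\<^sup>T * g * V = S"
    using S V VV by (simp add: Xg assoc_mult_mat[of S a c "V\<^sup>T" q V c])
  have G: "coercive s (X\<^sup>T * M * X)" "X\<^sup>T * M * X \<in> carrier_mat a a"
    using coercive_galerkin[OF coer(1) M oX X] X M by auto
  have "frob (K - Y * V) \<le> frob (W * V + \<delta> \<cdot>\<^sub>m (X * S - Y * V)) / s"
    using X S V W Y K by (intro implicit_step_bound[OF coer M K _ _ _ stepK]) auto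
  also have "W * V + \<delta> \<cdot>\<^sub>m (X * S - Y * V) = ?W * V"
    using smult_minus_mult_right[OF W g Y V, of \<delta>] by (simp only: gV)
  also have "frob (?W * V) / s \<le> e"
    using frob_coisometry_right[OF oV V Wc] coer(2) by (simp add: e_def g_def divide_right_mono)
  finally show "frob (K - Y * V) \<le> e" .
  have "frob (L\<^sup>T - X\<^sup>T * Y) \<le> frob (X\<^sup>T * W + \<delta> \<cdot>\<^sub>m (S * V\<^sup>T - X\<^sup>T * Y)) / s"
    using X S V W Y L by (intro implicit_step_bound[OF G(1) coer(2,3) G(2) _ _ _ _ stepL]) auto
  also have "X\<^sup>T * W + \<delta> \<cdot>\<^sub>m (S * V\<^sup>T - X\<^sup>T * Y) = X\<^sup>T * ?W"
    using smult_minus_mult_left[OF W g Y XT, of \<delta>] by (simp only: Xg)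
  also have "frob (X\<^sup>T * ?W) / s \<le> e"
    using frob_coisometry[OF oX X Wc] coer(2) by (simp add: e_def g_def divide_right_mono)
  finally show "frob (L\<^sup>T - X\<^sup>T * Y) \<le> e" .
  have "frob (S1 - X\<^sup>T * Y * V) \<le> frob (X\<^sup>T * W * V + \<delta> \<cdot>\<^sub>m (S - X\<^sup>T * Y * V)) / s"
    using X S V W Y S1 by (intro implicit_step_bound[OF G(1) coer(2,3) G(2) _ _ _ _ stepS]) auto
  also have "X\<^sup>T * W * V + \<delta> \<cdot>\<^sub>m (S - X\<^sup>T * Y * V) = X\<^sup>T * ?W * V"
    using smult_minus_mult_left[OF W g Y XT, of \<delta>]
      smult_minus_mult_right[of "X\<^sup>T * W" a q "X\<^sup>T * g" "X\<^sup>T * Y" V c \<delta>] X W g Y V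
    by (simp only: XgV mult_carrier_mat[OF XT])
  also have "frob (X\<^sup>T * ?W * V) / s \<le> e"
    using frob_coisometry_right[OF oV V mult_carrier_mat[OF XT Wc]] frob_coisometry[OF oX X Wc] coer(2)
    by (simp add: e_def g_def divide_right_mono)
  finally show "frob (S1 - X\<^sup>T * Y * V) \<le> e" .
qed


section \<open>The limit of the micro part\<close>

definition micro_source :: "rte \<Rightarrow> real vec \<Rightarrow> real mat" where
  "micro_source D u = outer (d0 D AX *\<^sub>v u) (ones D) * Q D AX + outer (d0 D AY *\<^sub>v u) (ones D) * Q D AY"

text \<open>
  The solution \<open>g\<close> of the micro equation with \<open>\<epsilon> = 0\<close>, before any low-rank approximation.
\<close>

definition micro_limit :: "rte \<Rightarrow> real vec \<Rightarrow> real mat" where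
  "micro_limit D T = - (Sig_inv D * micro_source D (planck_vec D T))"

lemma mat_diag_mult_vec:
  fixes f :: "nat \<Rightarrow> real"
  assumes "u \<in> carrier_vec n" "i < n"
  shows "vec_index (mat_diag n f *\<^sub>v u) i = f i * vec_index u i"
  using assms by (simp add: mat_diag_def scalar_prod_def if_distrib[of "\<lambda>x. x * _"] cong: if_cong)

lemma sum_lessThan_two: "(\<Sum>k<2. f k) = f 0 + f (1::nat)" for f :: "nat \<Rightarrow> real"
  by (simp add: numeral_2_eq_2)

lemma d0_carrier [simp]: "d0 D v \<in> carrier_mat (NI D) (NC D)"
  by (simp add: d0_def)

lemma Sig_carrier [simp]: "Sig D \<in> carrier_mat (NI D) (NI D)" "Sig_inv D \<in> carrier_mat (NI D) (NI D)"
  by (simp_all add: Sig_def Sig_inv_def)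

lemma dirs_carrier [simp]:
  "dirs_X D T \<in> carrier_mat (NI D) 2" "dirs_V D \<in> carrier_mat (Nq D) 2"
  by (auto simp: dirs_X_def dirs_V_def mat_of_cols_def)

lemma Lop_carrier [simp]: "Lop D Y \<in> carrier_mat (NI D) (Nq D)"
  by (auto simp: Lop_def Dminus_def Qplus_def mat_diag_def)

lemma Proj_carrier [simp]: "quadrature D \<Longrightarrow> Proj D \<in> carrier_mat (Nq D) (Nq D)"
  by (auto simp: Proj_def outer_def ones_def quadrature_def)

lemma discretization_dims [simp]:
  "dim_row (d0 D v) = NI D" "dim_col (d0 D v) = NC D" "dim_row (D0 D v) = NC D" "dim_col (D0 D v) = NI D"
  "dim_row (Sig D) = NI D" "dim_col (Sig D) = NI D" "dim_row (dirs_X D T) = NI D" "dim_col (dirs_X D T) = 2"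
  "dim_row (dirs_V D) = Nq D" "dim_col (dirs_V D) = 2" "dim_vec (ones D) = Nq D" "dim_row (Q D v) = Nq D" "dim_col (Q D v) = Nq D"
  by (simp_all add: d0_def D0_def Sig_def mat_diag_def dirs_X_def dirs_V_def ones_def Q_def)

lemma Q_ones: "Q D v *\<^sub>v ones D = vec (Nq D) (Om D v)"
  by (intro eq_vecI) (auto simp: Q_def mat_diag_def ones_def scalar_prod_def)

lemma outer_ones_mult_Q:
  assumes "u \<in> carrier_vec n"
  shows "outer u (ones D) * Q D v = outer u (Q D v *\<^sub>v ones D)"
proof -
  have "outer u (ones D) \<in> carrier_mat n (Nq D)" using assms by (simp add: outer_def ones_def)
  then show ?thesis
    unfolding Q_ones unfolding Q_def
    by (subst mat_diag_mult_right, assumption) (use assms in \<open>auto simp: outer_def ones_def\<close>)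
qed

lemma micro_source_eq_outer:
  "micro_source D u = outer (d0 D AX *\<^sub>v u) (Q D AX *\<^sub>v ones D) + outer (d0 D AY *\<^sub>v u) (Q D AY *\<^sub>v ones D)"
  by (simp add: micro_source_def outer_ones_mult_Q[OF carrier_vecI[of _ "NI D"]])

lemma micro_source_carrier [simp]: "micro_source D u \<in> carrier_mat (NI D) (Nq D)"
  by (simp add: micro_source_eq_outer outer_def Q_ones)

lemma micro_source_index:
  assumes "i < NI D" "l < Nq D"
  shows "micro_source D u $$ (i, l) = vec_index (d0 D AX *\<^sub>v u) i * Om D AX l + vec_index (d0 D AY *\<^sub>v u) i * Om D AY l"
  using assms unfolding micro_source_eq_outer Q_ones by (simp add: outer_def)

lemma Rop_eq_micro_source:
  assumes "T \<in> carrier_vec (NC D)" "h \<in> carrier_vec (NC D)"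
  shows "Rop D \<epsilon> T h = \<epsilon>\<^sup>2 \<cdot>\<^sub>m micro_source D h + micro_source D (planck_vec D T)"
proof -
  have "Rop D \<epsilon> T h = micro_source D (planck_vec D T + \<epsilon>\<^sup>2 \<cdot>\<^sub>v h)"
    by (simp add: Rop_def micro_source_def)
  also have "\<dots> = \<epsilon>\<^sup>2 \<cdot>\<^sub>m micro_source D h + micro_source D (planck_vec D T)"
  proof (rule eq_matI)
    fix i l assume "i < dim_row (\<epsilon>\<^sup>2 \<cdot>\<^sub>m micro_source D h + micro_source D (planck_vec D T))"
      "l < dim_col (\<epsilon>\<^sup>2 \<cdot>\<^sub>m micro_source D h + micro_source D (planck_vec D T))"
    then have il: "i < NI D" "l < Nq D" using carrier_matD[OF micro_source_carrier] by auto
    have "d0 D v *\<^sub>v (planck_vec D T + \<epsilon>\<^sup>2 \<cdot>\<^sub>v h) = d0 D v *\<^sub>v planck_vec D T + \<epsilon>\<^sup>2 \<cdot>\<^sub>v (d0 D v *\<^sub>v h)" for v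
      using assms by (simp add: mult_add_distrib_mat_vec[OF d0_carrier] mult_mat_vec[OF d0_carrier])
    then show "micro_source D (planck_vec D T + \<epsilon>\<^sup>2 \<cdot>\<^sub>v h) $$ (i, l)
        = (\<epsilon>\<^sup>2 \<cdot>\<^sub>m micro_source D h + micro_source D (planck_vec D T)) $$ (i, l)"
      using il carrier_matD[OF micro_source_carrier] carrier_matD[OF d0_carrier]
      by (simp add: micro_source_index algebra_simps)
  qed (use carrier_matD[OF micro_source_carrier] in auto)
  finally show ?thesis .
qed

lemma micro_limit_carrier [simp]: "micro_limit D T \<in> carrier_mat (NI D) (Nq D)"
  unfolding micro_limit_def by (intro uminus_carrier_mat mult_carrier_mat[of _ _ "NI D"]) auto

lemma micro_limit_index:
  assumes "i < NI D" "l < Nq D"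
  shows "micro_limit D T $$ (i, l)
    = - (1 / sigt D (pos D (KI D ! i)) * micro_source D (planck_vec D T) $$ (i, l))"
  using assms carrier_matD[OF micro_source_carrier]
  unfolding micro_limit_def Sig_inv_def mat_diag_mult_left[OF micro_source_carrier] by simp

text \<open>
  The limit is supported on the pre-augmented directions. This is the reason for the
  pre-augmentation, and the form required by the truncation bound.
\<close>

lemma micro_limit_eq_dirs: "micro_limit D T = dirs_X D T * (- 1\<^sub>m 2) * (dirs_V D)\<^sup>T"
proof (rule eq_matI)
  fix i l assume "i < dim_row (dirs_X D T * (- 1\<^sub>m 2) * (dirs_V D)\<^sup>T)"
    "l < dim_col (dirs_X D T * (- 1\<^sub>m 2) * (dirs_V D)\<^sup>T)"
  then have il: "i < NI D" "l < Nq D" using dirs_carrier(1)[of D T] dirs_carrier(2)[of D] by auto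
  have X: "dirs_X D T * (- 1\<^sub>m 2) = - dirs_X D T"
    using dirs_carrier(1)[of D T] uminus_mult_right_mat[of "1\<^sub>m 2" "dirs_X D T"] by simp
  have S: "vec_index (Sig_inv D *\<^sub>v u) i = 1 / sigt D (pos D (KI D ! i)) * vec_index u i" if "u \<in> carrier_vec (NI D)" for u
    using il that by (simp add: Sig_inv_def mat_diag_mult_vec del: index_mult_mat_vec)
  define b where "b v = d0 D v *\<^sub>v planck_vec D T" for v
  have b: "b v \<in> carrier_vec (NI D)" for v by (simp add: b_def carrier_vecI)
  show "micro_limit D T $$ (i, l) = (dirs_X D T * (- 1\<^sub>m 2) * (dirs_V D)\<^sup>T) $$ (i, l)"
    unfolding X micro_limit_index[OF il] micro_source_index[OF il]
    using il by (simp add: scalar_prod_def atLeast0LessThan sum_lessThan_two dirs_X_def dirs_V_def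
        mat_of_cols_index Q_ones S[OF b] algebra_simps flip: b_def)
qed (use carrier_matD[OF micro_limit_carrier] dirs_carrier(1)[of D T] dirs_carrier(2)[of D] in auto)

lemma Sig_mult_micro_limit:
  assumes "rte_discretization D"
  shows "Sig D * micro_limit D T = - micro_source D (planck_vec D T)"
proof (rule eq_matI)
  fix i l assume "i < dim_row (- micro_source D (planck_vec D T))" "l < dim_col (- micro_source D (planck_vec D T))"
  then have il: "i < NI D" "l < Nq D" using carrier_matD[OF micro_source_carrier] by auto
  have "sigt D p > 0" for p
    using assms unfolding rte_discretization_def by (metis less_le_trans)
  then have "sigt D p \<noteq> 0" for p by (simp add: less_imp_neq[symmetric])
  then show "(Sig D * micro_limit D T) $$ (i, l) = (- micro_source D (planck_vec D T)) $$ (i, l)"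
    using il carrier_matD[OF micro_source_carrier]
    unfolding Sig_def mat_diag_mult_left[OF micro_limit_carrier]
    by (simp add: micro_limit_index)
qed (use carrier_matD[OF micro_source_carrier] carrier_matD[OF micro_limit_carrier] carrier_matD[OF Sig_carrier(1)] in auto)

section \<open>The micro part after one step\<close>

lemma transpose_range_right:
  fixes V B :: "real mat"
  assumes "V \<in> carrier_mat q m" "B \<in> carrier_mat q b" "V * (V\<^sup>T * B) = B"
  shows "B\<^sup>T * V * V\<^sup>T = B\<^sup>T"
proof -
  have "(V * (V\<^sup>T * B))\<^sup>T = B\<^sup>T * V * V\<^sup>T"
    using assms(1,2) by (simp add: transpose_mult[of V q m _ b] transpose_mult[of _ m q B b])
  then show ?thesis by (simp add: assms(3))
qed

lemma Sig_galerkin_symmetric: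
  assumes "X \<in> carrier_mat (NI D) a"
  shows "(X\<^sup>T * Sig D * X)\<^sup>T = X\<^sup>T * Sig D * X"
proof -
  have "(Sig D)\<^sup>T = Sig D" by (auto simp: Sig_def mat_diag_def intro!: eq_matI)
  then show ?thesis
    using assms transpose_mult[of "X\<^sup>T * Sig D" a "NI D" X a] transpose_mult[of "X\<^sup>T" a "NI D" "Sig D" "NI D"]
      assoc_mult_mat[of "X\<^sup>T" a "NI D" "Sig D" "NI D" X a] mult_carrier_mat[of "X\<^sup>T" a "NI D" "Sig D" "NI D"]
    by (simp del: assoc_mult_mat)
qed

lemma transpose_implicit_step:
  fixes A B C Z :: "real mat"
  assumes "A \<in> carrier_mat n q" "B \<in> carrier_mat n q" "C \<in> carrier_mat n q"
    "L \<in> carrier_mat q n" "Z \<in> carrier_mat n q"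
    and "d \<cdot>\<^sub>m (L - Z\<^sup>T) = - (e \<cdot>\<^sub>m A\<^sup>T) - B\<^sup>T - C\<^sup>T"
  shows "d \<cdot>\<^sub>m (L\<^sup>T - Z) = - (e \<cdot>\<^sub>m A) - B - C"
proof -
  have "d \<cdot>\<^sub>m (L\<^sup>T - Z) = (d \<cdot>\<^sub>m (L - Z\<^sup>T))\<^sup>T"
    using assms(4,5) by (intro eq_matI) auto
  also have "\<dots> = - (e \<cdot>\<^sub>m A) - B - C"
    unfolding assms(6) using assms(1-3) by (intro eq_matI) auto
  finally show ?thesis .
qed

text \<open>
  The enlarged bases still represent the old \<open>g\<close> exactly, and they represent the limit exactly.
\<close>

lemma preaugmentation_facts:
  assumes "preaugmentation D T X S V Xn Sn Vn"
    and X: "X \<in> carrier_mat (NI D) r" and S: "S \<in> carrier_mat r r" and V: "V \<in> carrier_mat (Nq D) r"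
  obtains a c where "Xn \<in> carrier_mat (NI D) a" "Vn \<in> carrier_mat (Nq D) c" "Sn \<in> carrier_mat a c"
    "orthonormal_cols Xn" "orthonormal_cols Vn" "Xn * Sn * Vn\<^sup>T = X * S * V\<^sup>T"
    "Xn * (Xn\<^sup>T * micro_limit D T) = micro_limit D T" "micro_limit D T * Vn * Vn\<^sup>T = micro_limit D T"
proof -
  note pre = assms(1)[unfolded preaugmentation_def]
  obtain a where Xn: "Xn \<in> carrier_mat (NI D) a" "orthonormal_cols Xn"
    and XA: "Xn * (Xn\<^sup>T * dirs_X D T) = dirs_X D T" and XX: "Xn * (Xn\<^sup>T * X) = X"
    using onb_of_hcat[OF _ dirs_carrier(1) X] pre by metis
  obtain c where Vn: "Vn \<in> carrier_mat (Nq D) c" "orthonormal_cols Vn"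
    and VB: "Vn * (Vn\<^sup>T * dirs_V D) = dirs_V D" and VV: "Vn * (Vn\<^sup>T * V) = V"
    using onb_of_hcat[OF _ dirs_carrier(2) V] pre by metis
  have T: "Xn\<^sup>T \<in> carrier_mat a (NI D)" "Vn\<^sup>T \<in> carrier_mat c (Nq D)" "V\<^sup>T \<in> carrier_mat r (Nq D)"
    using Xn Vn V by auto
  have Sn: "Sn = Xn\<^sup>T * X * S * V\<^sup>T * Vn" using pre by simp
  have Snc: "Sn \<in> carrier_mat a c" using T X S V Vn by (auto simp: Sn)
  define Z where "Z = S * V\<^sup>T"
  have Z: "Z \<in> carrier_mat r (Nq D)" using S V by (auto simp: Z_def)
  have ZV: "Z * Vn * Vn\<^sup>T = Z"
    using S T Vn transpose_range_right[OF Vn(1) V VV] assoc_mult_mat[OF T(3) Vn(1) T(2)]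
      assoc_mult_mat[OF S T(3), of "Vn * Vn\<^sup>T" "Nq D"] assoc_mult_mat[OF Z Vn(1) T(2)]
    by (auto simp: Z_def)
  have "Sn = Xn\<^sup>T * X * (Z * Vn)"
    using T X Z Vn assoc_mult_mat[of "Xn\<^sup>T * X" a r S r "V\<^sup>T" "Nq D"] S
      assoc_mult_mat[of "Xn\<^sup>T * X" a r Z "Nq D" Vn c] mult_carrier_mat[OF T(1) X]
    by (simp add: Sn Z_def del: assoc_mult_mat)
  then have "Xn * Sn * Vn\<^sup>T = Xn * (Xn\<^sup>T * X) * (Z * Vn * Vn\<^sup>T)"
    using mult_carrier_mat[OF T(1) X] mult_carrier_mat[OF Z Vn(1)] Xn(1) T(2)
    by (simp only: assoc_mult_mat[of Xn "NI D" a "Xn\<^sup>T * X" r "Z * Vn" c, symmetric] mult_carrier_mat[of Xn]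
        assoc_mult_mat[of "Xn * (Xn\<^sup>T * X)" "NI D" r "Z * Vn" c "Vn\<^sup>T" "Nq D"])
  also have "\<dots> = X * S * V\<^sup>T" unfolding ZV XX using X S T by (simp add: Z_def)
  finally have g: "Xn * Sn * Vn\<^sup>T = X * S * V\<^sup>T" .
  define N where "N = (- 1\<^sub>m 2) * (dirs_V D)\<^sup>T"
  have N: "N \<in> carrier_mat 2 (Nq D)" by (auto simp: N_def)
  have Y: "micro_limit D T = dirs_X D T * N"
    unfolding micro_limit_eq_dirs N_def by (intro assoc_mult_mat[of _ "NI D" 2 _ 2 _ "Nq D"]) auto
  have NV: "N * Vn * Vn\<^sup>T = N"
    using transpose_range_right[OF Vn(1) dirs_carrier(2) VB] T Vn
      assoc_mult_mat[of "(dirs_V D)\<^sup>T" 2 "Nq D" Vn c "Vn\<^sup>T" "Nq D"]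
      assoc_mult_mat[of "- 1\<^sub>m 2" 2 2 "(dirs_V D)\<^sup>T" "Nq D" "Vn * Vn\<^sup>T" "Nq D"] assoc_mult_mat[OF N Vn(1) T(2)]
    by (auto simp: N_def)
  have "Xn * (Xn\<^sup>T * (dirs_X D T * N)) = Xn * (Xn\<^sup>T * dirs_X D T) * N"
    using Xn T N by (simp add: assoc_mult_mat[of _ _ "NI D" _ 2 _ "Nq D"] assoc_mult_mat[of _ "NI D" a _ 2 _ "Nq D"])
  then have YX: "Xn * (Xn\<^sup>T * micro_limit D T) = micro_limit D T" by (simp add: Y XA)
  have "dirs_X D T * N * Vn * Vn\<^sup>T = dirs_X D T * (N * Vn * Vn\<^sup>T)"
    by (simp only: assoc_mult_mat[OF dirs_carrier(1) N Vn(1)]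
        assoc_mult_mat[OF dirs_carrier(1) mult_carrier_mat[OF N Vn(1)] T(2)])
  then have YV: "micro_limit D T * Vn * Vn\<^sup>T = micro_limit D T" by (simp add: Y NV)
  show thesis by (rule that[OF Xn(1) Vn(1) Snc Xn(2) Vn(2) g YX YV])
qed

text \<open>
  The factor 9 is 3 (three substeps) times 3 (truncation).
\<close>

lemma bug_step_micro_bound:
  assumes D: "rte_discretization D" and step: "bug_step D \<theta> \<epsilon> T h X S V T1 h1 X1 S1 V1"
    and s: "0 < s" "\<And>p. s \<le> sigt D p"
  defines "g \<equiv> X * S * V\<^sup>T"
  shows "X1 * S1 * V1\<^sup>T \<in> carrier_mat (NI D) (Nq D)"
    and "frob (X1 * S1 * V1\<^sup>T - micro_limit D T)
    \<le> 9 / s * frob (- (\<epsilon> \<cdot>\<^sub>m (Lop D g * (Proj D)\<^sup>T)) - \<epsilon>\<^sup>2 \<cdot>\<^sub>m micro_source D h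
        + (\<epsilon>\<^sup>2 / (light D * dt D)) \<cdot>\<^sub>m (g - micro_limit D T))"
proof -
  obtain r Xn Sn Vn K1 L1 Sbar Xt Vt where Tc: "T \<in> carrier_vec (NC D)" and hc: "h \<in> carrier_vec (NC D)"
    and X: "X \<in> carrier_mat (NI D) r" and S: "S \<in> carrier_mat r r" and V: "V \<in> carrier_mat (Nq D) r"
    and pre: "preaugmentation D T X S V Xn Sn Vn"
    and K: "K_step D \<epsilon> T h Xn Sn Vn K1" and L: "L_step D \<epsilon> T h Xn Sn Vn L1"
    and SS: "S_step D \<epsilon> T h Xn Sn Vn Sbar"
    and Xt: "dim_row Xt = NI D" "onb_of_cols (hcat Xn K1) (hcat Xn Xt)"
    and Vt: "dim_row Vt = Nq D" "onb_of_cols (hcat Vn L1) (hcat Vn Vt)"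
    and tr: "conservative_truncation \<theta> (2 * (r + 2)) (dirs_X D T) (dirs_V D)
          (hcat Xn Xt
            * four_block_mat Sbar (L1\<^sup>T * Vt) (Xt\<^sup>T * K1) (0\<^sub>m (dim_col Xt) (dim_col Vt))
            * (hcat Vn Vt)\<^sup>T)
          X1 S1 V1"
    using step unfolding bug_step_def by metis
  obtain a c where Xn: "Xn \<in> carrier_mat (NI D) a" and Vn: "Vn \<in> carrier_mat (Nq D) c"
    and Sn: "Sn \<in> carrier_mat a c" and oX: "orthonormal_cols Xn" and oV: "orthonormal_cols Vn"
    and gn: "Xn * Sn * Vn\<^sup>T = g"
    and YX: "Xn * (Xn\<^sup>T * micro_limit D T) = micro_limit D T" and YV: "micro_limit D T * Vn * Vn\<^sup>T = micro_limit D T"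
    unfolding g_def by (rule preaugmentation_facts[OF pre X S V])
  obtain b where Xtc: "Xt \<in> carrier_mat (NI D) b" using Xt(1) by blast
  obtain d where Vtc: "Vt \<in> carrier_mat (Nq D) d" using Vt(1) by blast
  define Y where "Y = micro_limit D T"
  define E where "E = Lop D g * (Proj D)\<^sup>T"
  define H where "H = micro_source D h"
  define W where "W = - (\<epsilon> \<cdot>\<^sub>m E) - \<epsilon>\<^sup>2 \<cdot>\<^sub>m H"
  define \<delta> where "\<delta> = \<epsilon>\<^sup>2 / (light D * dt D)"
  have P: "(Proj D)\<^sup>T \<in> carrier_mat (Nq D) (Nq D)" and \<delta>: "0 \<le> \<delta>"
    using D by (auto simp: rte_discretization_def \<delta>_def)
  have Lc: "Lop D g \<in> carrier_mat (NI D) (Nq D)" and Sg: "Sig D \<in> carrier_mat (NI D) (NI D)" by auto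
  have Y: "Y \<in> carrier_mat (NI D) (Nq D)" and H: "H \<in> carrier_mat (NI D) (Nq D)"
    by (auto simp: Y_def H_def)
  have E: "E \<in> carrier_mat (NI D) (Nq D)"
    unfolding E_def using Lc P by (rule mult_carrier_mat)
  have N: "Sig D * Y \<in> carrier_mat (NI D) (Nq D)" and W: "W \<in> carrier_mat (NI D) (Nq D)"
    using Y E H Sg by (auto simp: W_def)
  have XT: "Xn\<^sup>T \<in> carrier_mat a (NI D)" and VT: "Vn\<^sup>T \<in> carrier_mat c (Nq D)" using Xn Vn by auto
  \<comment> \<open>The stiff part of the source is in equilibrium at \<open>Y\<close>.\<close>
  have R: "Rop D \<epsilon> T h = \<epsilon>\<^sup>2 \<cdot>\<^sub>m H - Sig D * Y"
    unfolding Rop_eq_micro_source[OF Tc hc] Y_def Sig_mult_micro_limit[OF D] H_def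
    using carrier_matD[OF micro_source_carrier] by (intro eq_matI) auto
  have K1: "K1 \<in> carrier_mat (NI D) c" and L1: "L1 \<in> carrier_mat (Nq D) a" and Sb: "Sbar \<in> carrier_mat a c"
    using K L SS Xn Vn by (auto simp: K_step_def L_step_def S_step_def)
  have stepK: "\<delta> \<cdot>\<^sub>m (K1 - Xn * Sn) = W * Vn + Sig D * (Y * Vn) - Sig D * K1"
  proof -
    have "\<delta> \<cdot>\<^sub>m (K1 - Xn * Sn) = - (\<epsilon> \<cdot>\<^sub>m (E * Vn)) - Rop D \<epsilon> T h * Vn - Sig D * K1"
      using K by (simp only: K_step_def \<delta>_def E_def gn)
    also have "- (\<epsilon> \<cdot>\<^sub>m (E * Vn)) - Rop D \<epsilon> T h * Vn = W * Vn + Sig D * Y * Vn"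
      unfolding R W_def by (rule source_mult_right[OF E H N Vn])
    also have "Sig D * Y * Vn = Sig D * (Y * Vn)"
      using Sg Y Vn by (rule assoc_mult_mat)
    finally show ?thesis .
  qed
  \<comment> \<open>The projected source is the reduced operator applied to the projection of \<open>Y\<close>.\<close>
  have XS: "Xn\<^sup>T * (Sig D * Y) = Xn\<^sup>T * Sig D * Xn * (Xn\<^sup>T * Y)"
  proof -
    have "Xn\<^sup>T * (Sig D * Y) = Xn\<^sup>T * (Sig D * (Xn * (Xn\<^sup>T * Y)))"
      by (simp only: YX Y_def)
    also have "\<dots> = Xn\<^sup>T * Sig D * Xn * (Xn\<^sup>T * Y)"
      by (simp only: assoc_mult_mat[OF XT Sg mult_carrier_mat[OF Xn mult_carrier_mat[OF XT Y]]]
          assoc_mult_mat[OF mult_carrier_mat[OF XT Sg] Xn mult_carrier_mat[OF XT Y]])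
    finally show ?thesis .
  qed
  \<comment> \<open>The L-step becomes an equation for \<open>L\<^sup>T\<close>, with the same reduced operator as the S-step.\<close>
  have stepL: "\<delta> \<cdot>\<^sub>m (L1\<^sup>T - Sn * Vn\<^sup>T)
      = Xn\<^sup>T * W + Xn\<^sup>T * Sig D * Xn * (Xn\<^sup>T * Y) - Xn\<^sup>T * Sig D * Xn * L1\<^sup>T"
  proof -
    have M: "Xn\<^sup>T * Sig D * Xn \<in> carrier_mat a a" using XT Xn Sg by auto
    have gT: "Xn * (Vn * Sn\<^sup>T)\<^sup>T = g"
      using Xn Sn Vn gn by (simp add: transpose_mult[of Vn "Nq D" c _ a])
    have ET: "Proj D * (Lop D g)\<^sup>T * Xn = (Xn\<^sup>T * E)\<^sup>T"
      using transpose_mult[OF XT E] transpose_mult[OF Lc P] by (simp add: E_def)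
    have RT: "(Rop D \<epsilon> T h)\<^sup>T * Xn = (Xn\<^sup>T * Rop D \<epsilon> T h)\<^sup>T"
      using transpose_mult[OF XT minus_carrier_mat[OF N], of "\<epsilon>\<^sup>2 \<cdot>\<^sub>m H"] R by simp
    have LT: "L1 * (Xn\<^sup>T * Sig D * Xn) = (Xn\<^sup>T * Sig D * Xn * L1\<^sup>T)\<^sup>T"
      using transpose_mult[OF M, of "L1\<^sup>T" "Nq D"] L1 by (simp only: Sig_galerkin_symmetric[OF Xn] transpose_transpose transpose_carrier_mat)
    have VS: "Vn * Sn\<^sup>T = (Sn * Vn\<^sup>T)\<^sup>T" using transpose_mult[OF Sn VT] by simp
    have "\<delta> \<cdot>\<^sub>m (L1 - Vn * Sn\<^sup>T) = - (\<epsilon> \<cdot>\<^sub>m (Proj D * (Lop D g)\<^sup>T * Xn)) - (Rop D \<epsilon> T h)\<^sup>T * Xn - L1 * (Xn\<^sup>T * Sig D * Xn)"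
      using L by (simp only: L_step_def \<delta>_def gT)
    then have "\<delta> \<cdot>\<^sub>m (L1 - (Sn * Vn\<^sup>T)\<^sup>T)
        = - (\<epsilon> \<cdot>\<^sub>m (Xn\<^sup>T * E)\<^sup>T) - (Xn\<^sup>T * Rop D \<epsilon> T h)\<^sup>T - (Xn\<^sup>T * Sig D * Xn * L1\<^sup>T)\<^sup>T"
      by (simp only: ET RT LT VS)
    moreover have "Rop D \<epsilon> T h \<in> carrier_mat (NI D) (Nq D)"
      unfolding R using N by (rule minus_carrier_mat)
    ultimately have "\<delta> \<cdot>\<^sub>m (L1\<^sup>T - Sn * Vn\<^sup>T) = - (\<epsilon> \<cdot>\<^sub>m (Xn\<^sup>T * E)) - Xn\<^sup>T * Rop D \<epsilon> T h - Xn\<^sup>T * Sig D * Xn * L1\<^sup>T"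
      using XT E M L1 Sn VT by (intro transpose_implicit_step[of _ a "Nq D"]) auto
    also have "- (\<epsilon> \<cdot>\<^sub>m (Xn\<^sup>T * E)) - Xn\<^sup>T * Rop D \<epsilon> T h = Xn\<^sup>T * W + Xn\<^sup>T * (Sig D * Y)"
      unfolding R W_def by (rule source_mult_left[OF E H N XT])
    finally show ?thesis unfolding XS .
  qed
  have stepS: "\<delta> \<cdot>\<^sub>m (Sbar - Sn)
      = Xn\<^sup>T * W * Vn + Xn\<^sup>T * Sig D * Xn * (Xn\<^sup>T * Y * Vn) - Xn\<^sup>T * Sig D * Xn * Sbar"
  proof -
    have XE: "Xn\<^sup>T * E \<in> carrier_mat a (Nq D)" and XH: "Xn\<^sup>T * H \<in> carrier_mat a (Nq D)"
      and XN: "Xn\<^sup>T * (Sig D * Y) \<in> carrier_mat a (Nq D)" and M: "Xn\<^sup>T * Sig D * Xn \<in> carrier_mat a a"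
      using XT E H N Xn Sg by auto
    have "\<delta> \<cdot>\<^sub>m (Sbar - Sn) = - (\<epsilon> \<cdot>\<^sub>m (Xn\<^sup>T * Lop D g * (Proj D)\<^sup>T * Vn)) - Xn\<^sup>T * Rop D \<epsilon> T h * Vn - Xn\<^sup>T * Sig D * Xn * Sbar"
      using SS by (simp only: S_step_def \<delta>_def gn)
    also have "Xn\<^sup>T * Lop D g * (Proj D)\<^sup>T = Xn\<^sup>T * E"
      unfolding E_def using XT Lc P by (rule assoc_mult_mat)
    also have "Xn\<^sup>T * Rop D \<epsilon> T h = \<epsilon>\<^sup>2 \<cdot>\<^sub>m (Xn\<^sup>T * H) - Xn\<^sup>T * (Sig D * Y)"
      unfolding R using mult_minus_distrib_mat[OF XT smult_carrier_mat[OF H] N] mult_smult_distrib[OF XT H] by simp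
    also have "- (\<epsilon> \<cdot>\<^sub>m (Xn\<^sup>T * E * Vn)) - (\<epsilon>\<^sup>2 \<cdot>\<^sub>m (Xn\<^sup>T * H) - Xn\<^sup>T * (Sig D * Y)) * Vn
        = (- (\<epsilon> \<cdot>\<^sub>m (Xn\<^sup>T * E)) - \<epsilon>\<^sup>2 \<cdot>\<^sub>m (Xn\<^sup>T * H)) * Vn + Xn\<^sup>T * (Sig D * Y) * Vn"
      by (rule source_mult_right[OF XE XH XN Vn])
    also have "- (\<epsilon> \<cdot>\<^sub>m (Xn\<^sup>T * E)) - \<epsilon>\<^sup>2 \<cdot>\<^sub>m (Xn\<^sup>T * H) = Xn\<^sup>T * W"
      unfolding W_def using mult_minus_distrib_mat[OF XT uminus_carrier_mat[OF smult_carrier_mat[OF E]] smult_carrier_mat[OF H]]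
        mult_smult_distrib[OF XT H] mult_smult_distrib[OF XT E] uminus_mult_right_mat[of "\<epsilon> \<cdot>\<^sub>m E" "Xn\<^sup>T"] XT E by simp
    also have "Xn\<^sup>T * (Sig D * Y) * Vn = Xn\<^sup>T * Sig D * Xn * (Xn\<^sup>T * Y * Vn)"
      unfolding XS by (rule assoc_mult_mat[OF M mult_carrier_mat[OF XT Y] Vn])
    finally show ?thesis .
  qed
  have coer: "coercive s (Sig D)"
    unfolding Sig_def by (rule coercive_mat_diag) (rule s(2))
  let ?e = "frob (W + \<delta> \<cdot>\<^sub>m (Xn * Sn * Vn\<^sup>T - Y)) / s"
  note sub = bug_substeps_bound[OF coer s(1) \<delta> Sg Xn Vn Sn oX oV W Y K1 L1 Sb stepK stepL stepS]
  let ?G = "hcat Xn Xt * four_block_mat Sbar (L1\<^sup>T * Vt) (Xt\<^sup>T * K1) (0\<^sub>m b d) * (hcat Vn Vt)\<^sup>T"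
  have G: "?G \<in> carrier_mat (NI D) (Nq D)"
    using hcat_carrier[OF Xn Xtc] hcat_carrier[OF Vn Vtc] Sb Xtc Vtc by auto
  have bound: "frob (?G - Y) \<le> 3 * ?e"
    using Xt(2) Vt(2) YX YV
    by (intro augmented_product_bound[OF Xn Xtc Vn Vtc oX _ oV _ Y _ _ K1 sub(1) L1 sub(2) Sb sub(3)])
      (auto simp: onb_of_cols_def Y_def)
  have tr': "conservative_truncation \<theta> (2 * (r + 2)) (dirs_X D T) (dirs_V D) ?G X1 S1 V1"
    using tr Xtc Vtc by simp
  then show "X1 * S1 * V1\<^sup>T \<in> carrier_mat (NI D) (Nq D)"
    unfolding conservative_truncation_def carrier_matD[OF G]
    by (meson mult_carrier_mat transpose_carrier_mat)
  have "frob (X1 * S1 * V1\<^sup>T - Y) \<le> 3 * frob (?G - Y)"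
    unfolding Y_def micro_limit_eq_dirs
    by (rule conservative_truncation_bound[OF tr' dirs_carrier G]) simp
  also have "\<dots> \<le> 9 * ?e" using bound by simp
  finally show "frob (X1 * S1 * V1\<^sup>T - micro_limit D T)
    \<le> 9 / s * frob (- (\<epsilon> \<cdot>\<^sub>m (Lop D g * (Proj D)\<^sup>T)) - \<epsilon>\<^sup>2 \<cdot>\<^sub>m micro_source D h
        + (\<epsilon>\<^sup>2 / (light D * dt D)) \<cdot>\<^sub>m (g - micro_limit D T))"
    by (simp add: gn W_def E_def H_def Y_def \<delta>_def)
qed

section \<open>Size of the remainder\<close>

lemma abs_index_le_frob:
  assumes "A \<in> carrier_mat n m" "i < n" "j < m"
  shows "\<bar>A $$ (i, j)\<bar> \<le> frob A"
proof -
  have "\<bar>A $$ (i, j)\<bar> \<le> L2_set (\<lambda>p. \<bar>A $$ p\<bar>) ({..<n} \<times> {..<m})"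
    using assms by (intro member_le_L2_set) auto
  also have "\<dots> = frob A" using assms by (simp add: frob_def L2_set_def)
  finally show ?thesis .
qed

lemma frob_le_of_entries:
  assumes "A \<in> carrier_mat n m" "0 \<le> c"
    and "\<And>i j. i < n \<Longrightarrow> j < m \<Longrightarrow> \<bar>A $$ (i, j)\<bar> \<le> c * f (i, j)"
  shows "frob A \<le> c * L2_set f ({..<n} \<times> {..<m})"
proof -
  have "frob A = L2_set (\<lambda>p. \<bar>A $$ p\<bar>) ({..<n} \<times> {..<m})"
    using assms(1) by (simp add: frob_def L2_set_def)
  also have "\<dots> \<le> L2_set (\<lambda>p. c * f p) ({..<n} \<times> {..<m})"
    using assms(3) by (intro L2_set_mono) auto
  also have "\<dots> = c * L2_set f ({..<n} \<times> {..<m})" by (simp add: L2_set_right_distrib assms(2))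
  finally show ?thesis .
qed

text \<open>
  The constants of this part are extracted existentially: only their independence of \<open>\<epsilon>\<close> and of the
  unknowns matters.
\<close>

lemma micro_source_bound:
  obtains C where "0 \<le> C"
    "\<And>u B. u \<in> carrier_vec (NC D) \<Longrightarrow> 0 \<le> B \<Longrightarrow> (\<And>j. j < NC D \<Longrightarrow> \<bar>vec_index u j\<bar> \<le> B) \<Longrightarrow>
      frob (micro_source D u) \<le> C * B"
proof
  define f where "f = (\<lambda>(i, l). (\<Sum>j<NC D. \<bar>d0 D AX $$ (i, j)\<bar>) * \<bar>Om D AX l\<bar>
    + (\<Sum>j<NC D. \<bar>d0 D AY $$ (i, j)\<bar>) * \<bar>Om D AY l\<bar>)"
  show "0 \<le> L2_set f ({..<NI D} \<times> {..<Nq D})" by (rule L2_set_nonneg)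
  fix u :: "real vec" and B :: real assume u: "u \<in> carrier_vec (NC D)" and B: "0 \<le> B" "\<And>j. j < NC D \<Longrightarrow> \<bar>vec_index u j\<bar> \<le> B"
  have d: "\<bar>vec_index (d0 D v *\<^sub>v u) i\<bar> \<le> B * (\<Sum>j<NC D. \<bar>d0 D v $$ (i, j)\<bar>)" if "i < NI D" for v i
  proof -
    have "\<bar>vec_index (d0 D v *\<^sub>v u) i\<bar> \<le> (\<Sum>j<NC D. \<bar>d0 D v $$ (i, j) * vec_index u j\<bar>)"
      using that u by (simp add: scalar_prod_def atLeast0LessThan)
    also have "\<dots> \<le> (\<Sum>j<NC D. \<bar>d0 D v $$ (i, j)\<bar> * B)"
      using B by (intro sum_mono) (auto simp: abs_mult intro!: mult_left_mono)
    finally show ?thesis by (simp add: sum_distrib_left mult.commute)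
  qed
  have "\<bar>micro_source D u $$ (i, l)\<bar> \<le> B * f (i, l)" if "i < NI D" "l < Nq D" for i l
  proof -
    have "\<bar>micro_source D u $$ (i, l)\<bar>
        \<le> \<bar>vec_index (d0 D AX *\<^sub>v u) i\<bar> * \<bar>Om D AX l\<bar> + \<bar>vec_index (d0 D AY *\<^sub>v u) i\<bar> * \<bar>Om D AY l\<bar>"
      unfolding micro_source_index[OF that] by (metis abs_mult abs_triangle_ineq)
    also have "\<dots> \<le> B * (\<Sum>j<NC D. \<bar>d0 D AX $$ (i, j)\<bar>) * \<bar>Om D AX l\<bar>
        + B * (\<Sum>j<NC D. \<bar>d0 D AY $$ (i, j)\<bar>) * \<bar>Om D AY l\<bar>"
      by (intro add_mono mult_right_mono d that(1)) auto
    finally show ?thesis by (simp add: f_def distrib_left mult.assoc)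
  qed
  then show "frob (micro_source D u) \<le> L2_set f ({..<NI D} \<times> {..<Nq D}) * B"
    using frob_le_of_entries[OF micro_source_carrier B(1)] by (simp add: mult.commute)
qed

lemma Lop_bound:
  obtains C where "0 \<le> C" "\<And>g. g \<in> carrier_mat (NI D) (Nq D) \<Longrightarrow> frob (Lop D g) \<le> C * frob g"
proof
  let ?p = "\<lambda>v. frob (Dplus D v) * frob (Qminus D v)" and ?m = "\<lambda>v. frob (Dminus D v) * frob (Qplus D v)"
  show "0 \<le> ?p AX + ?m AX + (?p AY + ?m AY)" by (simp add: frob_nonneg)
  fix g :: "real mat" assume g: "g \<in> carrier_mat (NI D) (Nq D)"
  have c: "Dplus D v \<in> carrier_mat (NI D) (NI D)" "Dminus D v \<in> carrier_mat (NI D) (NI D)"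
    "Qplus D v \<in> carrier_mat (Nq D) (Nq D)" "Qminus D v \<in> carrier_mat (Nq D) (Nq D)" for v
    by (auto simp: Dplus_def Dminus_def Qplus_def Qminus_def)
  have three: "frob (A * g * B) \<le> frob A * frob B * frob g"
    if "A \<in> carrier_mat (NI D) (NI D)" "B \<in> carrier_mat (Nq D) (Nq D)" for A B
  proof -
    have "frob (A * g * B) \<le> frob (A * g) * frob B"
      using that g by (intro frob_mult_le[of _ "NI D" "Nq D"]) auto
    also have "\<dots> \<le> frob A * frob g * frob B"
      using that g by (intro mult_right_mono frob_mult_le[of _ "NI D" "NI D"]) (auto simp: frob_nonneg)
    finally show ?thesis by (simp add: mult_ac)
  qed
  have axis: "frob (Dplus D v * g * Qminus D v + Dminus D v * g * Qplus D v) \<le> (?p v + ?m v) * frob g" for v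
  proof -
    have "frob (Dplus D v * g * Qminus D v + Dminus D v * g * Qplus D v)
        \<le> frob (Dplus D v * g * Qminus D v) + frob (Dminus D v * g * Qplus D v)"
      by (rule frob_add_le[of _ "NI D" "Nq D"]; intro mult_carrier_mat[OF _ c(4)] mult_carrier_mat[OF _ c(3)]
          mult_carrier_mat[OF _ g] c)
    then show ?thesis using three[OF c(1,4)[of v]] three[OF c(2,3)[of v]] by (simp add: distrib_right)
  qed
  have "frob (Lop D g) \<le> frob (Dplus D AX * g * Qminus D AX + Dminus D AX * g * Qplus D AX)
      + frob (Dplus D AY * g * Qminus D AY + Dminus D AY * g * Qplus D AY)"
    unfolding Lop_def
    by (rule frob_add_le[of _ "NI D" "Nq D"]; intro add_carrier_mat mult_carrier_mat[OF _ c(4)] mult_carrier_mat[OF _ c(3)]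
          mult_carrier_mat[OF _ g] c)
  then show "frob (Lop D g) \<le> (?p AX + ?m AX + (?p AY + ?m AY)) * frob g"
    using axis[of AX] axis[of AY] by (simp add: distrib_right)
qed

text \<open>
  Every term carries a factor \<open>\<epsilon>\<close> or \<open>\<epsilon>\<^sup>2 \<le> \<epsilon>\<close>; what remains is linear in \<open>g\<close>, \<open>h\<close> and \<open>B(T)\<close>.
\<close>

lemma micro_remainder_bound:
  assumes D: "rte_discretization D"
  obtains C where "0 \<le> C"
    "\<And>\<epsilon> T h g B. 0 \<le> \<epsilon> \<Longrightarrow> \<epsilon> \<le> 1 \<Longrightarrow> 0 \<le> B \<Longrightarrow>
      T \<in> carrier_vec (NC D) \<Longrightarrow> h \<in> carrier_vec (NC D) \<Longrightarrow> g \<in> carrier_mat (NI D) (Nq D) \<Longrightarrow>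
      (\<And>j. j < NC D \<Longrightarrow> \<bar>planck D (vec_index T j)\<bar> \<le> B) \<Longrightarrow> (\<And>j. j < NC D \<Longrightarrow> \<bar>vec_index h j\<bar> \<le> B) \<Longrightarrow>
      (\<And>i l. i < NI D \<Longrightarrow> l < Nq D \<Longrightarrow> \<bar>g $$ (i, l)\<bar> \<le> B) \<Longrightarrow>
      frob (- (\<epsilon> \<cdot>\<^sub>m (Lop D g * (Proj D)\<^sup>T)) - \<epsilon>\<^sup>2 \<cdot>\<^sub>m micro_source D h
        + (\<epsilon>\<^sup>2 / (light D * dt D)) \<cdot>\<^sub>m (g - micro_limit D T)) \<le> C * B * \<epsilon>"
proof -
  obtain cR where cR: "0 \<le> cR" "\<And>u B. u \<in> carrier_vec (NC D) \<Longrightarrow> 0 \<le> B \<Longrightarrow>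
      (\<And>j. j < NC D \<Longrightarrow> \<bar>vec_index u j\<bar> \<le> B) \<Longrightarrow> frob (micro_source D u) \<le> cR * B"
    using micro_source_bound[of D] by blast
  obtain cL where cL: "0 \<le> cL" "\<And>g. g \<in> carrier_mat (NI D) (Nq D) \<Longrightarrow> frob (Lop D g) \<le> cL * frob g"
    using Lop_bound[of D] by blast
  \<comment> \<open>\<open>?N\<close> turns the entrywise bound of \<open>g\<close> into a bound of its norm.\<close>
  let ?N = "L2_set (\<lambda>_. 1) ({..<NI D} \<times> {..<Nq D})" and ?P = "frob ((Proj D)\<^sup>T)"
  let ?Y = "?N + frob (Sig_inv D) * cR" and ?d = "1 / (light D * dt D)"
  have d: "0 \<le> ?d" and P: "(Proj D)\<^sup>T \<in> carrier_mat (Nq D) (Nq D)"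
    using D by (auto simp: rte_discretization_def)
  have nn: "0 \<le> ?N" "0 \<le> ?P" "0 \<le> frob (Sig_inv D)" by (auto simp: frob_nonneg L2_set_nonneg)
  show thesis
  proof (rule that[of "cL * ?N * ?P + cR + ?d * ?Y"])
    show "0 \<le> cL * ?N * ?P + cR + ?d * ?Y" using cL(1) cR(1) nn d by simp
    fix \<epsilon> B :: real and T h :: "real vec" and g :: "real mat"
    assume \<epsilon>: "0 \<le> \<epsilon>" "\<epsilon> \<le> 1" and B: "0 \<le> B"
      and T: "T \<in> carrier_vec (NC D)" and h: "h \<in> carrier_vec (NC D)" and g: "g \<in> carrier_mat (NI D) (Nq D)"
      and bT: "\<And>j. j < NC D \<Longrightarrow> \<bar>planck D (vec_index T j)\<bar> \<le> B" and bh: "\<And>j. j < NC D \<Longrightarrow> \<bar>vec_index h j\<bar> \<le> B"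
      and bg: "\<And>i l. i < NI D \<Longrightarrow> l < Nq D \<Longrightarrow> \<bar>g $$ (i, l)\<bar> \<le> B"
    let ?E = "Lop D g * (Proj D)\<^sup>T" and ?H = "micro_source D h" and ?L = "micro_limit D T"
    have sq: "\<epsilon>\<^sup>2 \<le> \<epsilon>" using \<epsilon> by (simp add: power2_eq_square mult_left_le)
    have E: "?E \<in> carrier_mat (NI D) (Nq D)" using Lop_carrier P by (rule mult_carrier_mat)
    have c1: "\<epsilon> \<cdot>\<^sub>m ?E \<in> carrier_mat (NI D) (Nq D)" using E by simp
    have gN: "frob g \<le> B * ?N"
      using frob_le_of_entries[OF g B, of "\<lambda>_. 1"] bg by simp
    have bE: "frob ?E \<le> cL * ?N * ?P * B"
    proof -
      have "frob ?E \<le> frob (Lop D g) * ?P" using Lop_carrier P by (rule frob_mult_le)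
      also have "\<dots> \<le> cL * (B * ?N) * ?P"
        using cL(2)[OF g] gN cL(1) nn by (intro mult_right_mono order_trans[OF cL(2)[OF g]] mult_left_mono) auto
      finally show ?thesis by (simp add: mult_ac)
    qed
    have bH: "frob ?H \<le> cR * B" using h B bh by (rule cR(2))
    have bL: "frob ?L \<le> frob (Sig_inv D) * cR * B"
    proof -
      have "frob ?L \<le> frob (Sig_inv D) * frob (micro_source D (planck_vec D T))"
        unfolding micro_limit_def frob_uminus using Sig_carrier(2) micro_source_carrier by (rule frob_mult_le)
      also have "frob (micro_source D (planck_vec D T)) \<le> cR * B"
        using T B bT by (intro cR(2)) auto
      finally show ?thesis using nn by (simp add: mult_left_mono mult.assoc)
    qed
    have e1: "frob (- (\<epsilon> \<cdot>\<^sub>m ?E)) = \<epsilon> * frob ?E"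
      unfolding frob_uminus frob_smult using \<epsilon> by simp
    have e2: "frob (\<epsilon>\<^sup>2 \<cdot>\<^sub>m ?H) = \<epsilon>\<^sup>2 * frob ?H"
      unfolding frob_smult by simp
    have e3: "frob ((\<epsilon>\<^sup>2 / (light D * dt D)) \<cdot>\<^sub>m (g - ?L)) = \<epsilon>\<^sup>2 * (?d * frob (g - ?L))"
      unfolding frob_smult using d by simp
    have "frob (- (\<epsilon> \<cdot>\<^sub>m ?E) - \<epsilon>\<^sup>2 \<cdot>\<^sub>m ?H) \<le> \<epsilon> * frob ?E + \<epsilon>\<^sup>2 * frob ?H"
      unfolding e1[symmetric] e2[symmetric]
      by (rule frob_minus_le[OF uminus_carrier_mat[OF c1]]) simp
    moreover have "frob (- (\<epsilon> \<cdot>\<^sub>m ?E) - \<epsilon>\<^sup>2 \<cdot>\<^sub>m ?H + (\<epsilon>\<^sup>2 / (light D * dt D)) \<cdot>\<^sub>m (g - ?L))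
        \<le> frob (- (\<epsilon> \<cdot>\<^sub>m ?E) - \<epsilon>\<^sup>2 \<cdot>\<^sub>m ?H) + \<epsilon>\<^sup>2 * (?d * frob (g - ?L))"
      unfolding e3[symmetric]
      by (rule frob_add_le[of _ "NI D" "Nq D"]; intro smult_carrier_mat minus_carrier_mat) auto
    ultimately have "frob (- (\<epsilon> \<cdot>\<^sub>m ?E) - \<epsilon>\<^sup>2 \<cdot>\<^sub>m ?H + (\<epsilon>\<^sup>2 / (light D * dt D)) \<cdot>\<^sub>m (g - ?L))
        \<le> \<epsilon> * frob ?E + \<epsilon>\<^sup>2 * frob ?H + \<epsilon>\<^sup>2 * (?d * frob (g - ?L))"
      by linarith
    also have "\<epsilon> * frob ?E + \<epsilon>\<^sup>2 * frob ?H + \<epsilon>\<^sup>2 * (?d * frob (g - ?L))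
        \<le> \<epsilon> * (cL * ?N * ?P * B) + \<epsilon> * (cR * B) + \<epsilon> * (?d * (?Y * B))"
    proof (intro add_mono mult_mono bE bH sq)
      have "frob (g - ?L) \<le> frob g + frob ?L" by (rule frob_minus_le[OF g micro_limit_carrier])
      also have "\<dots> \<le> B * ?N + frob (Sig_inv D) * cR * B" using gN bL by (rule add_mono)
      also have "\<dots> = ?Y * B" by (simp add: algebra_simps)
      finally show "frob (g - ?L) \<le> ?Y * B" .
    qed (use \<epsilon> d in \<open>auto simp: frob_nonneg\<close>)
    also have "\<dots> = (cL * ?N * ?P + cR + ?d * ?Y) * B * \<epsilon>"
      by (simp only: distrib_left distrib_right mult_ac)
    finally show "frob (- (\<epsilon> \<cdot>\<^sub>m ?E) - \<epsilon>\<^sup>2 \<cdot>\<^sub>m ?H + (\<epsilon>\<^sup>2 / (light D * dt D)) \<cdot>\<^sub>m (g - ?L))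
        \<le> (cL * ?N * ?P + cR + ?d * ?Y) * B * \<epsilon>" .
  qed
qed

section \<open>The macro equation\<close>

text \<open>
  The term \<open>w\<^sup>T Q\<^sub>v D\<^sup>0\<^sub>v g\<close> of the macro equation at the \<open>i\<close>-th point of \<open>KC\<close>, as a double sum.
\<close>

definition angular_flux :: "rte \<Rightarrow> real mat \<Rightarrow> nat \<Rightarrow> axis \<Rightarrow> real" where
  "angular_flux D g i v = (\<Sum>l<Nq D. vec_index (wt D) l * Om D v l * (\<Sum>k<NI D. D0 D v $$ (i, k) * g $$ (k, l)))"

lemma Q_mult_index:
  assumes "u \<in> carrier_vec (Nq D)" "l < Nq D"
  shows "vec_index (Q D v *\<^sub>v u) l = Om D v l * vec_index u l"
  using assms by (simp add: Q_def mat_diag_mult_vec del: index_mult_mat_vec)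

lemma angular_flux_eq:
  assumes "g \<in> carrier_mat (NI D) (Nq D)" "i < NC D"
  shows "scalar_prod (wt D) (Q D v *\<^sub>v row (D0 D v * g) i) = angular_flux D g i v"
proof -
  have r: "row (D0 D v * g) i \<in> carrier_vec (Nq D)" using assms by (auto simp: row_def)
  have d: "dim_vec (Q D v *\<^sub>v row (D0 D v * g) i) = Nq D" by (simp add: Q_def mat_diag_def)
  show ?thesis
    unfolding angular_flux_def scalar_prod_def d atLeast0LessThan
  proof (rule sum.cong[OF refl])
    fix l assume "l \<in> {..<Nq D}"
    then have l: "l < Nq D" by simp
    have "vec_index (row (D0 D v * g) i) l = (\<Sum>k<NI D. D0 D v $$ (i, k) * g $$ (k, l))"
      using assms l by (simp add: scalar_prod_def atLeast0LessThan)
    then show "vec_index (wt D) l * vec_index (Q D v *\<^sub>v row (D0 D v * g) i) l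
        = vec_index (wt D) l * Om D v l * (\<Sum>k<NI D. D0 D v $$ (i, k) * g $$ (k, l))"
      by (simp add: Q_mult_index[OF r l] mult.assoc)
  qed
qed

lemma second_moments:
  assumes "quadrature D"
  shows "(\<Sum>l<Nq D. vec_index (wt D) l * Om D v l * Om D u l) = (if u = v then 2 * pi / 3 else 0)"
proof -
  have "scalar_prod (wt D) (Q D v *\<^sub>v (Q D u *\<^sub>v ones D)) = (\<Sum>l<Nq D. vec_index (wt D) l * Om D v l * Om D u l)" for v u
  proof -
    have d: "dim_vec (Q D v *\<^sub>v (Q D u *\<^sub>v ones D)) = Nq D" by (simp add: Q_def mat_diag_def)
    show ?thesis
      unfolding scalar_prod_def d atLeast0LessThan Q_ones 
      by (intro sum.cong) (simp_all add: Q_mult_index del: index_mult_mat_vec)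
  qed
  then show ?thesis
    using assms by (cases u; cases v) (auto simp: quadrature_def mult_ac)
qed

text \<open>
  \<open>Y = - (a\<^sub>x (Q\<^sub>x \<one>)\<^sup>T + a\<^sub>y (Q\<^sub>y \<one>)\<^sup>T)\<close> with \<open>a\<^sub>v = (\<Sigma>\<^sup>t)\<inverse> d\<^sup>0\<^sub>v B\<close>. The moments \<open>w\<^sup>T Q\<^sub>v Q\<^sub>u \<one>\<close> are \<open>2\<pi>/3\<close> for
  \<open>u = v\<close> and 0 otherwise, so the mixed terms drop out.
\<close>

lemma angular_flux_micro_limit:
  assumes q: "quadrature D" and i: "i < NC D" 
  shows "angular_flux D (micro_limit D T) i v
    = - (2 * pi / 3) * vec_index (D0 D v *\<^sub>v (Sig_inv D *\<^sub>v (d0 D v *\<^sub>v planck_vec D T))) i"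
proof -
  define a where "a u = Sig_inv D *\<^sub>v (d0 D u *\<^sub>v planck_vec D T)" for u
  have ac: "a u \<in> carrier_vec (NI D)" for u by (simp add: a_def carrier_vecI Sig_inv_def mat_diag_def)
  have Y: "micro_limit D T $$ (k, l) = - (vec_index (a AX) k * Om D AX l + vec_index (a AY) k * Om D AY l)"
    if "k < NI D" "l < Nq D" for k l
  proof -
    define b where "b u = d0 D u *\<^sub>v planck_vec D T" for u
    have b: "b u \<in> carrier_vec (NI D)" for u by (simp add: b_def carrier_vecI)
    have "vec_index (a u) k = 1 / sigt D (pos D (KI D ! k)) * vec_index (b u) k" for u
      using that mat_diag_mult_vec[OF b[of u]] by (simp only: a_def Sig_inv_def b_def[symmetric])
    then show ?thesis
      unfolding micro_limit_index[OF that] micro_source_index[OF that] b_def[symmetric]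
      by (simp add: algebra_simps)
  qed
  have "angular_flux D (micro_limit D T) i v = (\<Sum>l<Nq D. \<Sum>k<NI D.
      - (D0 D v $$ (i, k) * vec_index (a AX) k * (vec_index (wt D) l * Om D v l * Om D AX l))
      - D0 D v $$ (i, k) * vec_index (a AY) k * (vec_index (wt D) l * Om D v l * Om D AY l))"
    unfolding angular_flux_def sum_distrib_left
    by (intro sum.cong refl) (simp add: Y algebra_simps)
  also have "\<dots> = (\<Sum>k<NI D. \<Sum>l<Nq D.
      - (D0 D v $$ (i, k) * vec_index (a AX) k * (vec_index (wt D) l * Om D v l * Om D AX l))
      - D0 D v $$ (i, k) * vec_index (a AY) k * (vec_index (wt D) l * Om D v l * Om D AY l))"
    by (rule sum.swap)
  also have "\<dots> = (\<Sum>k<NI D. - (2 * pi / 3) * (D0 D v $$ (i, k) * vec_index (a v) k))"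
  proof (rule sum.cong[OF refl])
    fix k
    show "(\<Sum>l<Nq D.
      - (D0 D v $$ (i, k) * vec_index (a AX) k * (vec_index (wt D) l * Om D v l * Om D AX l))
      - D0 D v $$ (i, k) * vec_index (a AY) k * (vec_index (wt D) l * Om D v l * Om D AY l))
      = - (2 * pi / 3) * (D0 D v $$ (i, k) * vec_index (a v) k)"
      unfolding sum_subtractf sum_negf sum_distrib_left[symmetric] second_moments[OF q]
      by (cases v) simp_all
  qed
  also have "\<dots> = - (2 * pi / 3) * vec_index (D0 D v *\<^sub>v a v) i"
    unfolding sum_distrib_left[symmetric] using i ac[of v] by (simp add: scalar_prod_def atLeast0LessThan)
  finally show ?thesis by (simp add: a_def)
qed

lemma angular_flux_bound:
  obtains C where "0 \<le> C" "\<And>g g' i v. g \<in> carrier_mat (NI D) (Nq D) \<Longrightarrow> g' \<in> carrier_mat (NI D) (Nq D) \<Longrightarrow>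
    i < NC D \<Longrightarrow> \<bar>angular_flux D g i v - angular_flux D g' i v\<bar> \<le> C * frob (g - g')"
proof
  let ?c = "\<lambda>i v. \<Sum>l<Nq D. \<Sum>k<NI D. \<bar>vec_index (wt D) l * Om D v l * D0 D v $$ (i, k)\<bar>"
  let ?C = "(\<Sum>i<NC D. ?c i AX + ?c i AY)"
  have nn: "0 \<le> ?c i v" for i v by (intro sum_nonneg) auto
  show "0 \<le> ?C" by (intro sum_nonneg add_nonneg_nonneg nn)
  fix g g' :: "real mat" and i v assume g: "g \<in> carrier_mat (NI D) (Nq D)" "g' \<in> carrier_mat (NI D) (Nq D)" and i: "i < NC D"
  have "angular_flux D g i v - angular_flux D g' i v
      = (\<Sum>l<Nq D. \<Sum>k<NI D. vec_index (wt D) l * Om D v l * D0 D v $$ (i, k) * (g - g') $$ (k, l))"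
    using g by (simp add: angular_flux_def sum_distrib_left algebra_simps flip: sum_subtractf)
  also have "\<bar>\<dots>\<bar> \<le> (\<Sum>l<Nq D. \<Sum>k<NI D. \<bar>vec_index (wt D) l * Om D v l * D0 D v $$ (i, k) * (g - g') $$ (k, l)\<bar>)"
    by (intro order_trans[OF sum_abs] sum_mono sum_abs)
  also have "\<dots> \<le> (\<Sum>l<Nq D. \<Sum>k<NI D. \<bar>vec_index (wt D) l * Om D v l * D0 D v $$ (i, k)\<bar> * frob (g - g'))"
    unfolding abs_mult
    by (intro sum_mono mult_left_mono abs_index_le_frob[of _ "NI D" "Nq D"] minus_carrier_mat g) auto
  also have "\<dots> = ?c i v * frob (g - g')" by (simp add: sum_distrib_right)
  also have "\<dots> \<le> ?C * frob (g - g')"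
  proof (rule mult_right_mono)
    have "?c i v \<le> ?c i AX + ?c i AY" using nn[of AX i] nn[of AY i] by (cases v) auto
    also have "\<dots> \<le> ?C" using i by (intro member_le_sum add_nonneg_nonneg nn) auto
    finally show "?c i v \<le> ?C" .
  qed (rule frob_nonneg)
  finally show "\<bar>angular_flux D g i v - angular_flux D g' i v\<bar> \<le> ?C * frob (g - g')" .
qed

text \<open>
  Multiplying the macro equation by \<open>2\<pi>\<close> and eliminating \<open>\<sigma>\<^sup>a h\<close> by means of the temperature equation
  gives the left-hand side of the Rosseland equation; its right-hand side is minus the flux of the limit.
\<close>

lemma rosseland_gap_eq:
  assumes D: "rte_discretization D" and up: "macro_update D \<epsilon> T h g1 T1 h1"
    and T: "T \<in> carrier_vec (NC D)" and g1: "g1 \<in> carrier_mat (NI D) (Nq D)" and i: "i < NC D"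
  shows "vec_index (rosseland_lhs D T T1) i - vec_index (rosseland_rhs D T) i
    = - (2 * pi * \<epsilon>\<^sup>2 / (light D * dt D)) * (vec_index h1 i - vec_index h i)
      - (\<Sum>v\<in>{AX, AY}. angular_flux D g1 i v - angular_flux D (micro_limit D T) i v)"
proof -
  have q: "quadrature D" using D by (simp add: rte_discretization_def)
  let ?sa = "siga D (pos D (KC D ! i))" and ?\<delta> = "\<epsilon>\<^sup>2 / (light D * dt D)"
    and ?B = "planck D (vec_index T1 i) - planck D (vec_index T i)" and ?T = "vec_index T1 i - vec_index T i"
  have e1: "?\<delta> * (vec_index h1 i - vec_index h i) + 1 / (light D * dt D) * ?B
      + 1 / (2 * pi) * (\<Sum>v\<in>{AX, AY}. angular_flux D g1 i v) = - ?sa * vec_index h1 i"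
    and e2: "cnu D / dt D * ?T = 2 * pi * ?sa * vec_index h1 i"
    unfolding angular_flux_eq[OF g1 i, symmetric]
    using up i unfolding macro_update_def Let_def by blast+
  have T1: "T1 \<in> carrier_vec (NC D)" using up by (simp add: macro_update_def)
  have lhs: "vec_index (rosseland_lhs D T T1) i = cnu D / dt D * ?T + 2 * pi / (light D * dt D) * ?B"
    using T T1 i by (simp add: rosseland_lhs_def)
  have rhs: "vec_index (rosseland_rhs D T) i = - (\<Sum>v\<in>{AX, AY}. angular_flux D (micro_limit D T) i v)"
    using i by (simp add: rosseland_rhs_def disc_diffusion_def angular_flux_micro_limit[OF q i] algebra_simps)
  have times_two_pi: "2 * pi * x + 2 * pi * y + F = 2 * pi * z" if "x + y + 1 / (2 * pi) * F = z" for x y z F :: real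
    using that by (auto simp: field_simps)
  note times_two_pi[OF e1]
  then show ?thesis
    unfolding lhs rhs e2 sum_subtractf by (simp add: algebra_simps diff_divide_distrib)
qed

lemma rosseland_gap_bound:
  assumes D: "rte_discretization D"
  obtains C where "0 \<le> C"
    "\<And>\<theta> \<epsilon> T h X S V T1 h1 X1 S1 V1 B i. bug_step D \<theta> \<epsilon> T h X S V T1 h1 X1 S1 V1 \<Longrightarrow>
      0 \<le> \<epsilon> \<Longrightarrow> \<epsilon> \<le> 1 \<Longrightarrow> 0 \<le> B \<Longrightarrow>
      (\<And>j. j < NC D \<Longrightarrow> \<bar>planck D (vec_index T j)\<bar> \<le> B) \<Longrightarrow> (\<And>j. j < NC D \<Longrightarrow> \<bar>vec_index h j\<bar> \<le> B) \<Longrightarrow>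
      (\<And>j. j < NC D \<Longrightarrow> \<bar>vec_index h1 j\<bar> \<le> B) \<Longrightarrow>
      (\<And>k l. k < NI D \<Longrightarrow> l < Nq D \<Longrightarrow> \<bar>(X * S * V\<^sup>T) $$ (k, l)\<bar> \<le> B) \<Longrightarrow> i < NC D \<Longrightarrow>
      \<bar>vec_index (rosseland_lhs D T T1) i - vec_index (rosseland_rhs D T) i\<bar> \<le> C * B * \<epsilon>"
proof -
  obtain s where s: "0 < s" "\<And>p. s \<le> sigt D p" using D unfolding rte_discretization_def by metis
  obtain cW where cW: "0 \<le> cW" "\<And>\<epsilon> T h g B. 0 \<le> \<epsilon> \<Longrightarrow> \<epsilon> \<le> 1 \<Longrightarrow> 0 \<le> B \<Longrightarrow>
      T \<in> carrier_vec (NC D) \<Longrightarrow> h \<in> carrier_vec (NC D) \<Longrightarrow> g \<in> carrier_mat (NI D) (Nq D) \<Longrightarrow>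
      (\<And>j. j < NC D \<Longrightarrow> \<bar>planck D (vec_index T j)\<bar> \<le> B) \<Longrightarrow> (\<And>j. j < NC D \<Longrightarrow> \<bar>vec_index h j\<bar> \<le> B) \<Longrightarrow>
      (\<And>i l. i < NI D \<Longrightarrow> l < Nq D \<Longrightarrow> \<bar>g $$ (i, l)\<bar> \<le> B) \<Longrightarrow>
      frob (- (\<epsilon> \<cdot>\<^sub>m (Lop D g * (Proj D)\<^sup>T)) - \<epsilon>\<^sup>2 \<cdot>\<^sub>m micro_source D h
        + (\<epsilon>\<^sup>2 / (light D * dt D)) \<cdot>\<^sub>m (g - micro_limit D T)) \<le> cW * B * \<epsilon>"
    using micro_remainder_bound[OF D] by blast
  obtain cF where cF: "0 \<le> cF" "\<And>g g' i v. g \<in> carrier_mat (NI D) (Nq D) \<Longrightarrow> g' \<in> carrier_mat (NI D) (Nq D) \<Longrightarrow>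
    i < NC D \<Longrightarrow> \<bar>angular_flux D g i v - angular_flux D g' i v\<bar> \<le> cF * frob (g - g')"
    using angular_flux_bound[of D] by blast
  let ?d = "2 * pi / (light D * dt D)"
  have d: "0 \<le> ?d" using D by (simp add: rte_discretization_def)
  show thesis
  proof (rule that[of "?d * 2 + 2 * cF * (9 / s * cW)"])
    show "0 \<le> ?d * 2 + 2 * cF * (9 / s * cW)" using d cF(1) cW(1) s(1) by simp
    fix \<theta> \<epsilon> T h X S V T1 h1 X1 S1 V1 and B :: real and i
    assume step: "bug_step D \<theta> \<epsilon> T h X S V T1 h1 X1 S1 V1"
      and \<epsilon>: "0 \<le> \<epsilon>" "\<epsilon> \<le> 1" and B: "0 \<le> B"
      and bT: "\<And>j. j < NC D \<Longrightarrow> \<bar>planck D (vec_index T j)\<bar> \<le> B" and bh: "\<And>j. j < NC D \<Longrightarrow> \<bar>vec_index h j\<bar> \<le> B"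
      and bh1: "\<And>j. j < NC D \<Longrightarrow> \<bar>vec_index h1 j\<bar> \<le> B"
      and bg: "\<And>k l. k < NI D \<Longrightarrow> l < Nq D \<Longrightarrow> \<bar>(X * S * V\<^sup>T) $$ (k, l)\<bar> \<le> B" and i: "i < NC D"
    let ?g1 = "X1 * S1 * V1\<^sup>T" and ?Y = "micro_limit D T"
    have sq: "\<epsilon>\<^sup>2 \<le> \<epsilon>" using \<epsilon> by (simp add: power2_eq_square mult_left_le)
    have Tc: "T \<in> carrier_vec (NC D)" and hc: "h \<in> carrier_vec (NC D)"
      and up: "macro_update D \<epsilon> T h ?g1 T1 h1"
      using step by (auto simp: bug_step_def)
    have g: "X * S * V\<^sup>T \<in> carrier_mat (NI D) (Nq D)"
      using step by (auto simp: bug_step_def)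
    have g1: "?g1 \<in> carrier_mat (NI D) (Nq D)"
      by (rule bug_step_micro_bound(1)[OF D step s])
    have "frob (?g1 - ?Y) \<le> 9 / s * (cW * B * \<epsilon>)"
      by (rule order_trans[OF bug_step_micro_bound(2)[OF D step s]
            mult_left_mono[OF cW(2)[OF \<epsilon> B Tc hc g bT bh bg]]]) (use s(1) in simp_all)
    then have F: "\<bar>angular_flux D ?g1 i v - angular_flux D ?Y i v\<bar> \<le> cF * (9 / s * (cW * B * \<epsilon>))" for v
      by (rule order_trans[OF cF(2)[OF g1 micro_limit_carrier i] mult_left_mono[OF _ cF(1)]])
    have H: "\<bar>?d * (\<epsilon>\<^sup>2 * (vec_index h1 i - vec_index h i))\<bar> \<le> ?d * (\<epsilon> * (2 * B))"
      unfolding abs_mult using bh1[OF i] bh[OF i] d sq \<epsilon> by (intro mult_mono) auto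
    have "vec_index (rosseland_lhs D T T1) i - vec_index (rosseland_rhs D T) i
        = - (?d * (\<epsilon>\<^sup>2 * (vec_index h1 i - vec_index h i)))
          - ((angular_flux D ?g1 i AX - angular_flux D ?Y i AX) + (angular_flux D ?g1 i AY - angular_flux D ?Y i AY))"
      unfolding rosseland_gap_eq[OF D up Tc g1 i] by simp
    then have "\<bar>vec_index (rosseland_lhs D T T1) i - vec_index (rosseland_rhs D T) i\<bar>
        \<le> ?d * (\<epsilon> * (2 * B)) + 2 * (cF * (9 / s * (cW * B * \<epsilon>)))"
      using H F[of AX] F[of AY] by linarith
    also have "\<dots> = (?d * 2 + 2 * cF * (9 / s * cW)) * B * \<epsilon>"
      by (simp add: algebra_simps)
    finally show "\<bar>vec_index (rosseland_lhs D T T1) i - vec_index (rosseland_rhs D T) i\<bar>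
        \<le> (?d * 2 + 2 * cF * (9 / s * cW)) * B * \<epsilon>" .
  qed
qed

lemma Bfun_finite_family:
  fixes f :: "'i \<Rightarrow> 'a \<Rightarrow> real"
  assumes "finite I" "\<And>i. i \<in> I \<Longrightarrow> Bfun (f i) F"
  obtains B where "0 \<le> B" "\<forall>\<^sub>F x in F. \<forall>i\<in>I. \<bar>f i x\<bar> \<le> B"
proof -
  have "\<forall>i\<in>I. \<exists>K>0. \<forall>\<^sub>F x in F. \<bar>f i x\<bar> \<le> K"
  proof
    fix i assume "i \<in> I"
    then have "Bfun (f i) F" by (rule assms(2))
    then obtain K where "K > 0" "\<forall>\<^sub>F x in F. norm (f i x) \<le> K" by (rule BfunE)
    then show "\<exists>K>0. \<forall>\<^sub>F x in F. \<bar>f i x\<bar> \<le> K" by auto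
  qed
  then obtain K where K: "\<And>i. i \<in> I \<Longrightarrow> 0 < K i" "\<And>i. i \<in> I \<Longrightarrow> \<forall>\<^sub>F x in F. \<bar>f i x\<bar> \<le> K i"
    by metis
  show thesis
  proof (rule that)
    show "0 \<le> sum K I" using K(1) by (simp add: sum_nonneg less_imp_le)
    have "\<forall>\<^sub>F x in F. \<bar>f i x\<bar> \<le> sum K I" if "i \<in> I" for i
    proof -
      have "K i \<le> sum K I" using assms(1) that K(1) by (intro member_le_sum) (auto simp: less_imp_le)
      then show ?thesis using K(2)[OF that] by (auto elim!: eventually_mono)
    qed
    then show "\<forall>\<^sub>F x in F. \<forall>i\<in>I. \<bar>f i x\<bar> \<le> sum K I" using assms(1) by (simp add: eventually_ball_finite)
  qed
qed

text \<open>
  A general filter covers both uses: the principal filter at 0 is the formal limit scheme, and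
  \<open>at_right 0\<close> is the limit of bounded families.
\<close>

lemma rosseland_gap_eventually:
  assumes D: "rte_discretization D"
    and step: "\<forall>\<^sub>F \<epsilon> in F. bug_step D \<theta> \<epsilon> (T \<epsilon>) (h \<epsilon>) (X \<epsilon>) (S \<epsilon>) (V \<epsilon>) (T1 \<epsilon>) (h1 \<epsilon>) (X1 \<epsilon>) (S1 \<epsilon>) (V1 \<epsilon>)"
    and F: "\<forall>\<^sub>F \<epsilon> in F. 0 \<le> \<epsilon> \<and> \<epsilon> \<le> 1"
    and bT: "\<And>i. i < NC D \<Longrightarrow> Bfun (\<lambda>\<epsilon>. vec_index (T \<epsilon>) i) F"
    and bh: "\<And>i. i < NC D \<Longrightarrow> Bfun (\<lambda>\<epsilon>. vec_index (h \<epsilon>) i) F"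
    and bh1: "\<And>i. i < NC D \<Longrightarrow> Bfun (\<lambda>\<epsilon>. vec_index (h1 \<epsilon>) i) F"
    and bg: "\<And>k l. k < NI D \<Longrightarrow> l < Nq D \<Longrightarrow> Bfun (\<lambda>\<epsilon>. (X \<epsilon> * S \<epsilon> * (V \<epsilon>)\<^sup>T) $$ (k, l)) F"
  obtains C where "\<forall>\<^sub>F \<epsilon> in F. \<forall>i<NC D.
    \<bar>vec_index (rosseland_lhs D (T \<epsilon>) (T1 \<epsilon>)) i - vec_index (rosseland_rhs D (T \<epsilon>)) i\<bar> \<le> C * \<epsilon>"
proof -
  obtain C where C: "0 \<le> C" "\<And>\<theta> \<epsilon> T h X S V T1 h1 X1 S1 V1 B i. bug_step D \<theta> \<epsilon> T h X S V T1 h1 X1 S1 V1 \<Longrightarrow>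
      0 \<le> \<epsilon> \<Longrightarrow> \<epsilon> \<le> 1 \<Longrightarrow> 0 \<le> B \<Longrightarrow>
      (\<And>j. j < NC D \<Longrightarrow> \<bar>planck D (vec_index T j)\<bar> \<le> B) \<Longrightarrow> (\<And>j. j < NC D \<Longrightarrow> \<bar>vec_index h j\<bar> \<le> B) \<Longrightarrow>
      (\<And>j. j < NC D \<Longrightarrow> \<bar>vec_index h1 j\<bar> \<le> B) \<Longrightarrow>
      (\<And>k l. k < NI D \<Longrightarrow> l < Nq D \<Longrightarrow> \<bar>(X * S * V\<^sup>T) $$ (k, l)\<bar> \<le> B) \<Longrightarrow> i < NC D \<Longrightarrow>
      \<bar>vec_index (rosseland_lhs D T T1) i - vec_index (rosseland_rhs D T) i\<bar> \<le> C * B * \<epsilon>"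
    using rosseland_gap_bound[OF D] by blast
  obtain B1 where B1: "0 \<le> B1" "\<forall>\<^sub>F \<epsilon> in F. \<forall>i\<in>{..<NC D}. \<bar>vec_index (T \<epsilon>) i\<bar> \<le> B1"
    using Bfun_finite_family[of "{..<NC D}" "\<lambda>i \<epsilon>. vec_index (T \<epsilon>) i" F] bT by auto
  obtain B2 where B2: "0 \<le> B2" "\<forall>\<^sub>F \<epsilon> in F. \<forall>i\<in>{..<NC D}. \<bar>vec_index (h \<epsilon>) i\<bar> \<le> B2"
    using Bfun_finite_family[of "{..<NC D}" "\<lambda>i \<epsilon>. vec_index (h \<epsilon>) i" F] bh by auto
  obtain B3 where B3: "0 \<le> B3" "\<forall>\<^sub>F \<epsilon> in F. \<forall>i\<in>{..<NC D}. \<bar>vec_index (h1 \<epsilon>) i\<bar> \<le> B3"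
    using Bfun_finite_family[of "{..<NC D}" "\<lambda>i \<epsilon>. vec_index (h1 \<epsilon>) i" F] bh1 by auto
  obtain B4 where B4: "0 \<le> B4" "\<forall>\<^sub>F \<epsilon> in F. \<forall>p\<in>{..<NI D} \<times> {..<Nq D}. \<bar>(X \<epsilon> * S \<epsilon> * (V \<epsilon>)\<^sup>T) $$ p\<bar> \<le> B4"
    using Bfun_finite_family[of "{..<NI D} \<times> {..<Nq D}" "\<lambda>p \<epsilon>. (X \<epsilon> * S \<epsilon> * (V \<epsilon>)\<^sup>T) $$ p" F] bg by auto
  let ?B = "planck D B1 + B2 + B3 + B4"
  have pl0: "0 \<le> planck D B1" using D by (simp add: planck_def rte_discretization_def)
  have pl: "\<bar>planck D x\<bar> \<le> planck D B1" if "\<bar>x\<bar> \<le> B1" for x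
  proof -
    have "x ^ 4 \<le> B1 ^ 4" using power_mono[OF that, of 4] by simp
    then show ?thesis
      using D by (simp add: planck_def rte_discretization_def abs_mult mult_left_mono divide_right_mono)
  qed
  show thesis
  proof (rule that[of "C * ?B"])
    show "\<forall>\<^sub>F \<epsilon> in F. \<forall>i<NC D.
      \<bar>vec_index (rosseland_lhs D (T \<epsilon>) (T1 \<epsilon>)) i - vec_index (rosseland_rhs D (T \<epsilon>)) i\<bar> \<le> C * ?B * \<epsilon>"
      using step F B1(2) B2(2) B3(2) B4(2)
    proof eventually_elim
      case (elim \<epsilon>)
      have p: "\<bar>planck D (vec_index (T \<epsilon>) j)\<bar> \<le> ?B" if "j < NC D" for j
      proof -
        have "\<bar>planck D (vec_index (T \<epsilon>) j)\<bar> \<le> planck D B1" using elim(3) that by (intro pl) simp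
        then show ?thesis using B2(1) B3(1) B4(1) by linarith
      qed
      have hh: "\<bar>vec_index (h \<epsilon>) j\<bar> \<le> ?B" "\<bar>vec_index (h1 \<epsilon>) j\<bar> \<le> ?B" if "j < NC D" for j
      proof -
        have "\<bar>vec_index (h \<epsilon>) j\<bar> \<le> B2" "\<bar>vec_index (h1 \<epsilon>) j\<bar> \<le> B3"
          using elim(4,5) that by simp_all
        then show "\<bar>vec_index (h \<epsilon>) j\<bar> \<le> ?B" "\<bar>vec_index (h1 \<epsilon>) j\<bar> \<le> ?B"
          using B2(1) B3(1) B4(1) pl0 by linarith+
      qed
      have gg: "\<bar>(X \<epsilon> * S \<epsilon> * (V \<epsilon>)\<^sup>T) $$ (k, l)\<bar> \<le> ?B" if "k < NI D" "l < Nq D" for k l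
      proof -
        have "\<bar>(X \<epsilon> * S \<epsilon> * (V \<epsilon>)\<^sup>T) $$ (k, l)\<bar> \<le> B4" using bspec[OF elim(6), of "(k, l)"] that by simp
        then show ?thesis using B2(1) B3(1) pl0 by linarith
      qed
      show ?case
        using elim(2) B2(1) B3(1) B4(1) pl0 by (intro allI impI C(2)[OF elim(1)] p hh gg) auto
    qed
  qed
qed

section \<open>The five-point stencil\<close>

lemma ghost_difference_index:
  assumes "U \<in> carrier_vec (NC D)" "m < NI D"
  shows "vec_index (Sig_inv D *\<^sub>v (d0 D v *\<^sub>v U)) m
    = (ghost_ext D U (KI D ! m + half v) - ghost_ext D U (KI D ! m - half v))
      / (step D v * sigt D (pos D (KI D ! m)))"
proof -
  have u: "d0 D v *\<^sub>v U \<in> carrier_vec (NI D)" by (simp add: carrier_vecI)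
  have "vec_index (d0 D v *\<^sub>v U) m
      = (ghost_ext D U (KI D ! m + half v) - ghost_ext D U (KI D ! m - half v)) / step D v"
    using assms
    by (simp add: d0_def scalar_prod_def atLeast0LessThan ghost_ext_def left_diff_distrib
        flip: sum_subtractf sum_divide_distrib)
  then show ?thesis
    using assms(2) by (simp add: Sig_inv_def mat_diag_mult_vec[OF u] del: index_mult_mat_vec)
qed

text \<open>
  The closure of the grid reproduces grid values at grid points, so next to interfaces of the grid
  the row of \<open>D\<^sup>0\<^sub>v\<close> has just two nonzero entries.
\<close>

lemma D0_mult_index:
  assumes D: "rte_discretization D" and y: "y \<in> carrier_vec (NI D)" and i: "i < NC D"
    and m: "m < NI D" "KI D ! m = KC D ! i + half v" and n: "n < NI D" "KI D ! n = KC D ! i - half v"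
  shows "vec_index (D0 D v *\<^sub>v y) i = (vec_index y m - vec_index y n) / step D v"
proof -
  have g: "gI D (KI D ! a) j = (if a = j then 1 else 0)" if "a < NI D" "j < NI D" for a j
    using D that by (simp add: rte_discretization_def)
  have "vec_index (D0 D v *\<^sub>v y) i
      = (\<Sum>j<NI D. (gI D (KI D ! m) j - gI D (KI D ! n) j) / step D v * vec_index y j)"
    using y i by (simp add: D0_def scalar_prod_def atLeast0LessThan m n)
  also have "\<dots> = (\<Sum>j<NI D. (if m = j then vec_index y j / step D v else 0) - (if n = j then vec_index y j / step D v else 0))"
    by (intro sum.cong refl) (auto simp: g m(1) n(1))
  also have "\<dots> = (vec_index y m - vec_index y n) / step D v"
    using m n by (simp add: sum_subtractf diff_divide_distrib)
  finally show ?thesis .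
qed

lemma axis_diffusion_stencil:
  assumes D: "rte_discretization D" and U: "U \<in> carrier_vec (NC D)" and i: "i < NC D"
    and nb: "KC D ! i + half v \<in> set (KI D)" "KC D ! i - half v \<in> set (KI D)"
  defines "k \<equiv> KC D ! i" and "G \<equiv> ghost_ext D U"
  shows "vec_index (D0 D v *\<^sub>v (Sig_inv D *\<^sub>v (d0 D v *\<^sub>v U))) i
    = ((G (k + half v + half v) - G k) / (step D v * sigt D (pos D (k + half v)))
       - (G k - G (k - half v - half v)) / (step D v * sigt D (pos D (k - half v)))) / step D v"
proof -
  obtain m n where m: "m < NI D" "KI D ! m = k + half v" and n: "n < NI D" "KI D ! n = k - half v"
    using nb by (auto simp: in_set_conv_nth NI_def k_def)
  have "Sig_inv D *\<^sub>v (d0 D v *\<^sub>v U) \<in> carrier_vec (NI D)"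
    by (intro mult_mat_vec_carrier[OF Sig_carrier(2)]) (simp add: carrier_vecI)
  from D0_mult_index[OF D this i m(1) _ n(1), of v] show ?thesis
    using m n by (simp add: ghost_difference_index[OF U] k_def[symmetric] G_def[symmetric])
qed

lemma disc_diffusion_five_point:
  assumes D: "rte_discretization D" and U: "U \<in> carrier_vec (NC D)" and i: "i < NC D"
  defines "k \<equiv> KC D ! i"
  assumes nb: "{k + (1, 0), k - (1, 0), k + (0, 1), k - (0, 1)} \<subseteq> set (KI D)"
    and u: "\<forall>k'\<in>{k, k + (2, 0), k - (2, 0), k + (0, 2), k - (0, 2)}. u (pos D k') = ghost_ext D U k'"
  shows "vec_index (disc_diffusion D U) i = five_point (dx D) (dy D) (sigt D) u (pos D k)"
proof -
  obtain a b where k: "k = (a, b)" by (cases k)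
  obtain x y where p: "pos D k = (x, y)" by (cases "pos D k")
  have s: "pos D (k + (1, 0)) = (x + dx D / 2, y)" "pos D (k - (1, 0)) = (x - dx D / 2, y)"
    "pos D (k + (0, 1)) = (x, y + dy D / 2)" "pos D (k - (0, 1)) = (x, y - dy D / 2)"
    "pos D (k + (2, 0)) = (x + dx D, y)" "pos D (k - (2, 0)) = (x - dx D, y)"
    "pos D (k + (0, 2)) = (x, y + dy D)" "pos D (k - (0, 2)) = (x, y - dy D)"
    using p by (auto simp: pos_def k field_simps)
  have h: "k + (1, 0) + (1, 0) = k + (2, 0)" "k - (1, 0) - (1, 0) = k - (2, 0)"
    "k + (0, 1) + (0, 1) = k + (0, 2)" "k - (0, 1) - (0, 1) = k - (0, 2)"
    by (auto simp: k)
  have g: "ghost_ext D U k = u (x, y)" "ghost_ext D U (k + (2, 0)) = u (x + dx D, y)"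
    "ghost_ext D U (k - (2, 0)) = u (x - dx D, y)" "ghost_ext D U (k + (0, 2)) = u (x, y + dy D)"
    "ghost_ext D U (k - (0, 2)) = u (x, y - dy D)"
    using u s p by auto
  have "vec_index (disc_diffusion D U) i
      = vec_index (D0 D AX *\<^sub>v (Sig_inv D *\<^sub>v (d0 D AX *\<^sub>v U))) i
        + vec_index (D0 D AY *\<^sub>v (Sig_inv D *\<^sub>v (d0 D AY *\<^sub>v U))) i"
    using i by (simp add: disc_diffusion_def del: index_mult_mat_vec)
  also have "\<dots> = five_point (dx D) (dy D) (sigt D) u (x, y)"
    using nb axis_diffusion_stencil[OF D U i, of AX] axis_diffusion_stencil[OF D U i, of AY]
    by (simp add: k_def[symmetric] five_point_def g s h)
  finally show ?thesis by (simp add: p)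
qed

section \<open>Consistency\<close>

text \<open>
  Taylor's formula of second order at a point where \<open>f'\<close> is merely differentiable, by l'Hopital's rule.
\<close>

lemma difference_quotient_has_derivative:
  fixes f :: "real \<Rightarrow> real"
  assumes ev: "\<forall>\<^sub>F z in nhds x. f differentiable at z" and d2: "deriv f differentiable at x"
  shows "((\<lambda>\<xi>. if \<xi> = 0 then deriv f x else (f (x + \<xi>) - f x) / \<xi>)
    has_real_derivative deriv (deriv f) x / 2) (at 0)"
proof -
  have ev0: "\<forall>\<^sub>F \<xi> in at 0. f differentiable at (x + \<xi>)"
  proof -
    have "((\<lambda>\<xi>. x + \<xi>) \<longlongrightarrow> x) (at 0)" by (auto intro!: tendsto_eq_intros)
    from eventually_compose_filterlim[OF ev this] show ?thesis .
  qed
  have fx: "isCont f x"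
    using eventually_nhds_x_imp_x[OF ev] by (auto simp: DERIV_deriv_iff_real_differentiable[symmetric] DERIV_isCont)
  have "((\<lambda>\<xi>. (f (x + \<xi>) - f x - \<xi> * deriv f x) / \<xi>\<^sup>2) \<longlongrightarrow> deriv (deriv f) x / 2) (at 0)"
  proof (rule lhopital)
    have c: "((\<lambda>\<xi>. f (x + \<xi>)) \<longlongrightarrow> f x) (at 0)"
      using fx by (simp add: isCont_def LIM_offset_zero)
    show "((\<lambda>\<xi>. f (x + \<xi>) - f x - \<xi> * deriv f x) \<longlongrightarrow> 0) (at 0)"
      using c by (auto intro!: tendsto_eq_intros)
    show "((\<lambda>\<xi>::real. \<xi>\<^sup>2) \<longlongrightarrow> 0) (at 0)" by (auto intro!: tendsto_eq_intros)
    show "\<forall>\<^sub>F \<xi>::real in at 0. \<xi>\<^sup>2 \<noteq> 0" "\<forall>\<^sub>F \<xi>::real in at 0. 2 * \<xi> \<noteq> 0"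
      by (auto simp: eventually_at_filter)
    show "\<forall>\<^sub>F \<xi>::real in at 0. ((\<lambda>\<xi>. \<xi>\<^sup>2) has_real_derivative 2 * \<xi>) (at \<xi>)"
      by (intro always_eventually allI) (auto intro!: derivative_eq_intros)
    show "\<forall>\<^sub>F \<xi> in at 0. ((\<lambda>\<xi>. f (x + \<xi>) - f x - \<xi> * deriv f x) has_real_derivative deriv f (x + \<xi>) - deriv f x) (at \<xi>)"
      using ev0
    proof eventually_elim
      case (elim \<xi>)
      then have "(f has_real_derivative deriv f (x + \<xi>)) (at (x + \<xi>))"
        by (simp add: DERIV_deriv_iff_real_differentiable)
      then have "((\<lambda>\<xi>. f (x + \<xi>)) has_real_derivative deriv f (x + \<xi>)) (at \<xi>)"
        using DERIV_shift[of f _ \<xi> x] by (simp add: add.commute)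
      then show ?case by (auto intro!: derivative_eq_intros)
    qed
    have "(deriv f has_real_derivative deriv (deriv f) x) (at x)"
      using d2 by (simp add: DERIV_deriv_iff_real_differentiable)
    then have "((\<lambda>\<xi>. (deriv f (x + \<xi>) - deriv f x) / \<xi> / 2) \<longlongrightarrow> deriv (deriv f) x / 2) (at 0)"
      unfolding DERIV_def by (rule tendsto_divide) auto
    then show "((\<lambda>\<xi>. (deriv f (x + \<xi>) - deriv f x) / (2 * \<xi>)) \<longlongrightarrow> deriv (deriv f) x / 2) (at 0)"
      by (simp add: mult.commute)
  qed
  then show ?thesis
    unfolding DERIV_def
    by (rule Lim_transform_eventually) (auto simp: eventually_at_filter power2_eq_square divide_simps)
qed

text \<open>
  The forward flux is \<open>\<psi>(\<xi>)\<close> and the backward flux is \<open>\<psi>(-\<xi>)\<close> for one function \<open>\<psi>\<close>, the product of the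
  difference quotient of \<open>f\<close> and of \<open>1 / s\<close> at the midpoint. At 0 each factor has half the derivative
  that it has in the continuous flux, so \<open>(\<psi>(\<xi>) - \<psi>(-\<xi>)) / \<xi>\<close> tends to \<open>2 \<psi>'(0)\<close>, the derivative of that flux.
\<close>

lemma flux_difference_tendsto:
  fixes f s :: "real \<Rightarrow> real"
  assumes ev: "\<forall>\<^sub>F z in nhds x. f differentiable at z" and d2: "deriv f differentiable at x"
    and s: "s differentiable at x" "s x \<noteq> 0"
  shows "((\<lambda>\<xi>. ((f (x + \<xi>) - f x) / (\<xi> * s (x + \<xi> / 2)) - (f x - f (x - \<xi>)) / (\<xi> * s (x - \<xi> / 2))) / \<xi>)
    \<longlongrightarrow> deriv (\<lambda>z. 1 / s z * deriv f z) x) (at_right 0)"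
proof -
  define \<phi> where "\<phi> \<xi> = (if \<xi> = 0 then deriv f x else (f (x + \<xi>) - f x) / \<xi>)" for \<xi>
  define \<psi> where "\<psi> \<xi> = \<phi> \<xi> / s (x + \<xi> / 2)" for \<xi>
  define c where "c = (deriv (deriv f) x * s x - deriv f x * deriv s x) / (s x * s x)"
  have ds: "(s has_real_derivative deriv s x) (at x)" and df: "(deriv f has_real_derivative deriv (deriv f) x) (at x)"
    using s d2 by (simp_all add: DERIV_deriv_iff_real_differentiable)
  have "((\<lambda>z. 1 / s z * deriv f z) has_real_derivative c) (at x)"
    using DERIV_divide[OF df ds s(2)] by (simp add: c_def)
  then have c: "deriv (\<lambda>z. 1 / s z * deriv f z) x = c" by (rule DERIV_imp_deriv)
  have d\<phi>: "(\<phi> has_real_derivative deriv (deriv f) x / 2) (at 0)"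
    unfolding \<phi>_def using difference_quotient_has_derivative[OF ev d2] .
  have d\<rho>: "((\<lambda>\<xi>. s (x + \<xi> / 2)) has_real_derivative deriv s x / 2) (at 0)"
  proof -
    have "((\<lambda>\<xi>::real. x + \<xi> / 2) has_real_derivative 1 / 2) (at 0)"
      by (auto intro!: derivative_eq_intros)
    from DERIV_chain2[OF _ this, of s "deriv s x"] ds show ?thesis by simp
  qed
  have "(\<psi> has_real_derivative c / 2) (at 0)"
  proof -
    have "(deriv (deriv f) x / 2 * s (x + 0 / 2) - \<phi> 0 * (deriv s x / 2)) / (s (x + 0 / 2) * s (x + 0 / 2)) = c / 2"
      by (simp add: \<phi>_def c_def diff_divide_distrib)
    from DERIV_cong[OF DERIV_divide[OF d\<phi> d\<rho>] this] s(2) show ?thesis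
      by (simp add: \<psi>_def[abs_def])
  qed
  then have lim: "((\<lambda>\<xi>. (\<psi> \<xi> - \<psi> 0) / \<xi>) \<longlongrightarrow> c / 2) (at 0)"
    by (simp add: DERIV_def)
  have R: "((\<lambda>\<xi>. (\<psi> \<xi> - \<psi> 0) / \<xi>) \<longlongrightarrow> c / 2) (at_right 0)"
    using lim by (rule tendsto_mono[OF at_le, rotated]) simp
  have L: "((\<lambda>\<xi>. (\<psi> (- \<xi>) - \<psi> 0) / (- \<xi>)) \<longlongrightarrow> c / 2) (at_right 0)"
  proof (rule filterlim_compose[OF lim])
    show "filterlim (\<lambda>\<xi>::real. - \<xi>) (at 0) (at_right 0)"
      by (auto simp: filterlim_at eventually_at_filter intro!: tendsto_eq_intros)
  qed
  have "((\<lambda>\<xi>. (\<psi> \<xi> - \<psi> (- \<xi>)) / \<xi>) \<longlongrightarrow> c) (at_right 0)"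
    using tendsto_add[OF R L] by (simp add: diff_divide_distrib)
  then show ?thesis
    unfolding c
  proof (rule Lim_transform_eventually)
    have "\<psi> \<xi> = (f (x + \<xi>) - f x) / (\<xi> * s (x + \<xi> / 2))"
      "\<psi> (- \<xi>) = (f x - f (x - \<xi>)) / (\<xi> * s (x - \<xi> / 2))" if "0 < \<xi>" for \<xi>
    proof -
      have "(f (x - \<xi>) - f x) / (- \<xi>) = (f x - f (x - \<xi>)) / \<xi>"
        using minus_divide_divide[of "f x - f (x - \<xi>)" \<xi>] by (simp only: minus_diff_eq)
      then show "\<psi> (- \<xi>) = (f x - f (x - \<xi>)) / (\<xi> * s (x - \<xi> / 2))"
        using that by (simp only: \<psi>_def \<phi>_def) simp
    qed (use that in \<open>simp add: \<psi>_def \<phi>_def\<close>)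
    then show "\<forall>\<^sub>F \<xi> in at_right 0. (\<psi> \<xi> - \<psi> (- \<xi>)) / \<xi>
      = ((f (x + \<xi>) - f x) / (\<xi> * s (x + \<xi> / 2)) - (f x - f (x - \<xi>)) / (\<xi> * s (x - \<xi> / 2))) / \<xi>"
      by (simp add: eventually_at_filter)
  qed
qed

lemma planck_comp_regular:
  fixes g :: "real \<Rightarrow> real"
  assumes ev: "\<forall>\<^sub>F z in nhds x. g differentiable at z" and d2: "deriv g differentiable at x"
  shows "\<forall>\<^sub>F z in nhds x. (\<lambda>z. planck D (g z)) differentiable at z"
    "deriv (\<lambda>z. planck D (g z)) differentiable at x"
proof -
  let ?f' = "\<lambda>z. arad D * light D / (2 * pi) * (4 * g z ^ 3 * deriv g z)"
  have d: "\<forall>\<^sub>F z in nhds x. ((\<lambda>z. planck D (g z)) has_real_derivative ?f' z) (at z)"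
    using ev
  proof eventually_elim
    case (elim z)
    then have "(g has_real_derivative deriv g z) (at z)" by (simp add: DERIV_deriv_iff_real_differentiable)
    then show ?case unfolding planck_def by (auto intro!: derivative_eq_intros)
  qed
  then show "\<forall>\<^sub>F z in nhds x. (\<lambda>z. planck D (g z)) differentiable at z"
    by eventually_elim (auto simp: real_differentiable_def)
  have eq: "\<forall>\<^sub>F z in nhds x. deriv (\<lambda>z. planck D (g z)) z = ?f' z"
    using d by eventually_elim (rule DERIV_imp_deriv)
  have "(g has_real_derivative deriv g x) (at x)" "(deriv g has_real_derivative deriv (deriv g) x) (at x)"
    using eventually_nhds_x_imp_x[OF ev] d2 by (simp_all add: DERIV_deriv_iff_real_differentiable)
  then have "(?f' has_real_derivative arad D * light D / (2 * pi)
      * (4 * (3 * g x ^ 2 * deriv g x) * deriv g x + 4 * g x ^ 3 * deriv (deriv g) x)) (at x)"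
    by (auto intro!: derivative_eq_intros simp: field_simps)
  then show "deriv (\<lambda>z. planck D (g z)) differentiable at x"
    unfolding DERIV_cong_ev[OF refl eq refl, symmetric] by (auto simp: real_differentiable_def)
qed

lemma difference_quotient_tendsto:
  fixes f :: "real \<Rightarrow> real"
  assumes "f differentiable at t"
  shows "((\<lambda>\<tau>. (f (t + \<tau>) - f t) / \<tau>) \<longlongrightarrow> deriv f t) (at_right 0)"
proof -
  have "(f has_real_derivative deriv f t) (at t)"
    using assms by (simp add: DERIV_deriv_iff_real_differentiable)
  then show ?thesis unfolding DERIV_def by (rule tendsto_mono[OF at_le, rotated]) simp
qed

lemma explicit_residual_tendsto:
  assumes D: "rte_discretization D" and reg: "regular_at D T t p"
  shows "((\<lambda>(\<tau>, \<xi>, \<eta>). explicit_residual D T t p \<tau> \<xi> \<eta>) \<longlongrightarrow> rosseland_residual D T t p)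
    (at_right 0 \<times>\<^sub>F at_right 0 \<times>\<^sub>F at_right 0)"
proof -
  obtain x y where p: "p = (x, y)" by (cases p)
  note reg = reg[unfolded regular_at_def p, simplified]
  have s0: "sigt D q \<noteq> 0" for q
    using D unfolding rte_discretization_def by (metis less_irrefl less_le_trans)
  let ?T = "\<lambda>t'. T t' (x, y)"
  let ?bx = "\<lambda>z. planck D (T t (z, y))" and ?by = "\<lambda>z. planck D (T t (x, z))"
  have Td: "?T differentiable at t" using reg by blast
  then have Bd: "(\<lambda>t'. planck D (?T t')) differentiable at t"
    unfolding planck_def by (intro differentiable_mult differentiable_power) auto
  have time: "((\<lambda>\<tau>. cnu D * ((?T (t + \<tau>) - ?T t) / \<tau>)
        + 2 * pi / light D * ((planck D (?T (t + \<tau>)) - planck D (?T t)) / \<tau>))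
      \<longlongrightarrow> cnu D * deriv ?T t + 2 * pi / light D * deriv (\<lambda>t'. planck D (?T t')) t) (at_right 0)"
    by (intro tendsto_intros difference_quotient_tendsto Td Bd)
  have xdir: "((\<lambda>\<xi>. ((?bx (x + \<xi>) - ?bx x) / (\<xi> * sigt D (x + \<xi> / 2, y))
        - (?bx x - ?bx (x - \<xi>)) / (\<xi> * sigt D (x - \<xi> / 2, y))) / \<xi>)
      \<longlongrightarrow> deriv (\<lambda>z. 1 / sigt D (z, y) * deriv ?bx z) x) (at_right 0)"
    using reg s0 by (intro flux_difference_tendsto planck_comp_regular) auto
  have ydir: "((\<lambda>\<eta>. ((?by (y + \<eta>) - ?by y) / (\<eta> * sigt D (x, y + \<eta> / 2))
        - (?by y - ?by (y - \<eta>)) / (\<eta> * sigt D (x, y - \<eta> / 2))) / \<eta>)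
      \<longlongrightarrow> deriv (\<lambda>z. 1 / sigt D (x, z) * deriv ?by z) y) (at_right 0)"
    using reg s0 by (intro flux_difference_tendsto planck_comp_regular) auto
  let ?F = "at_right 0 \<times>\<^sub>F at_right 0 \<times>\<^sub>F at_right (0::real) :: (real \<times> real \<times> real) filter"
  have proj: "filterlim fst (at_right 0) ?F" "filterlim (\<lambda>q. fst (snd q)) (at_right 0) ?F"
    "filterlim (\<lambda>q. snd (snd q)) (at_right 0) ?F"
    by (intro filterlim_fst filterlim_compose[OF filterlim_fst filterlim_snd] filterlim_compose[OF filterlim_snd filterlim_snd])+
  note lims = filterlim_compose[OF time proj(1)] filterlim_compose[OF xdir proj(2)] filterlim_compose[OF ydir proj(3)]
  show ?thesis
    unfolding rosseland_residual_def p
    by (rule tendsto_eq_rhs, rule Lim_transform_eventually,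
        rule tendsto_diff[OF lims(1) tendsto_mult[OF tendsto_const[of "2 * pi / 3"] tendsto_add[OF lims(2,3)]]])
      (auto simp: explicit_residual_def five_point_def intro!: always_eventually)
qed

section \<open>Asymptotic preservation\<close>

theorem theorem5:
  fixes D :: rte and \<theta> :: real
  assumes "rte_discretization D" and "0 \<le> \<theta>"
  shows
    \<comment> \<open>the formal limit of the scheme is exactly the discrete Rosseland equation\<close>
    "(\<forall>T h X S V T1 h1 X1 S1 V1.
        bug_step D \<theta> 0 T h X S V T1 h1 X1 S1 V1 \<longrightarrow> rosseland_lhs D T T1 = rosseland_rhs D T) \<and>
     \<comment> \<open>bounded solutions of the scheme satisfy it up to an error vanishing as \<open>\<epsilon>\<close> tends to 0\<close>
     (\<forall>T h X S V T1 h1 X1 S1 V1.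
        (\<forall>\<^sub>F \<epsilon> in at_right 0. bug_step D \<theta> \<epsilon> (T \<epsilon>) (h \<epsilon>) (X \<epsilon>) (S \<epsilon>) (V \<epsilon>)
                                     (T1 \<epsilon>) (h1 \<epsilon>) (X1 \<epsilon>) (S1 \<epsilon>) (V1 \<epsilon>)) \<and>
        (\<forall>i<NC D. Bfun (\<lambda>\<epsilon>. vec_index (T \<epsilon>) i) (at_right 0) \<and> Bfun (\<lambda>\<epsilon>. vec_index (h \<epsilon>) i) (at_right 0) \<and>
                   Bfun (\<lambda>\<epsilon>. vec_index (T1 \<epsilon>) i) (at_right 0) \<and> Bfun (\<lambda>\<epsilon>. vec_index (h1 \<epsilon>) i) (at_right 0)) \<and>
        (\<forall>i<NI D. \<forall>l<Nq D. Bfun (\<lambda>\<epsilon>. (X \<epsilon> * S \<epsilon> * (V \<epsilon>)\<^sup>T) $$ (i, l)) (at_right 0) \<and>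
                             Bfun (\<lambda>\<epsilon>. (X1 \<epsilon> * S1 \<epsilon> * (V1 \<epsilon>)\<^sup>T) $$ (i, l)) (at_right 0))
        \<longrightarrow> (\<forall>i<NC D. ((\<lambda>\<epsilon>. vec_index (rosseland_lhs D (T \<epsilon>) (T1 \<epsilon>)) i - vec_index (rosseland_rhs D (T \<epsilon>)) i)
                         \<longlongrightarrow> 0) (at_right 0))) \<and>
     \<comment> \<open>the discrete diffusion operator is the centered 5-point stencil\<close>
     (\<forall>U\<in>carrier_vec (NC D). \<forall>u. \<forall>i<NC D. let k = KC D ! i in
        {k + (1, 0), k - (1, 0), k + (0, 1), k - (0, 1)} \<subseteq> set (KI D) \<and>
        (\<forall>k'\<in>{k, k + (2, 0), k - (2, 0), k + (0, 2), k - (0, 2)}. u (pos D k') = ghost_ext D U k')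
        \<longrightarrow> vec_index (disc_diffusion D U) i = five_point (dx D) (dy D) (sigt D) u (pos D k)) \<and>
     \<comment> \<open>with explicit time differencing, it is consistent with the Rosseland equation\<close>
     (\<forall>T t p. regular_at D T t p
        \<longrightarrow> ((\<lambda>(\<tau>, \<xi>, \<eta>). explicit_residual D T t p \<tau> \<xi> \<eta>) \<longlongrightarrow> rosseland_residual D T t p)
              (at_right 0 \<times>\<^sub>F at_right 0 \<times>\<^sub>F at_right 0))"
proof (intro conjI)
  show "\<forall>T h X S V T1 h1 X1 S1 V1.
      bug_step D \<theta> 0 T h X S V T1 h1 X1 S1 V1 \<longrightarrow> rosseland_lhs D T T1 = rosseland_rhs D T"
  proof (intro allI impI)
    fix T h X S V T1 h1 X1 S1 V1
    assume step: "bug_step D \<theta> 0 T h X S V T1 h1 X1 S1 V1"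
    obtain C where "\<forall>\<^sub>F \<epsilon> in principal {0}. \<forall>i<NC D.
        \<bar>vec_index (rosseland_lhs D T T1) i - vec_index (rosseland_rhs D T) i\<bar> \<le> C * \<epsilon>"
      by (rule rosseland_gap_eventually[OF assms(1), of \<theta> "\<lambda>_. T" "\<lambda>_. h" "\<lambda>_. X" "\<lambda>_. S" "\<lambda>_. V"
            "\<lambda>_. T1" "\<lambda>_. h1" "\<lambda>_. X1" "\<lambda>_. S1" "\<lambda>_. V1" "principal {0}"])
        (auto simp: eventually_principal step)
    then have gap: "vec_index (rosseland_lhs D T T1) i = vec_index (rosseland_rhs D T) i" if "i < NC D" for i
      using that by (simp add: eventually_principal)
    have "dim_vec T = NC D" using step by (auto simp: bug_step_def)
    then have "dim_vec (rosseland_lhs D T T1) = NC D" "dim_vec (rosseland_rhs D T) = NC D"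
      by (simp_all add: rosseland_lhs_def rosseland_rhs_def disc_diffusion_def)
    then show "rosseland_lhs D T T1 = rosseland_rhs D T"
      by (intro eq_vecI) (simp_all add: gap)
  qed
  show "\<forall>T h X S V T1 h1 X1 S1 V1.
        (\<forall>\<^sub>F \<epsilon> in at_right 0. bug_step D \<theta> \<epsilon> (T \<epsilon>) (h \<epsilon>) (X \<epsilon>) (S \<epsilon>) (V \<epsilon>)
                                     (T1 \<epsilon>) (h1 \<epsilon>) (X1 \<epsilon>) (S1 \<epsilon>) (V1 \<epsilon>)) \<and>
        (\<forall>i<NC D. Bfun (\<lambda>\<epsilon>. vec_index (T \<epsilon>) i) (at_right 0) \<and> Bfun (\<lambda>\<epsilon>. vec_index (h \<epsilon>) i) (at_right 0) \<and>
                   Bfun (\<lambda>\<epsilon>. vec_index (T1 \<epsilon>) i) (at_right 0) \<and> Bfun (\<lambda>\<epsilon>. vec_index (h1 \<epsilon>) i) (at_right 0)) \<and>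
        (\<forall>i<NI D. \<forall>l<Nq D. Bfun (\<lambda>\<epsilon>. (X \<epsilon> * S \<epsilon> * (V \<epsilon>)\<^sup>T) $$ (i, l)) (at_right 0) \<and>
                             Bfun (\<lambda>\<epsilon>. (X1 \<epsilon> * S1 \<epsilon> * (V1 \<epsilon>)\<^sup>T) $$ (i, l)) (at_right 0))
        \<longrightarrow> (\<forall>i<NC D. ((\<lambda>\<epsilon>. vec_index (rosseland_lhs D (T \<epsilon>) (T1 \<epsilon>)) i - vec_index (rosseland_rhs D (T \<epsilon>)) i)
                         \<longlongrightarrow> 0) (at_right 0))"
  proof (intro allI impI, elim conjE)
    fix T h X S V T1 h1 X1 S1 V1 and i
    assume step: "\<forall>\<^sub>F \<epsilon> in at_right 0. bug_step D \<theta> \<epsilon> (T \<epsilon>) (h \<epsilon>) (X \<epsilon>) (S \<epsilon>) (V \<epsilon>)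
        (T1 \<epsilon>) (h1 \<epsilon>) (X1 \<epsilon>) (S1 \<epsilon>) (V1 \<epsilon>)"
      and b: "\<forall>i<NC D. Bfun (\<lambda>\<epsilon>. vec_index (T \<epsilon>) i) (at_right 0) \<and> Bfun (\<lambda>\<epsilon>. vec_index (h \<epsilon>) i) (at_right 0) \<and>
                   Bfun (\<lambda>\<epsilon>. vec_index (T1 \<epsilon>) i) (at_right 0) \<and> Bfun (\<lambda>\<epsilon>. vec_index (h1 \<epsilon>) i) (at_right 0)"
      and bg: "\<forall>i<NI D. \<forall>l<Nq D. Bfun (\<lambda>\<epsilon>. (X \<epsilon> * S \<epsilon> * (V \<epsilon>)\<^sup>T) $$ (i, l)) (at_right 0) \<and>
                             Bfun (\<lambda>\<epsilon>. (X1 \<epsilon> * S1 \<epsilon> * (V1 \<epsilon>)\<^sup>T) $$ (i, l)) (at_right 0)"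
      and i: "i < NC D"
    have small: "\<forall>\<^sub>F \<epsilon>::real in at_right 0. 0 \<le> \<epsilon> \<and> \<epsilon> \<le> 1"
      by (auto simp: eventually_at_right_field intro!: exI[of _ 1])
    obtain C where "\<forall>\<^sub>F \<epsilon> in at_right 0. \<forall>i<NC D.
        \<bar>vec_index (rosseland_lhs D (T \<epsilon>) (T1 \<epsilon>)) i - vec_index (rosseland_rhs D (T \<epsilon>)) i\<bar> \<le> C * \<epsilon>"
      by (rule rosseland_gap_eventually[OF assms(1) step small]) (use b bg in auto)
    then have "\<forall>\<^sub>F \<epsilon> in at_right 0.
        norm (vec_index (rosseland_lhs D (T \<epsilon>) (T1 \<epsilon>)) i - vec_index (rosseland_rhs D (T \<epsilon>)) i) \<le> C * \<epsilon>"
      by eventually_elim (use i in simp)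
    moreover have "((\<lambda>\<epsilon>. C * \<epsilon>) \<longlongrightarrow> 0) (at_right 0)"
      by (auto intro!: tendsto_eq_intros)
    ultimately show "((\<lambda>\<epsilon>. vec_index (rosseland_lhs D (T \<epsilon>) (T1 \<epsilon>)) i - vec_index (rosseland_rhs D (T \<epsilon>)) i)
        \<longlongrightarrow> 0) (at_right 0)"
      by (rule Lim_null_comparison)
  qed
qed (use disc_diffusion_five_point[OF assms(1)] explicit_residual_tendsto[OF assms(1)] in \<open>auto simp: Let_def\<close>)

end
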